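(* Let $\tau>0$, $x_{\max}>c>0$, $\alpha_{\max}=\ln(x_{\max}/c)/\big((x_{\max}/c)-1\big)$, and suppose $\alpha\in(0,\pi\alpha_{\max}/2)$. Let $B$ be the map sending an input $f\in W_2$ to the pair $(y,u)\in W_{2e}\times L_{2e}$ determined by the interconnection $$y=Gu+f,\qquad u=\Delta y,$$ with $G$ and $\Delta$ as defined in the context. Then $B$ is $W_2\times L_2$ stable on $W_2$: $B$ maps $W_2$ into $W_2\times L_2$ and there exists a constant $b$ such that $\|B f\|_{W_2\times L_2}\le b\,\|f\|_{W_2}$ for all $f\in W_2$.
   Context: All signals are real-valued functions on $[0,\infty)$, extended by $0$ for $t<0$. $L_2=L_2[0,\infty)$; $L_{2e}$ is the space of functions whose restriction to $[0,T]$ is square integrable for every $T>0$. $W_2=\{y\in L_2:\dot y\in L_2\}$ (absolutely continuous on $[0,\infty)$) with inner product $\langle x,y\rangle_{W_2}=\langle x,y\rangle_{L_2}+\langle\dot x,\dot y\rangle_{L_2}$, and $W_{2e}=\{y\in L_{2e}:\dot y\in L_{2e}\}$. Let $p_0=\frac{\tau}{\alpha}\ln\frac{x_{\max}}{c}$ and $$f_1(y)=\min\{e^{\frac{\alpha}{\tau}y}-1,\ e^{\frac{\alpha}{\tau}p_0}-1\},\qquad f_2(y)=\max\{0,f_1(y)\},\qquad f_c(x,y)=\begin{cases}f_1(y)& x>-p_0,\\ f_2(y)&\text{otherwise.}\end{cases}$$ $G$ is the linear operator $(Gu)(t)=\int_{t-\tau}^t u(\theta)\,d\theta$. The map $\Delta_z$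 is defined by $z=\Delta_z y$ if $z$ is absolutely continuous, $z(0)=0$ and $\dot z(t)=f_c(z(t),y(t)-z(t))$ for (almost every) $t\ge0$. The map $\Delta$ is defined by $v=\Delta y$ if $v=\dot z$ with $z=\Delta_z y$. (For every $f\in W_2$ the interconnection has a unique solution $(y,u)\in W_{2e}\times L_{2e}$.) *)

theory Defs
  imports "HOL-Analysis.Analysis"
begin

text \<open>
  A signal is a function on the whole real line vanishing for negative times. Elements of
  \<open>L2\<close>, \<open>L2e\<close> are represented by functions rather than by classes modulo null sets.
\<close>

definition signal :: "(real \<Rightarrow> real) \<Rightarrow> bool" where
  "signal f \<longleftrightarrow> (\<forall>t<0. f t = 0)"

definition square_integrable_on :: "(real \<Rightarrow> real) \<Rightarrow> real set \<Rightarrow> bool" where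
  "square_integrable_on f S \<longleftrightarrow>
     f \<in> borel_measurable (lebesgue_on S) \<and> integrable (lebesgue_on S) (\<lambda>t. (f t)\<^sup>2)"

definition L2 :: "(real \<Rightarrow> real) set" where
  "L2 = {f. signal f \<and> square_integrable_on f {0..}}"

definition L2e :: "(real \<Rightarrow> real) set" where
  "L2e = {f. signal f \<and> (\<forall>T>0. square_integrable_on f {0..T})}"

definition L2_norm :: "(real \<Rightarrow> real) \<Rightarrow> real" where
  "L2_norm f = sqrt (LINT t|lebesgue_on {0..}. (f t)\<^sup>2)"

definition abs_continuous_on :: "real set \<Rightarrow> (real \<Rightarrow> real) \<Rightarrow> bool" where
  "abs_continuous_on S f \<longleftrightarrow>
     (\<forall>\<epsilon>>0. \<exists>\<delta>>0. \<forall>(n::nat) a b.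
        (\<forall>i<n. a i \<le> b i \<and> {a i..b i} \<subseteq> S) \<and>
        (\<forall>i<n. \<forall>j<n. i \<noteq> j \<longrightarrow> {a i<..<b i} \<inter> {a j<..<b j} = {}) \<and>
        (\<Sum>i<n. b i - a i) < \<delta>
        \<longrightarrow> (\<Sum>i<n. \<bar>f (b i) - f (a i)\<bar>) < \<epsilon>)"

text \<open>
  Absolute continuity on \<open>[0,\<infinity>)\<close> is taken on every compact \<open>[0,T]\<close>; for functions whose
  derivative is square integrable on \<open>[0,\<infinity>)\<close> this agrees with the condition on all of \<open>[0,\<infinity>)\<close>.
\<close>

definition loc_abs_continuous :: "(real \<Rightarrow> real) \<Rightarrow> bool" where
  "loc_abs_continuous f \<longleftrightarrow> (\<forall>T>0. abs_continuous_on {0..T} f)"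

text \<open>
  The clause on differentiability almost everywhere is implied by absolute continuity (Lebesgue);
  it records that \<open>deriv y\<close> is the genuine derivative outside a null set.
\<close>

definition W2 :: "(real \<Rightarrow> real) set" where
  "W2 = {y. loc_abs_continuous y \<and>
            (AE t in lebesgue_on {0..}. y differentiable (at t)) \<and>
            y \<in> L2 \<and> deriv y \<in> L2}"

definition W2e :: "(real \<Rightarrow> real) set" where
  "W2e = {y. loc_abs_continuous y \<and>
             (AE t in lebesgue_on {0..}. y differentiable (at t)) \<and>
             y \<in> L2e \<and> deriv y \<in> L2e}"

definition W2_norm :: "(real \<Rightarrow> real) \<Rightarrow> real" where
  "W2_norm y = sqrt ((LINT t|lebesgue_on {0..}. (y t)\<^sup>2) +
                     (LINT t|lebesgue_on {0..}. (deriv y t)\<^sup>2))"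

definition W2_L2_norm :: "(real \<Rightarrow> real) \<times> (real \<Rightarrow> real) \<Rightarrow> real" where
  "W2_L2_norm p = sqrt ((W2_norm (fst p))\<^sup>2 + (L2_norm (snd p))\<^sup>2)"

definition \<alpha>_max :: "real \<Rightarrow> real \<Rightarrow> real" where
  "\<alpha>_max xmax c = ln (xmax / c) / (xmax / c - 1)"

definition p0 :: "real \<Rightarrow> real \<Rightarrow> real \<Rightarrow> real \<Rightarrow> real" where
  "p0 \<tau> \<alpha> xmax c = \<tau> / \<alpha> * ln (xmax / c)"

definition f1 :: "real \<Rightarrow> real \<Rightarrow> real \<Rightarrow> real \<Rightarrow> real \<Rightarrow> real" where
  "f1 \<tau> \<alpha> xmax c y =
     min (exp (\<alpha> / \<tau> * y) - 1) (exp (\<alpha> / \<tau> * p0 \<tau> \<alpha> xmax c) - 1)"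

definition f2 :: "real \<Rightarrow> real \<Rightarrow> real \<Rightarrow> real \<Rightarrow> real \<Rightarrow> real" where
  "f2 \<tau> \<alpha> xmax c y = max 0 (f1 \<tau> \<alpha> xmax c y)"

definition fc :: "real \<Rightarrow> real \<Rightarrow> real \<Rightarrow> real \<Rightarrow> real \<Rightarrow> real \<Rightarrow> real" where
  "fc \<tau> \<alpha> xmax c x y =
     (if x > - p0 \<tau> \<alpha> xmax c then f1 \<tau> \<alpha> xmax c y else f2 \<tau> \<alpha> xmax c y)"

definition G :: "real \<Rightarrow> (real \<Rightarrow> real) \<Rightarrow> real \<Rightarrow> real" where
  "G \<tau> u t = (LINT \<theta>|lebesgue_on {t - \<tau>..t}. u \<theta>)"

definition \<Delta>z :: "real \<Rightarrow> real \<Rightarrow> real \<Rightarrow> real \<Rightarrow> (real \<Rightarrow> real) \<Rightarrow> (real \<Rightarrow> real) \<Rightarrow> bool" where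
  "\<Delta>z \<tau> \<alpha> xmax c y z \<longleftrightarrow>
     signal z \<and> loc_abs_continuous z \<and> z 0 = 0 \<and>
     (AE t in lebesgue_on {0..}.
        (z has_real_derivative fc \<tau> \<alpha> xmax c (z t) (y t - z t)) (at t))"

definition \<Delta> :: "real \<Rightarrow> real \<Rightarrow> real \<Rightarrow> real \<Rightarrow> (real \<Rightarrow> real) \<Rightarrow> (real \<Rightarrow> real) \<Rightarrow> bool" where
  "\<Delta> \<tau> \<alpha> xmax c y v \<longleftrightarrow>
     signal v \<and>
     (\<exists>z. \<Delta>z \<tau> \<alpha> xmax c y z \<and>
          (AE t in lebesgue_on {0..}. (z has_real_derivative v t) (at t)))"

text \<open>
  The closed-loop map as a relation between the input and the pair of internal signals: the
  second component is determined only up to null sets.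
\<close>

definition closed_loop ::
  "real \<Rightarrow> real \<Rightarrow> real \<Rightarrow> real \<Rightarrow> (real \<Rightarrow> real) \<Rightarrow> (real \<Rightarrow> real) \<times> (real \<Rightarrow> real) \<Rightarrow> bool" where
  "closed_loop \<tau> \<alpha> xmax c f = (\<lambda>(y, u).
     y \<in> W2e \<and> u \<in> L2e \<and> (\<forall>t\<ge>0. y t = G \<tau> u t + f t) \<and> \<Delta> \<tau> \<alpha> xmax c y u)"

definition W2_L2_stable_on_W2 ::
  "((real \<Rightarrow> real) \<Rightarrow> (real \<Rightarrow> real) \<times> (real \<Rightarrow> real) \<Rightarrow> bool) \<Rightarrow> bool" where
  "W2_L2_stable_on_W2 B \<longleftrightarrow>
     (\<forall>f\<in>W2. (\<exists>p. B f p) \<and> (\<forall>p. B f p \<longrightarrow> p \<in> W2 \<times> L2)) \<and>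
     (\<exists>b. \<forall>f\<in>W2. \<forall>p. B f p \<longrightarrow> W2_L2_norm p \<le> b * W2_norm f)"

end

theory Submission
  imports Defs
begin

text \<open>
  Write \<open>z\<close> for the internal state of \<open>\<Delta>\<close>, \<open>v = z'\<close> and \<open>w = y - z\<close>. As \<open>G v = z - z(\<cdot> - \<tau>)\<close>, closing the
  loop gives \<open>w = f - z(\<cdot> - \<tau>)\<close>, so the loop is the scalar delay equation \<open>z'(t) = f\<^sub>c(z(t), f(t) - z(t - \<tau>))\<close>.
  The function \<open>f\<^sub>1\<close> lies in the sector \<open>[0, k]\<close> with \<open>k = (x\<^sub>m\<^sub>a\<^sub>x/c - 1)/p\<^sub>0\<close>, by convexity of the exponential up
  to the saturation point, and \<open>k \<tau> = \<alpha>/\<alpha>\<^sub>m\<^sub>a\<^sub>x\<close>; the hypothesis on \<open>\<alpha>\<close> says \<open>k \<tau> < \<pi>/2\<close>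
  (\<open>congestion_feedback\<close>). The theorem is the Popov criterion for this loop, proved on finite horizons \<open>[0,T]\<close>
  with constants independent of \<open>T\<close>.

  Three inequalities carry it. The sector condition and \<open>\<integral> v z = z(T)\<^sup>2/2 \<ge> 0\<close> give
  \<open>\<integral> v\<^sup>2/k - \<integral> v G v \<le> \<integral> v f\<close> (\<open>sector_inequality\<close>). The Popov term \<open>\<integral> v w' \<ge> - const \<cdot> f(0)\<^sup>2\<close> gives
  \<open>\<integral> v v(\<cdot> - \<tau>) \<le> \<integral> v f' + k f(0)\<^sup>2\<close> (\<open>popov_inequality\<close>); it survives the switching in \<open>f\<^sub>c\<close> because
  the additional term that a smoothed switch produces has a favourable sign, and \<open>f(0)\<^sup>2\<close> is bounded by the norm of the
  input (\<open>initial_value_bound\<close>). Finally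
  \<open>2/\<pi> \<integral> v\<^sup>2 + 4/\<pi>\<^sup>2 \<integral> v v(\<cdot> - \<tau>) - \<integral> v G v / \<tau> \<ge> 0\<close> for every bounded signal (\<open>coercivity\<close>), which is the
  frequency inequality \<open>sin x \<le> x (2/\<pi> + (4/\<pi>\<^sup>2) cos x)\<close> for \<open>x \<ge> 0\<close> (\<open>critical_symbol\<close>). Their combination leaves the
  margin \<open>1/(k \<tau>) - 2/\<pi> > 0\<close> in front of \<open>\<integral> v\<^sup>2\<close> (\<open>energy_bound\<close>), and the bounds on \<open>y\<close> and \<open>y'\<close> follow
  from \<open>y = f + z - z(\<cdot> - \<tau>)\<close>.

  The passage from frequencies to signals avoids Plancherel's theorem. Replace \<open>v\<close> by the difference quotient of
  \<open>z\<close> with step \<open>h = \<tau>/n\<close>. Sampling along \<open>t + h \<int>\<close> turns the quadratic form into a Toeplitz form, whose positivity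
  needs only the orthogonality of finitely many cosines (\<open>toeplitz_form_nonneg\<close>); sums of delayed quotients telescope
  to \<open>z - z(\<cdot> - \<tau>)\<close> exactly, so \<open>n \<rightarrow> \<infinity>\<close> is a plain dominated convergence (\<open>delay_form_nonneg\<close>).

  Existence of the loop signals is obtained by the method of steps. On each delay interval the input of the
  nonlinearity is known and the equation with switching is solved by Skorokhod reflection at the barrier \<open>-p\<^sub>0\<close>
  (\<open>reflected_solution\<close>), which is differentiable outside a countable set because its input is continuous.
\<close>

section \<open>Absolutely continuous functions and the fundamental theorem of calculus\<close>

definition nonoverlapping_in :: "real set \<Rightarrow> nat \<Rightarrow> (nat \<Rightarrow> real) \<Rightarrow> (nat \<Rightarrow> real) \<Rightarrow> bool" where
  "nonoverlapping_in S n a b \<longleftrightarrow> (\<forall>i<n. a i \<le> b i \<and> {a i..b i} \<subseteq> S) \<and>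
     (\<forall>i<n. \<forall>j<n. i \<noteq> j \<longrightarrow> {a i<..<b i} \<inter> {a j<..<b j} = {})"

lemma abs_continuous_on_iff:
  "abs_continuous_on S f \<longleftrightarrow> (\<forall>\<epsilon>>0. \<exists>\<delta>>0. \<forall>n a b.
     nonoverlapping_in S n a b \<longrightarrow> (\<Sum>i<n. b i - a i) < \<delta> \<longrightarrow> (\<Sum>i<n. \<bar>f (b i) - f (a i)\<bar>) < \<epsilon>)"
  unfolding abs_continuous_on_def nonoverlapping_in_def by (simp only: conj_assoc imp_conjL)

lemma abs_continuous_onE:
  assumes "abs_continuous_on S f" "0 < \<epsilon>"
  obtains \<delta> where "0 < \<delta>" "\<And>n a b. nonoverlapping_in S n a b \<Longrightarrow>
      (\<Sum>i<n. b i - a i) < \<delta> \<Longrightarrow> (\<Sum>i<n. \<bar>f (b i) - f (a i)\<bar>) < \<epsilon>"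
  using assms unfolding abs_continuous_on_iff by blast

text \<open>
  Lipschitz functions, sums, products and \<open>C\<^sup>1\<close> images are all dominated in this sense, so the epsilon-delta
  argument is carried out only here.
\<close>

lemma abs_continuous_on_dominated:
  assumes g: "abs_continuous_on S g" and h: "abs_continuous_on S h"
    and C: "\<And>s t. s \<in> S \<Longrightarrow> t \<in> S \<Longrightarrow> \<bar>f t - f s\<bar> \<le> C * (\<bar>g t - g s\<bar> + \<bar>h t - h s\<bar>)"
  shows "abs_continuous_on S f"
  unfolding abs_continuous_on_iff
proof (intro allI impI)
  fix \<epsilon> :: real assume "0 < \<epsilon>"
  define K where "K = \<bar>C\<bar> + 1"
  have K: "0 < K" "C \<le> K" by (auto simp: K_def)
  define e where "e = \<epsilon> / (2 * K)"
  have e: "0 < e" using \<open>0 < \<epsilon>\<close> K by (simp add: e_def)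
  obtain d1 where d1: "0 < d1" "\<And>n a b. nonoverlapping_in S n a b \<Longrightarrow>
      (\<Sum>i<n. b i - a i) < d1 \<Longrightarrow> (\<Sum>i<n. \<bar>g (b i) - g (a i)\<bar>) < e"
    using abs_continuous_onE[OF g e] by blast
  obtain d2 where d2: "0 < d2" "\<And>n a b. nonoverlapping_in S n a b \<Longrightarrow>
      (\<Sum>i<n. b i - a i) < d2 \<Longrightarrow> (\<Sum>i<n. \<bar>h (b i) - h (a i)\<bar>) < e"
    using abs_continuous_onE[OF h e] by blast
  show "\<exists>\<delta>>0. \<forall>n a b. nonoverlapping_in S n a b \<longrightarrow> (\<Sum>i<n. b i - a i) < \<delta> \<longrightarrow> (\<Sum>i<n. \<bar>f (b i) - f (a i)\<bar>) < \<epsilon>"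
  proof (intro exI[of _ "min d1 d2"] conjI allI impI)
    show "0 < min d1 d2" using d1 d2 by simp
    fix n :: nat and a b :: "nat \<Rightarrow> real"
    assume *: "nonoverlapping_in S n a b" "(\<Sum>i<n. b i - a i) < min d1 d2"
    have 1: "(\<Sum>i<n. \<bar>g (b i) - g (a i)\<bar>) < e" by (rule d1(2)) (use * in auto)
    have 2: "(\<Sum>i<n. \<bar>h (b i) - h (a i)\<bar>) < e" by (rule d2(2)) (use * in auto)
    have "(\<Sum>i<n. \<bar>f (b i) - f (a i)\<bar>) \<le> (\<Sum>i<n. K * (\<bar>g (b i) - g (a i)\<bar> + \<bar>h (b i) - h (a i)\<bar>))"
    proof (rule sum_mono)
      fix i assume "i \<in> {..<n}"
      then have "\<bar>f (b i) - f (a i)\<bar> \<le> C * (\<bar>g (b i) - g (a i)\<bar> + \<bar>h (b i) - h (a i)\<bar>)"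
        using *(1) by (intro C) (auto simp: nonoverlapping_in_def subset_eq)
      also have "\<dots> \<le> K * (\<bar>g (b i) - g (a i)\<bar> + \<bar>h (b i) - h (a i)\<bar>)"
        using K by (intro mult_right_mono) auto
      finally show "\<bar>f (b i) - f (a i)\<bar> \<le> K * (\<bar>g (b i) - g (a i)\<bar> + \<bar>h (b i) - h (a i)\<bar>)" .
    qed
    also have "\<dots> = K * ((\<Sum>i<n. \<bar>g (b i) - g (a i)\<bar>) + (\<Sum>i<n. \<bar>h (b i) - h (a i)\<bar>))"
      by (simp add: sum_distrib_left[symmetric] sum.distrib)
    also have "\<dots> < K * (e + e)" using 1 2 K by (intro mult_strict_left_mono add_strict_mono) auto
    also have "\<dots> = \<epsilon>" using K by (simp add: e_def)
    finally show "(\<Sum>i<n. \<bar>f (b i) - f (a i)\<bar>) < \<epsilon>" .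
  qed
qed

lemma abs_continuous_on_id: "abs_continuous_on S (\<lambda>t. t)"
  unfolding abs_continuous_on_iff
proof (intro allI impI)
  fix \<epsilon> :: real assume "0 < \<epsilon>"
  show "\<exists>\<delta>>0. \<forall>n a b. nonoverlapping_in S n a b \<longrightarrow> (\<Sum>i<n. b i - a i) < \<delta> \<longrightarrow> (\<Sum>i<n. \<bar>b i - a i\<bar>) < \<epsilon>"
  proof (intro exI[of _ \<epsilon>] conjI allI impI \<open>0 < \<epsilon>\<close>)
    fix n :: nat and a b :: "nat \<Rightarrow> real"
    assume *: "nonoverlapping_in S n a b" "(\<Sum>i<n. b i - a i) < \<epsilon>"
    have "(\<Sum>i<n. \<bar>b i - a i\<bar>) = (\<Sum>i<n. b i - a i)" by (intro sum.cong) (use * in \<open>auto simp: nonoverlapping_in_def\<close>)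
    then show "(\<Sum>i<n. \<bar>b i - a i\<bar>) < \<epsilon>" using * by simp
  qed
qed

lemma abs_continuous_on_Lipschitz:
  assumes "\<And>s t. s \<in> S \<Longrightarrow> t \<in> S \<Longrightarrow> \<bar>f t - f s\<bar> \<le> L * \<bar>t - s\<bar>"
  shows "abs_continuous_on S f"
  using abs_continuous_on_dominated[where g = "\<lambda>t. t" and h = "\<lambda>t. t" and C = "L/2" and f = f,
      OF abs_continuous_on_id abs_continuous_on_id] assms by simp

lemma abs_continuous_on_subset:
  assumes f: "abs_continuous_on S f" and T: "T \<subseteq> S"
  shows "abs_continuous_on T f"
proof -
  have "nonoverlapping_in T n a b \<Longrightarrow> nonoverlapping_in S n a b" for n a b
    using T by (auto simp: nonoverlapping_in_def)
  then show ?thesis using f unfolding abs_continuous_on_iff by metis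
qed

lemma abs_continuous_on_add:
  assumes "abs_continuous_on S g" "abs_continuous_on S h"
  shows "abs_continuous_on S (\<lambda>t. g t + h t)"
  using abs_continuous_on_dominated[where C = 1 and f = "\<lambda>t. g t + h t", OF assms] by simp

lemma abs_continuous_on_imp_continuous_on:
  assumes f: "abs_continuous_on {a..b} f" shows "continuous_on {a..b} f"
  unfolding continuous_on_iff
proof (intro ballI allI impI)
  fix x e :: real assume x: "x \<in> {a..b}" and "0 < e"
  obtain d where d: "0 < d" "\<And>n p q. nonoverlapping_in {a..b} n p q \<Longrightarrow>
      (\<Sum>i<n. q i - p i) < d \<Longrightarrow> (\<Sum>i<n. \<bar>f (q i) - f (p i)\<bar>) < e"
    using abs_continuous_onE[OF f \<open>0 < e\<close>] by blast
  show "\<exists>d>0. \<forall>y\<in>{a..b}. dist y x < d \<longrightarrow> dist (f y) (f x) < e"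
  proof (intro exI[of _ d] conjI ballI impI d(1))
    fix y assume y: "y \<in> {a..b}" "dist y x < d"
    have "(\<Sum>i<Suc 0. \<bar>f (max x y) - f (min x y)\<bar>) < e"
      by (rule d(2)[where n = "Suc 0" and p = "\<lambda>_. min x y" and q = "\<lambda>_. max x y"])
         (use x y in \<open>auto simp: nonoverlapping_in_def dist_real_def max_def min_def\<close>)
    then show "dist (f y) (f x) < e" by (auto simp: dist_real_def max_def min_def split: if_splits)
  qed
qed

text \<open>
  The point of differentiability lies between \<open>u\<close> and \<open>v\<close>, hence the errors of the two one-sided expansions add
  up to a multiple of \<open>v - u\<close> itself.
\<close>

lemma straddle_real:
  assumes der: "(F has_real_derivative D) (at x within S)" and "0 < e"
  obtains d where "0 < d" "\<And>u v. u \<in> S \<Longrightarrow> v \<in> S \<Longrightarrow> u \<le> x \<Longrightarrow> x \<le> v \<Longrightarrow> \<bar>u - x\<bar> < d \<Longrightarrow> \<bar>v - x\<bar> < d \<Longrightarrow>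
     \<bar>F v - F u - D * (v - u)\<bar> \<le> e * (v - u)"
proof -
  obtain d where "0 < d" and d: "\<And>y. y \<in> S \<Longrightarrow> \<bar>y - x\<bar> < d \<Longrightarrow> \<bar>F y - F x - D * (y - x)\<bar> \<le> e * \<bar>y - x\<bar>"
    using der \<open>0 < e\<close> unfolding has_field_derivative_def has_derivative_within_alt real_norm_def by metis
  show ?thesis
  proof (rule that[OF \<open>0 < d\<close>])
    fix u v assume uv: "u \<in> S" "v \<in> S" "u \<le> x" "x \<le> v" "\<bar>u - x\<bar> < d" "\<bar>v - x\<bar> < d"
    have "\<bar>F v - F x - D * (v - x)\<bar> \<le> e * (v - x)" "\<bar>F u - F x - D * (u - x)\<bar> \<le> e * (x - u)"
      using d[of u] d[of v] uv by auto
    moreover have "F v - F u - D * (v - u) = (F v - F x - D * (v - x)) - (F u - F x - D * (u - x))"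
      by (simp add: algebra_simps)
    moreover have "e * (v - u) = e * (v - x) + e * (x - u)" by (simp add: algebra_simps)
    ultimately show "\<bar>F v - F u - D * (v - u)\<bar> \<le> e * (v - u)" by linarith
  qed
qed

lemma sum_lengths_le_measure:
  fixes a b :: "nat \<Rightarrow> real"
  assumes le: "\<And>i. i < n \<Longrightarrow> a i \<le> b i"
    and disj: "\<And>i j. i < n \<Longrightarrow> j < n \<Longrightarrow> i \<noteq> j \<Longrightarrow> {a i<..<b i} \<inter> {a j<..<b j} = {}"
    and sub: "\<And>i. i < n \<Longrightarrow> {a i<..<b i} \<subseteq> U" and U: "open U"
  shows "ennreal (\<Sum>i<n. b i - a i) \<le> emeasure lborel U"
proof -
  have "ennreal (\<Sum>i<n. b i - a i) = (\<Sum>i<n. ennreal (b i - a i))"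
    by (rule sum_ennreal[symmetric]) (use le in auto)
  also have "\<dots> = (\<Sum>i<n. emeasure lborel {a i<..<b i})"
    by (intro sum.cong) (use le in auto)
  also have "\<dots> = emeasure lborel (\<Union>i<n. {a i<..<b i})"
    by (rule sum_emeasure) (use disj in \<open>auto simp: disjoint_family_on_def\<close>)
  also have "\<dots> \<le> emeasure lborel U"
    by (rule emeasure_mono) (use sub U in auto)
  finally show ?thesis .
qed

text \<open>
  A direct gauge argument. At a point of differentiability the gauge comes from \<open>straddle_real\<close>. At a point of the
  null set \<open>N\<close> it forces the interval into an open set \<open>U \<supseteq> N\<close> of small measure: the intervals tagged there have
  small total length, and absolute continuity makes the sum of the increments of \<open>F\<close> over them small.
\<close>

lemma abs_continuous_FTC:
  fixes F :: "real \<Rightarrow> real"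
  assumes ab: "a \<le> b" and ac: "abs_continuous_on {a..b} F" and N: "negligible N"
    and der: "\<And>t. t \<in> {a..b} - N \<Longrightarrow> (F has_real_derivative D t) (at t within {a..b})"
  shows "(D has_integral (F b - F a)) {a..b}"
proof -
  define D' where "D' t = (if t \<in> N then 0 else D t)" for t
  have "(D' has_integral (F b - F a)) {a..b}"
    unfolding has_integral_real
  proof (intro allI impI)
    fix e :: real assume "0 < e"
    define e1 where "e1 = e / (2 * (b - a + 1))"
    have e1: "0 < e1" using \<open>0 < e\<close> ab by (simp add: e1_def)
    obtain \<delta> where \<delta>: "0 < \<delta>" "\<And>n p q. nonoverlapping_in {a..b} n p q \<Longrightarrow>
      (\<Sum>i<n. q i - p i) < \<delta> \<Longrightarrow> (\<Sum>i<n. \<bar>F (q i) - F (p i)\<bar>) < e/2"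
      using abs_continuous_onE[OF ac, of "e/2"] \<open>0 < e\<close> half_gt_zero by blast
    obtain U where U: "open U" "N \<subseteq> U" "emeasure lborel U < ennreal \<delta>"
    proof -
      have N0: "N \<in> null_sets lebesgue" using N by (simp add: negligible_iff_null_sets)
      obtain T where T: "open T" "N \<subseteq> T" "T - N \<in> lmeasurable" "emeasure lebesgue (T - N) < ennreal \<delta>"
        using sets_lebesgue_outer_open[of N \<delta>] N0 \<delta>(1) by blast
      have "emeasure lebesgue (T - N) = emeasure lebesgue T"
        using emeasure_Diff_null_set[OF N0, of T] T(1) by (simp add: borel_open)
      moreover have "emeasure lebesgue T = emeasure lborel T" using T(1) by (simp add: borel_open)
      ultimately show ?thesis using that[of T] T by simp
    qed
    have "\<exists>d>0. \<forall>u v. u \<in> {a..b} \<longrightarrow> v \<in> {a..b} \<longrightarrow> u \<le> x \<longrightarrow> x \<le> v \<longrightarrow> \<bar>u - x\<bar> < d \<longrightarrow> \<bar>v - x\<bar> < d \<longrightarrow>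
     \<bar>F v - F u - D x * (v - u)\<bar> \<le> e1 * (v - u)" if "x \<in> {a..b} - N" for x
      using straddle_real[OF der[OF that] e1] by metis
    then obtain r where r: "\<And>x. x \<in> {a..b} - N \<Longrightarrow> 0 < r x"
      "\<And>x u v. x \<in> {a..b} - N \<Longrightarrow> u \<in> {a..b} \<Longrightarrow> v \<in> {a..b} \<Longrightarrow> u \<le> x \<Longrightarrow> x \<le> v \<Longrightarrow> \<bar>u - x\<bar> < r x \<Longrightarrow> \<bar>v - x\<bar> < r x \<Longrightarrow>
     \<bar>F v - F u - D x * (v - u)\<bar> \<le> e1 * (v - u)" by metis
    define \<gamma> where "\<gamma> x = (if x \<in> N then U else if x \<in> {a..b} then ball x (r x) else UNIV)" for x
    have \<gamma>: "gauge \<gamma>"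
      unfolding gauge_def \<gamma>_def using U r(1) by (auto simp: subset_eq)
    show "\<exists>\<gamma>. gauge \<gamma> \<and> (\<forall>\<D>. \<D> tagged_division_of {a..b} \<and> \<gamma> fine \<D> \<longrightarrow>
        norm ((\<Sum>(x, k)\<in>\<D>. measure lborel k *\<^sub>R D' x) - (F b - F a)) < e)"
    proof (intro exI[of _ \<gamma>] conjI allI impI \<gamma>)
      fix \<D> assume "\<D> tagged_division_of {a..b} \<and> \<gamma> fine \<D>"
      then have td: "\<D> tagged_division_of {a..b}" and fine: "\<gamma> fine \<D>" by auto
      have fin: "finite \<D>" using td by blast
      have K: "K = {Inf K..Sup K} \<and> Inf K \<le> x \<and> x \<le> Sup K \<and> Inf K \<in> {a..b} \<and> Sup K \<in> {a..b} \<and> K \<subseteq> \<gamma> x \<and> measure lborel K = Sup K - Inf K"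
        if "(x, K) \<in> \<D>" for x K
      proof -
        have "\<exists>l u. K = cbox l u" by (rule tagged_division_ofD(4)[OF td that])
        then obtain l u where lu: "K = {l..u}" by auto
        have "x \<in> K" "K \<subseteq> {a..b}" using tagged_division_ofD(2,3)[OF td that] by auto
        moreover have "K \<subseteq> \<gamma> x" using fine that by (auto simp: fine_def)
        ultimately show ?thesis using lu by auto
      qed
      define E where "E = {xK \<in> \<D>. fst xK \<in> N}"
      have E: "finite E" "E \<subseteq> \<D>" using fin by (auto simp: E_def)
      let ?\<Delta> = "\<lambda>K. F (Sup K) - F (Inf K)"
      have tele: "(\<Sum>(x,K)\<in>\<D>. ?\<Delta> K) = F b - F a" by (rule additive_tagged_division_1[OF ab td])
      have split: "(\<Sum>(x,K)\<in>\<D>. measure lborel K *\<^sub>R D' x) - (F b - F a)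
         = (\<Sum>(x,K)\<in>\<D> - E. measure lborel K * D' x - ?\<Delta> K) - (\<Sum>(x,K)\<in>E. ?\<Delta> K)"
      proof -
        have "(\<Sum>(x,K)\<in>\<D>. measure lborel K *\<^sub>R D' x) - (F b - F a) = (\<Sum>(x,K)\<in>\<D>. measure lborel K * D' x - ?\<Delta> K)"
          unfolding tele[symmetric] sum_subtractf[symmetric] by (intro sum.cong) auto
        also have "\<dots> = (\<Sum>(x,K)\<in>\<D> - E. measure lborel K * D' x - ?\<Delta> K) + (\<Sum>(x,K)\<in>E. measure lborel K * D' x - ?\<Delta> K)"
          by (rule sum.subset_diff[OF E(2) fin])
        also have "(\<Sum>(x,K)\<in>E. measure lborel K * D' x - ?\<Delta> K) = - (\<Sum>(x,K)\<in>E. ?\<Delta> K)"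
          unfolding sum_negf[symmetric] by (intro sum.cong) (auto simp: E_def D'_def)
        finally show ?thesis by simp
      qed
      have "\<bar>\<Sum>(x,K)\<in>\<D> - E. measure lborel K * D' x - ?\<Delta> K\<bar> \<le> (\<Sum>(x,K)\<in>\<D> - E. e1 * measure lborel K)"
      proof (rule order_trans[OF sum_abs sum_mono], unfold case_prod_unfold)
        fix y assume "y \<in> \<D> - E"
        then obtain x K where y: "y = (x, K)" and xK: "(x, K) \<in> \<D>" "(x, K) \<notin> E" by (cases y) auto
        then have x: "x \<notin> N" by (auto simp: E_def)
        note k = K[OF xK(1)]
        have x': "x \<in> {a..b} - N" using x k by auto
        have "Inf K \<in> K" "Sup K \<in> K" using k by (metis atLeastAtMost_iff order_refl order_trans)+
        then have "Inf K \<in> ball x (r x)" "Sup K \<in> ball x (r x)" using k x' unfolding \<gamma>_def by auto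
        then have "\<bar>F (Sup K) - F (Inf K) - D x * (Sup K - Inf K)\<bar> \<le> e1 * (Sup K - Inf K)"
          using k by (intro r(2) x') (auto simp: dist_real_def)
        then show "\<bar>measure lborel (snd y) * D' (fst y) - ?\<Delta> (snd y)\<bar> \<le> e1 * measure lborel (snd y)"
          using k x y by (simp add: D'_def abs_minus_commute mult.commute)
      qed
      also have "\<dots> \<le> (\<Sum>(x,K)\<in>\<D>. e1 * measure lborel K)"
        by (rule sum_mono2[OF fin]) (use e1 in auto)
      also have "\<dots> = e1 * (\<Sum>(x,K)\<in>\<D>. measure lborel K)" by (simp add: sum_distrib_left case_prod_unfold)
      also have "\<dots> = e1 * (b - a)" using additive_content_tagged_division[of \<D> a b] td ab by simp
      also have "\<dots> \<le> e / 2" using ab \<open>0 < e\<close> by (simp add: e1_def field_simps)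
      finally have 1: "\<bar>\<Sum>(x,K)\<in>\<D> - E. measure lborel K * D' x - ?\<Delta> K\<bar> \<le> e / 2" .
      obtain g where g: "bij_betw g {..<card E} E"
        using ex_bij_betw_nat_finite[OF E(1)] by (auto simp: atLeast0LessThan)
      define p where "p i = Inf (snd (g i))" for i
      define q where "q i = Sup (snd (g i))" for i
      have gE: "g i \<in> E" if "i < card E" for i using g that by (auto simp: bij_betw_def)
      have gK: "(fst (g i), snd (g i)) \<in> \<D>" "fst (g i) \<in> N" if "i < card E" for i
        using gE[OF that] by (auto simp: E_def)
      have pq: "p i \<le> q i \<and> {p i..q i} \<subseteq> {a..b}" "{p i<..<q i} \<subseteq> U" "snd (g i) = {p i..q i}" if "i < card E" for i
      proof -
        have k: "snd (g i) = {p i..q i}" "p i \<le> fst (g i)" "fst (g i) \<le> q i" "p i \<in> {a..b}" "q i \<in> {a..b}" "snd (g i) \<subseteq> \<gamma> (fst (g i))"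
          using K[OF gK(1)[OF that]] by (auto simp: p_def q_def)
        then show "p i \<le> q i \<and> {p i..q i} \<subseteq> {a..b}" "snd (g i) = {p i..q i}" by auto
        have "{p i..q i} \<subseteq> U" using k gK(2)[OF that] by (simp add: \<gamma>_def)
        then show "{p i<..<q i} \<subseteq> U" by (auto simp: subset_eq)
      qed
      have disj: "{p i<..<q i} \<inter> {p j<..<q j} = {}" if "i < card E" "j < card E" "i \<noteq> j" for i j
      proof -
        have "g i \<noteq> g j" using g that by (auto simp: bij_betw_def inj_on_def)
        then have "interior (snd (g i)) \<inter> interior (snd (g j)) = {}"
          using tagged_division_ofD(5)[OF td gK(1)[OF that(1)] gK(1)[OF that(2)]] by (simp add: prod_eq_iff)
        then show ?thesis using pq(3) that by simp
      qed
      have "ennreal (\<Sum>i<card E. q i - p i) \<le> emeasure lborel U"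
        by (rule sum_lengths_le_measure[OF _ disj _ U(1)]) (use pq in auto)
      also note U(3)
      finally have "(\<Sum>i<card E. q i - p i) < \<delta>"
        by (subst (asm) ennreal_less_iff) (use pq in \<open>auto intro!: sum_nonneg\<close>)
      then have "(\<Sum>i<card E. \<bar>F (q i) - F (p i)\<bar>) < e/2"
        by (intro \<delta>(2)) (use pq(1) disj in \<open>auto simp: nonoverlapping_in_def\<close>)
      moreover have "(\<Sum>i<card E. \<bar>F (q i) - F (p i)\<bar>) = (\<Sum>xK\<in>E. \<bar>?\<Delta> (snd xK)\<bar>)"
        unfolding p_def q_def by (rule sum.reindex_bij_betw[OF g])
      moreover have "\<bar>\<Sum>(x,K)\<in>E. ?\<Delta> K\<bar> \<le> (\<Sum>xK\<in>E. \<bar>?\<Delta> (snd xK)\<bar>)"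
        unfolding case_prod_unfold by (rule sum_abs)
      ultimately have 2: "\<bar>\<Sum>(x,K)\<in>E. ?\<Delta> K\<bar> < e/2" by simp
      show "norm ((\<Sum>(x, k)\<in>\<D>. measure lborel k *\<^sub>R D' x) - (F b - F a)) < e"
        unfolding split real_norm_def using 1 2 by linarith
    qed
  qed
  then show ?thesis
    by (rule has_integral_spike[OF N, rotated]) (auto simp: D'_def)
qed

lemma continuous_on_Icc_bounded:
  fixes f :: "real \<Rightarrow> real"
  assumes "continuous_on {a..b} f"
  obtains B where "\<And>t. t \<in> {a..b} \<Longrightarrow> \<bar>f t\<bar> \<le> B"
proof -
  have "bounded (f ` {a..b})"
    using assms compact_Icc compact_continuous_image compact_imp_bounded by blast
  then show ?thesis using that unfolding bounded_iff by (metis imageI real_norm_def)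
qed

lemma abs_continuous_on_compose_C1:
  fixes F :: "real \<Rightarrow> real"
  assumes f: "abs_continuous_on {a..b} f"
    and F: "\<And>x. (F has_real_derivative F' x) (at x)" and F': "continuous_on UNIV F'"
  shows "abs_continuous_on {a..b} (\<lambda>t. F (f t))"
proof -
  obtain B where B: "\<And>t. t \<in> {a..b} \<Longrightarrow> \<bar>f t\<bar> \<le> B"
    using continuous_on_Icc_bounded[OF abs_continuous_on_imp_continuous_on[OF f]] by metis
  obtain C where C: "\<And>x. x \<in> {-B..B} \<Longrightarrow> \<bar>F' x\<bar> \<le> C"
    using continuous_on_Icc_bounded[OF continuous_on_subset[OF F' subset_UNIV]] by metis
  have lip: "\<bar>F x - F y\<bar> \<le> C * \<bar>x - y\<bar>" if "x \<in> {-B..B}" "y \<in> {-B..B}" for x y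
    using field_differentiable_bound[of "{-B..B}" F F' C x y] that C F
    by (auto simp: has_field_derivative_at_within)
  show ?thesis
  proof (rule abs_continuous_on_dominated[OF f f, where C = "C/2"])
    fix s t assume "s \<in> {a..b}" "t \<in> {a..b}"
    then have "f t \<in> {-B..B}" "f s \<in> {-B..B}" using B[of s] B[of t] by auto
    from lip[OF this] show "\<bar>F (f t) - F (f s)\<bar> \<le> C / 2 * (\<bar>f t - f s\<bar> + \<bar>f t - f s\<bar>)" by simp
  qed
qed

lemma abs_continuous_on_mult:
  assumes f: "abs_continuous_on {a..b} f" and g: "abs_continuous_on {a..b} g"
  shows "abs_continuous_on {a..b} (\<lambda>t. f t * g t)"
proof -
  obtain A where A: "\<And>t. t \<in> {a..b} \<Longrightarrow> \<bar>f t\<bar> \<le> A"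
    using continuous_on_Icc_bounded[OF abs_continuous_on_imp_continuous_on[OF f]] by metis
  obtain B where B: "\<And>t. t \<in> {a..b} \<Longrightarrow> \<bar>g t\<bar> \<le> B"
    using continuous_on_Icc_bounded[OF abs_continuous_on_imp_continuous_on[OF g]] by metis
  show ?thesis
  proof (rule abs_continuous_on_dominated[OF f g, where C = "\<bar>A\<bar> + \<bar>B\<bar>"])
    fix s t assume st: "s \<in> {a..b}" "t \<in> {a..b}"
    have "\<bar>f t * g t - f s * g s\<bar> = \<bar>f t * (g t - g s) + g s * (f t - f s)\<bar>" by (simp add: algebra_simps)
    also have "\<dots> \<le> \<bar>f t\<bar> * \<bar>g t - g s\<bar> + \<bar>g s\<bar> * \<bar>f t - f s\<bar>"
      by (rule order_trans[OF abs_triangle_ineq]) (simp add: abs_mult)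
    also have "\<dots> \<le> (\<bar>A\<bar> + \<bar>B\<bar>) * \<bar>g t - g s\<bar> + (\<bar>A\<bar> + \<bar>B\<bar>) * \<bar>f t - f s\<bar>"
      using A[OF st(2)] B[OF st(1)] by (intro add_mono mult_right_mono) auto
    finally show "\<bar>f t * g t - f s * g s\<bar> \<le> (\<bar>A\<bar> + \<bar>B\<bar>) * (\<bar>f t - f s\<bar> + \<bar>g t - g s\<bar>)"
      by (simp add: algebra_simps)
  qed
qed

lemma continuous_antiderivative:
  fixes g :: "real \<Rightarrow> real"
  assumes g: "continuous_on UNIV g"
  obtains P where "P 0 = 0" "\<And>x. (P has_real_derivative g x) (at x)"
proof -
  let ?P = "\<lambda>x. interval_lebesgue_integral lborel (ereal 0) (ereal x) g"
  have D: "(?P has_real_derivative g x) (at x)" for x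
  proof -
  let ?S = "{- (\<bar>x\<bar> + 1)..\<bar>x\<bar> + 1}"
  have "(?P has_vector_derivative g x) (at x within ?S)"
    by (rule interval_integral_FTC2) (use g in \<open>auto intro: continuous_on_subset\<close>)
  moreover have "at x within ?S = at x" by (rule at_within_interior) auto
  ultimately show ?thesis
    by (simp add: has_real_derivative_iff_has_vector_derivative)
  qed
  show ?thesis by (rule that[of ?P, OF _ D]) simp
qed

lemma has_real_derivative_max0_square: "((\<lambda>x. (max 0 x)\<^sup>2) has_real_derivative 2 * max 0 x) (at (x::real))"
proof -
  consider "x < 0" | "x = 0" | "0 < x" by linarith
  then show ?thesis
  proof cases
    case 1
    have "((\<lambda>x. 0) has_real_derivative 0) (at x)" by simp
    then have "((\<lambda>x. (max 0 x)\<^sup>2) has_real_derivative 0) (at x)"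
      by (rule DERIV_cong_ev[THEN iffD1, rotated -1, OF _ refl]) 
         (use 1 in \<open>auto intro!: eventually_mono[OF eventually_nhds_in_open[of "{..<0}" x]]\<close>)
    then show ?thesis using 1 by simp
  next
    case 2
    have "((\<lambda>h. (max 0 h)\<^sup>2 / h) \<longlongrightarrow> 0) (at (0::real))"
    proof (rule Lim_null_comparison)
      show "\<forall>\<^sub>F h in at (0::real). norm ((max 0 h)\<^sup>2 / h) \<le> \<bar>h\<bar>"
        by (rule always_eventually) (auto simp: max_def power2_eq_square)
      show "((\<lambda>h. \<bar>h\<bar>) \<longlongrightarrow> 0) (at (0::real))" by (rule tendsto_rabs_zero) simp
    qed
    then show ?thesis using 2 by (simp add: DERIV_def)
  next
    case 3
    have "((\<lambda>x. x\<^sup>2) has_real_derivative 2 * x) (at x)" by (auto intro!: derivative_eq_intros)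
    then have "((\<lambda>x. (max 0 x)\<^sup>2) has_real_derivative 2 * x) (at x)"
      by (rule DERIV_cong_ev[THEN iffD1, rotated -1, OF _ refl]) 
         (use 3 in \<open>auto intro!: eventually_mono[OF eventually_nhds_in_open[of "{0<..}" x]]\<close>)
    then show ?thesis using 3 by simp
  qed
qed

text \<open>
  The mean value theorem replaces the integral by one value of \<open>g\<close> between \<open>0\<close> and \<open>x\<close>, which costs a factor \<open>2\<close>
  against the sharp bound \<open>k x\<^sup>2/2\<close>.
\<close>

lemma antiderivative_of_sector_bounded:
  fixes P g :: "real \<Rightarrow> real"
  assumes P: "P 0 = 0" "\<And>x. (P has_real_derivative g x) (at x)"
    and sgn: "\<And>x. 0 \<le> g x * x" and k: "\<And>x. \<bar>g x\<bar> \<le> k * \<bar>x\<bar>" and k0: "0 \<le> k"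
  shows "0 \<le> P x" "P x \<le> k * x\<^sup>2"
proof -
  have "\<exists>\<xi>. P x = x * g \<xi> \<and> (0 < x \<longrightarrow> 0 < \<xi> \<and> \<xi> < x) \<and> (x < 0 \<longrightarrow> \<xi> < 0 \<and> x < \<xi>)"
  proof -
    consider "x = 0" | "0 < x" | "x < 0" by linarith
    then show ?thesis
    proof cases
      case 2
      from MVT2[OF 2 P(2)] P(1) show ?thesis using 2 by auto
    next
      case 3
      from MVT2[OF 3 P(2)] P(1) show ?thesis using 3 by auto
    qed (use P in auto)
  qed
  then obtain \<xi> where \<xi>: "P x = x * g \<xi>" "0 < x \<longrightarrow> 0 < \<xi> \<and> \<xi> < x" "x < 0 \<longrightarrow> \<xi> < 0 \<and> x < \<xi>" by blast
  show "0 \<le> P x"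
    using \<xi> sgn[of \<xi>] by (cases x "0::real" rule: linorder_cases) (auto simp: zero_le_mult_iff)
  have "P x \<le> \<bar>x\<bar> * \<bar>g \<xi>\<bar>" unfolding \<xi>(1) abs_mult[symmetric] by simp
  also have "\<dots> \<le> \<bar>x\<bar> * (k * \<bar>x\<bar>)"
  proof (cases "x = 0")
    case False
    then have "\<bar>\<xi>\<bar> \<le> \<bar>x\<bar>" using \<xi> by (cases x "0::real" rule: linorder_cases) auto
    then have "k * \<bar>\<xi>\<bar> \<le> k * \<bar>x\<bar>" using k0 by (rule mult_left_mono)
    then have "\<bar>g \<xi>\<bar> \<le> k * \<bar>x\<bar>" using k[of \<xi>] by linarith
    then show ?thesis by (rule mult_left_mono) simp
  qed simp
  finally show "P x \<le> k * x\<^sup>2" by (simp add: power2_eq_square mult_ac)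
qed

section \<open>The Popov symbol at the critical gain\<close>

lemma nonneg_from_deriv:
  fixes F F' :: "real \<Rightarrow> real"
  assumes "\<And>t. (F has_real_derivative F' t) (at t)" "F 0 = 0" "\<And>t. 0 \<le> t \<Longrightarrow> 0 \<le> F' t" "0 \<le> x"
  shows "0 \<le> F x"
proof -
  have "F 0 \<le> F x"
    by (rule DERIV_nonneg_imp_nondecreasing[OF \<open>0 \<le> x\<close>]) (use assms in blast)
  then show ?thesis using assms by simp
qed

lemma sin_cos_Taylor_bounds:
  fixes x :: real
  assumes "0 \<le> x"
  shows "1 - x^2/2 \<le> cos x" "x - x^3/6 \<le> sin x" "cos x \<le> 1 - x^2/2 + x^4/24"
    "sin x \<le> x - x^3/6 + x^5/120"
proof -
  have c2: "0 \<le> cos x - (1 - x^2/2)" if "0 \<le> x" for x :: real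
    by (rule nonneg_from_deriv[where F' = "\<lambda>t. t - sin t", OF _ _ _ that])
       (auto intro!: derivative_eq_intros sin_x_le_x)
  have s3: "0 \<le> sin x - (x - x^3/6)" if "0 \<le> x" for x :: real
    by (rule nonneg_from_deriv[where F' = "\<lambda>t. cos t - (1 - t^2/2)", OF _ _ _ that])
       (use c2 in \<open>auto intro!: derivative_eq_intros\<close>)
  have c4: "0 \<le> 1 - x^2/2 + x^4/24 - cos x" if "0 \<le> x" for x :: real
    by (rule nonneg_from_deriv[where F' = "\<lambda>t. sin t - (t - t^3/6)", OF _ _ _ that])
       (use s3 in \<open>auto intro!: derivative_eq_intros\<close>)
  have s5: "0 \<le> x - x^3/6 + x^5/120 - sin x" if "0 \<le> x" for x :: real
    by (rule nonneg_from_deriv[where F' = "\<lambda>t. 1 - t^2/2 + t^4/24 - cos t", OF _ _ _ that])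
       (use c4 in \<open>auto intro!: derivative_eq_intros\<close>)
  show "1 - x^2/2 \<le> cos x" "x - x^3/6 \<le> sin x" "cos x \<le> 1 - x^2/2 + x^4/24"
    "sin x \<le> x - x^3/6 + x^5/120"
    using c2[OF assms] s3[OF assms] c4[OF assms] s5[OF assms] by auto
qed

lemma x_cos_le_sin: assumes "0 \<le> (x::real)" "x \<le> pi" shows "x * cos x \<le> sin x"
proof -
  have "sin 0 - 0 * cos 0 \<le> sin x - x * cos x"
  proof (rule DERIV_nonneg_imp_nondecreasing[OF assms(1)])
    fix t assume "0 \<le> t" "t \<le> x"
    then show "\<exists>y. ((\<lambda>x. sin x - x * cos x) has_real_derivative y) (at t) \<and> 0 \<le> y"
      using assms by (intro exI[of _ "t * sin t"]) (auto intro!: derivative_eq_intros mult_nonneg_nonneg sin_ge_zero)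
  qed
  then show ?thesis by simp
qed

text \<open>
  In terms of \<open>x = s/2\<close> this is \<open>x cos x \<le> sin x\<close> weakened by \<open>4/\<pi>\<^sup>2 \<le> 1/2\<close>.
\<close>

lemma x_sin_le_one_minus_cos: assumes "0 \<le> s" "s \<le> pi" shows "s * sin s * (4/pi^2) \<le> 1 - cos s"
proof -
  have pi2: "(4/pi^2) \<le> 1/2"
  proof -
    have "3^2 \<le> pi^2" using pi_gt3 by (intro power_mono) auto
    then show ?thesis by (simp add: field_simps)
  qed
  define x where "x = s/2"
  have x: "0 \<le> x" "x \<le> pi" "s = 2*x" using assms by (auto simp: x_def)
  have "x * cos x \<le> sin x" using x by (intro x_cos_le_sin)
  moreover have "0 \<le> sin x" using x by (intro sin_ge_zero)
  ultimately have "sin x * (x * cos x) \<le> sin x * sin x" by (intro mult_left_mono)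
  then have "4 * (sin x * (x * cos x)) \<le> 2 * (2 * (sin x * sin x))" by simp
  moreover have "1 - cos s = 2 * (sin x * sin x)"
    unfolding x(3) cos_double_sin by (simp add: power2_eq_square)
  moreover have "s * sin s = 4 * (sin x * (x * cos x))"
    unfolding x(3) sin_double by simp
  ultimately have "s * sin s \<le> 2 * (1 - cos s)" by simp
  then have "s * sin s * (1/2) \<le> 1 - cos s" by simp
  moreover have "0 \<le> s * sin s" using assms by (intro mult_nonneg_nonneg sin_ge_zero)
  ultimately show ?thesis using mult_left_mono[OF pi2, of "s * sin s"] by (meson order_trans)
qed

lemma pi_quotient_bounds: "2/pi \<le> 6367/10000" "6366/10000 \<le> 2/pi" "4/pi^2 \<le> 4054/10000" "405/1000 \<le> 4/pi^2"
proof -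
  show a: "2/pi \<le> 6367/10000" "6366/10000 \<le> 2/pi" using pi_approx by (auto simp: field_simps)
  have "4/pi^2 = (2/pi)*(2/pi)" by (simp add: power2_eq_square)
  then show "4/pi^2 \<le> 4054/10000" "405/1000 \<le> 4/pi^2"
    using mult_mono[OF a(1) a(1)] mult_mono[OF a(2) a(2)] by auto
qed

lemma critical_multiplier_ge: "1/5 \<le> 2/pi + 4/pi^2 * cos (x::real)"
proof -
  have "4/pi^2 * (-1) \<le> 4/pi^2 * cos x" by (rule mult_left_mono) auto
  moreover have "4/pi^2 * (-1) = - (4/pi^2)" by simp
  ultimately show ?thesis using pi_quotient_bounds by linarith
qed

text \<open>
  Low order Taylor bounds at \<open>0\<close> suffice, thanks to the slack \<open>2/\<pi> + 4/\<pi>\<^sup>2 - 1 > 0.04\<close>.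
\<close>

lemma critical_symbol_near_0:
  assumes "0 \<le> (x::real)" "x \<le> 9/10" shows "sin x \<le> x * (2/pi + 4/pi^2 * cos x)"
proof -
  have b: "1 - x^2/2 \<le> cos x" "sin x \<le> x - x^3/6 + x^5/120" using sin_cos_Taylor_bounds assms(1) by auto
  have xx: "x^2 \<le> 81/100" using power_mono[OF assms(2,1), of 2] by (simp add: power2_eq_square)
  then have pos: "0 \<le> 1 - x^2/2" by simp
  have "405/1000 * (1 - x^2/2) \<le> 4/pi^2 * cos x"
    by (rule mult_mono) (use b pos pi_quotient_bounds in auto)
  then have 1: "6366/10000 + 405/1000 * (1 - x^2/2) \<le> 2/pi + 4/pi^2 * cos x" using pi_quotient_bounds by linarith
  have "x^4 \<le> 81/100 * x^2" using mult_right_mono[OF xx, of "x^2"] by (simp add: power_numeral_reduce)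
  moreover have "1 - y/6 + q/120 \<le> 6366/10000 + 405/1000 * (1 - y/2)" if "q \<le> 81/100 * y" "y \<le> 81/100" for q y :: real
    using that by (simp add: field_simps)
  ultimately have "1 - x^2/6 + x^4/120 \<le> 6366/10000 + 405/1000 * (1 - x^2/2)" using xx by blast
  with 1 have "x * (1 - x^2/6 + x^4/120) \<le> x * (2/pi + 4/pi^2 * cos x)" by (intro mult_left_mono assms) auto
  moreover have "x * (1 - x^2/6 + x^4/120) = x - x^3/6 + x^5/120" by (simp add: algebra_simps power_numeral_reduce)
  ultimately show ?thesis using b by linarith
qed

text \<open>
  This is \<open>critical_symbol\<close> at \<open>x = \<pi>/2 - r\<close>. Both sides vanish to second order at \<open>r = 0\<close>, and \<open>1/2 - 4/\<pi>\<^sup>2 > 0\<close> is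
  the leading coefficient of their difference. The range reaches beyond \<open>\<pi>/2 - 9/10\<close>, where the expansion at \<open>x = 0\<close>
  takes over.
\<close>

lemma critical_symbol_below_half_pi:
  assumes "0 \<le> r" "r \<le> 68/100"
  shows "4/pi^2 * (r * sin r) + 2/pi * (r - sin r) \<le> 1 - cos (r::real)"
proof -
  note T = sin_cos_Taylor_bounds[OF assms(1)]
  have r2: "r^2 \<le> 4624/10000" using power_mono[OF assms(2,1), of 2] by (simp add: power2_eq_square)
  have "r * sin r \<le> r * r" using assms by (intro mult_left_mono sin_x_le_x)
  moreover have "0 \<le> r * sin r" using assms pi_gt3 by (intro mult_nonneg_nonneg sin_ge_zero) auto
  ultimately have "4/pi^2 * (r * sin r) \<le> 4054/10000 * (r * r)"
    by (intro mult_mono[OF pi_quotient_bounds(3)]) simp_all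
  then have 1: "4/pi^2 * (r * sin r) \<le> 4054/10000 * r^2" by (simp only: power2_eq_square)
  have "r^3 \<le> 68/100 * r^2" using mult_right_mono[OF assms(2), of "r^2"] by (simp add: power_numeral_reduce)
  then have "r - sin r \<le> 68/600 * r^2" using T(2) by simp
  then have "2/pi * (r - sin r) \<le> 6367/10000 * (68/600 * r^2)"
    using sin_x_le_x[OF assms(1)] by (intro mult_mono pi_quotient_bounds) simp_all
  then have 2: "2/pi * (r - sin r) \<le> 6367/10000 * (68/600) * r^2" by (simp only: mult.assoc)
  have "r^4 \<le> 4624/10000 * r^2" using mult_right_mono[OF r2, of "r^2"] by (simp add: power_numeral_reduce)
  then have "1/2 * r^2 - 4624/240000 * r^2 \<le> 1 - cos r" using T(3) by simp
  then have 3: "(1/2 - 4624/240000) * r^2 \<le> 1 - cos r" by (simp only: left_diff_distrib)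
  have "(4054/10000 + 6367/10000 * (68/600)) * r^2 \<le> (1/2 - 4624/240000) * r^2"
    by (intro mult_right_mono) (simp_all add: field_simps)
  from order_trans[OF this 3]
  have 4: "4054/10000 * r^2 + 6367/10000 * (68/600) * r^2 \<le> 1 - cos r"
    unfolding distrib_right .
  show ?thesis by (rule order_trans[OF add_mono[OF 1 2] 4])
qed

text \<open>
  The Popov frequency condition at the critical gain \<open>k \<tau> = \<pi>/2\<close>, in the normalised frequency \<open>x = \<omega> \<tau>\<close>. Equality
  holds at \<open>x = \<pi>/2\<close>; the derivatives of the two sides agree there only for the Popov multiplier \<open>4/\<pi>\<^sup>2\<close>.
\<close>

lemma critical_symbol:
  fixes x :: real
  assumes "0 \<le> x" shows "sin x \<le> x * (2/pi + 4/pi^2 * cos x)"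
proof -
  define s where "s = x - pi/2"
  have xs: "x = pi/2 + s" by (simp add: s_def)
  have cs: "cos x = - sin s" "sin x = cos s" unfolding xs by (simp_all add: cos_add sin_add)
  have expand: "x * (2/pi + 4/pi^2 * cos x) - sin x
    = (1 - cos s) + 2/pi * (s - sin s) - 4/pi^2 * (s * sin s)"
    unfolding cs unfolding xs by (simp add: field_simps power2_eq_square)
  consider "x \<le> 9/10" | "9/10 < x" "x < pi/2" | "pi/2 \<le> x" "x \<le> pi" | "pi < x" "x < 2*pi" | "2*pi \<le> x"
    by linarith
  then show ?thesis
  proof cases
    case 1 then show ?thesis using critical_symbol_near_0 assms by blast
  next
    case 2
    define r where "r = -s"
    have "0 \<le> r" "r \<le> 68/100" using 2 pi_approx by (auto simp: r_def s_def)
    from critical_symbol_below_half_pi[OF this]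
    have "4/pi^2 * (s * sin s) - 2/pi * (s - sin s) \<le> 1 - cos s"
      by (simp add: r_def minus_divide_left[symmetric] algebra_simps diff_divide_distrib)
    then have "0 \<le> x * (2/pi + 4/pi^2 * cos x) - sin x" unfolding expand by linarith
    then show ?thesis by simp
  next
    case 3
    then have "0 \<le> s" "s \<le> pi" by (auto simp: s_def)
    then have A: "4/pi^2 * (s * sin s) \<le> 1 - cos s" and B: "0 \<le> 2/pi * (s - sin s)"
      using x_sin_le_one_minus_cos[of s] sin_x_le_x[of s] by (auto simp: mult.commute)
    have "0 \<le> x * (2/pi + 4/pi^2 * cos x) - sin x"
      unfolding expand using add_mono[OF A B] by (simp only: diff_add_eq le_diff_eq add_0_left add_0_right)
    then show ?thesis by simp
  next
    case 4
    have "1/5 \<le> 2/pi + 4/pi^2 * cos x" by (rule critical_multiplier_ge)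
    then have "0 \<le> x * (2/pi + 4/pi^2 * cos x)" using assms by simp
    moreover have "sin x \<le> 0" using 4 by (intro sin_le_zero) auto
    ultimately show ?thesis by linarith
  next
    case 5
    have "1/5 \<le> 2/pi + 4/pi^2 * cos x" by (rule critical_multiplier_ge)
    then have A: "x * (1/5) \<le> x * (2/pi + 4/pi^2 * cos x)" using assms by (rule mult_left_mono)
    have "6 \<le> x" using 5 pi_gt3 by simp
    then have B: "1 \<le> x * (1/5)" by simp
    show ?thesis by (rule order_trans[OF sin_le_one order_trans[OF B A]])
  qed
qed

text \<open>
  With half weights at both ends the Dirichlet sum is \<open>sin (n t) cot (t/2) / 2\<close>; the full weights would leave an
  additional cosine term of no definite sign.
\<close>

lemma trapezoid_cos_sum:
  fixes t :: real assumes "0 < n"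
  shows "2 * sin (t/2) * (1/2 + (\<Sum>j=1..<n. cos (real j * t)) + cos (real n * t)/2) = sin (real n * t) * cos (t/2)"
  using assms
proof (induction n)
  case 0 then show ?case by simp
next
  case (Suc n)
  define x where "x = t/2"
  have t: "t = 2*x" by (simp add: x_def)
  show ?case
  proof (cases "n = 0")
    case True
    have "2 * sin x * (1/2 + cos (2*x)/2) = sin (2*x) * cos x"
      unfolding sin_double cos_double_cos by (simp add: power2_eq_square field_simps)
    with True show ?thesis by (simp add: t)
  next
    case False
    then have "2 * sin x * (1/2 + (\<Sum>j=1..<n. cos (real j * t)) + cos (real n * t)/2) = sin (real n * t) * cos x"
      using Suc by (simp add: x_def)
    moreover have "(\<Sum>j=1..<Suc n. cos (real j * t)) = (\<Sum>j=1..<n. cos (real j * t)) + cos (real n * t)"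
      using False by (simp add: sum.atLeastLessThan_Suc)
    moreover have "sin (real n * t) * cos x + sin x * (cos (real n * t) + cos (real (Suc n) * t)) = sin (real (Suc n) * t) * cos x"
    proof -
      have e: "real (Suc n) * t = real n * t + 2*x" by (simp add: t algebra_simps)
      define A where "A = sin (real n * t)"
      define B where "B = cos (real n * t)"
      have s2: "sin x * sin x = 1 - cos x * cos x" using sin_cos_squared_add3[of x] by linarith
      have "A * cos x + sin x * (B + (B * (2*(cos x * cos x) - 1) - A * (2 * sin x * cos x)))
         = A * cos x + 2 * B * cos x * cos x * sin x - 2 * A * cos x * (sin x * sin x)"
        by (simp add: algebra_simps)
      also have "\<dots> = (A * (2*(cos x * cos x) - 1) + B * (2 * sin x * cos x)) * cos x"
        unfolding s2 by (simp add: algebra_simps)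
      finally show ?thesis unfolding e sin_add cos_add sin_double cos_double_cos A_def[symmetric] B_def[symmetric]
        by (simp add: power2_eq_square)
    qed
    ultimately show ?thesis unfolding x_def[symmetric] by (simp add: algebra_simps)
  qed
qed

text \<open>
  With \<open>x = t/2\<close> the left-hand side equals \<open>sin (n t)/(n t) \<cdot> x cot x\<close>, where \<open>0 \<le> x cot x \<le> 1\<close>. Where the sine is
  nonnegative, it is therefore at most the continuous symbol \<open>sin (n t)/(n t)\<close>; elsewhere it is nonpositive, and
  the right-hand side is positive.
\<close>

lemma discrete_symbol_nonneg_pos:
  fixes t :: real assumes "0 < n" "0 < t" "t \<le> pi"
  shows "(1/2 + (\<Sum>j=1..<n. cos (real j * t)) + cos (real n * t)/2) / real n \<le> 2/pi + 4/pi^2 * cos (real n * t)"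
    (is "?D / _ \<le> ?m")
proof -
  define x where "x = t/2"
  have x: "0 < x" "x \<le> pi/2" and t: "t = 2*x" using assms by (auto simp: x_def)
  have sx: "0 < sin x" using x by (intro sin_gt_zero) auto
  have cx: "0 \<le> cos x" using x by (intro cos_ge_zero) auto
  have D: "2 * sin x * ?D = sin (real n * t) * cos x"
    using trapezoid_cos_sum[OF assms(1), of t] by (simp add: x_def)
  have m: "0 \<le> ?m" using critical_multiplier_ge[of "real n * t"] by linarith
  have "sin (real n * t) * (x * cos x) \<le> real n * t * ?m * sin x"
  proof (cases "0 \<le> sin (real n * t)")
    case True
    have "sin (real n * t) * (x * cos x) \<le> sin (real n * t) * sin x"
      using True x x_cos_le_sin[of x] by (intro mult_left_mono) auto
    also have "\<dots> \<le> (real n * t * ?m) * sin x"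
      using critical_symbol[of "real n * t"] assms sx by (intro mult_right_mono) auto
    finally show ?thesis .
  next
    case False
    then have "sin (real n * t) * (x * cos x) \<le> 0" using x cx by (intro mult_nonpos_nonneg) auto
    also have "0 \<le> real n * t * ?m * sin x" using assms m sx by auto
    finally show ?thesis .
  qed
  then have "x * (2 * sin x * ?D) \<le> x * (2 * sin x * (real n * ?m))"
    unfolding D unfolding t by (simp add: algebra_simps)
  then have "?D \<le> real n * ?m" using x sx by simp
  then show ?thesis using assms by (simp add: field_simps)
qed

lemma discrete_symbol_nonneg:
  fixes t :: real assumes "0 < n" "\<bar>t\<bar> \<le> pi"
  shows "(1/2 + (\<Sum>j=1..<n. cos (real j * t)) + cos (real n * t)/2) / real n \<le> 2/pi + 4/pi^2 * cos (real n * t)"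
proof -
  have ev: "cos (real j * t) = cos (real j * \<bar>t\<bar>)" for j by (cases "0 \<le> t") auto
  consider "t = 0" | "0 < \<bar>t\<bar>" by linarith
  then show ?thesis
  proof cases
    case 1
    have "(1/2 + (real n - 1) + 1/2) / real n = 1" using assms by simp
    moreover have "1 \<le> 2/pi + 4/pi^2" using pi_quotient_bounds by linarith
    ultimately show ?thesis using 1 assms by (simp add: of_nat_diff)
  next
    case 2
    then show ?thesis unfolding ev using discrete_symbol_nonneg_pos[OF assms(1) 2 assms(2)] by simp
  qed
qed

section \<open>Positivity of the delay form\<close>

text \<open>
  By orthogonality of the cosines, \<open>2\<pi>\<close> times the form is the integral over \<open>[-\<pi>, \<pi>]\<close> of the symbol multiplied by
  the squared modulus of the trigonometric polynomial with coefficients \<open>b\<close>.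
\<close>

lemma toeplitz_form_nonneg:
  fixes b :: "int \<Rightarrow> real" and c :: "nat \<Rightarrow> real"
  assumes sym: "\<And>t. \<bar>t\<bar> \<le> pi \<Longrightarrow> 0 \<le> (\<Sum>j\<le>n. c j * cos (real j * t))"
    and b0: "\<And>i. i < 0 \<Longrightarrow> b i = 0"
  shows "0 \<le> (\<Sum>j\<le>n. c j * (\<Sum>i<J. b (int i) * b (int i - int j)))"
proof -
  define A where "A t = (\<Sum>i<J. b (int i) * cos (real i * t))^2 + (\<Sum>i<J. b (int i) * sin (real i * t))^2" for t
  define I where "I m = (if m = (0::int) then 2 * pi else 0)" for m
  have hi: "((\<lambda>t. cos (real_of_int m * t)) has_integral I m) {-pi..pi}" for m
  proof -
    have "(\<lambda>t. cos (t * real_of_int m)) integrable_on {-pi..pi}"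
      by (intro integrable_continuous_real continuous_intros)
    then have "((\<lambda>t. cos (t * real_of_int m)) has_integral I m) {-pi..pi}"
      using integral_cos_nx[of m] by (simp add: has_integral_iff I_def)
    then show ?thesis by (simp add: mult.commute)
  qed
  \<comment> \<open>the squared modulus of the sum of \<open>b i exp (\<i> i t)\<close>, expanded\<close>
  have A2: "A t = (\<Sum>i<J. \<Sum>k<J. b (int i) * b (int k) * cos (real_of_int (int i - int k) * t))" for t
  proof -
    have "A t = (\<Sum>i<J. \<Sum>k<J. b (int i) * cos (real i * t) * (b (int k) * cos (real k * t)))
       + (\<Sum>i<J. \<Sum>k<J. b (int i) * sin (real i * t) * (b (int k) * sin (real k * t)))"
      unfolding A_def power2_eq_square sum_product ..
    also have "\<dots> = (\<Sum>i<J. \<Sum>k<J. b (int i) * b (int k) * (cos (real i * t) * cos (real k * t) + sin (real i * t) * sin (real k * t)))"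
      unfolding sum.distrib[symmetric] by (intro sum.cong refl) (simp add: algebra_simps)
    also have "\<dots> = (\<Sum>i<J. \<Sum>k<J. b (int i) * b (int k) * cos (real_of_int (int i - int k) * t))"
      by (intro sum.cong refl) (simp add: cos_diff[symmetric] algebra_simps)
    finally show ?thesis .
  qed
  have prod: "A t * (\<Sum>j\<le>n. c j * cos (real j * t)) =
     (\<Sum>j\<le>n. \<Sum>i<J. \<Sum>k<J. c j * (b (int i) * b (int k)) / 2 *
        (cos (real_of_int (int i - int k + int j) * t) + cos (real_of_int (int i - int k - int j) * t)))" for t
  proof -
    have cc: "cos x * cos y = (cos (x + y) + cos (x - y)) / 2" for x y :: real
      by (simp add: cos_add cos_diff)
    have "A t * (\<Sum>j\<le>n. c j * cos (real j * t)) = (\<Sum>j\<le>n. \<Sum>i<J. \<Sum>k<J. c j * (b (int i) * b (int k)) *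
       (cos (real_of_int (int i - int k) * t) * cos (real j * t)))"
      unfolding A2 sum_distrib_left sum_distrib_right by (intro sum.cong refl) (simp add: mult_ac)
    also have "\<dots> = (\<Sum>j\<le>n. \<Sum>i<J. \<Sum>k<J. c j * (b (int i) * b (int k)) / 2 *
        (cos (real_of_int (int i - int k + int j) * t) + cos (real_of_int (int i - int k - int j) * t)))"
      unfolding cc by (intro sum.cong refl) (simp add: algebra_simps)
    finally show ?thesis .
  qed
  have int: "((\<lambda>t. A t * (\<Sum>j\<le>n. c j * cos (real j * t))) has_integral
     (\<Sum>j\<le>n. \<Sum>i<J. \<Sum>k<J. c j * (b (int i) * b (int k)) / 2 *
        (I (int i - int k + int j) + I (int i - int k - int j)))) {-pi..pi}"
    unfolding prod by (intro has_integral_sum has_integral_mult_right has_integral_add hi finite_atMost finite_lessThan)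
  have nn: "0 \<le> (\<Sum>j\<le>n. \<Sum>i<J. \<Sum>k<J. c j * (b (int i) * b (int k)) / 2 *
        (I (int i - int k + int j) + I (int i - int k - int j)))"
    by (rule has_integral_nonneg[OF int]) (intro mult_nonneg_nonneg sym, auto simp: A_def)
  have pick: "(\<Sum>k<J. b (int i) * b (int k) * I (int i - int k - int j)) = 2 * pi * (b (int i) * b (int i - int j))"
    if "i < J" for i j
  proof (cases "j \<le> i")
    case True
    have "(\<Sum>k<J. b (int i) * b (int k) * I (int i - int k - int j)) =
      (\<Sum>k<J. if k = i - j then b (int i) * b (int k) * (2*pi) else 0)"
      by (intro sum.cong refl) (use True in \<open>auto simp: I_def\<close>)
    also have "\<dots> = 2 * pi * (b (int i) * b (int i - int j))"
      using True that by (subst sum.delta) (auto simp: of_nat_diff)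
    finally show ?thesis .
  next
    case False
    then have "I (int i - int k - int j) = 0" for k by (auto simp: I_def)
    then show ?thesis using b0[of "int i - int j"] False by simp
  qed
  have "(\<Sum>i<J. \<Sum>k<J. c j * (b (int i) * b (int k)) / 2 * (I (int i - int k + int j) + I (int i - int k - int j)))
      = 2 * pi * (c j * (\<Sum>i<J. b (int i) * b (int i - int j)))" for j
  proof -
    define P where "P = (\<Sum>i<J. \<Sum>k<J. b (int i) * b (int k) * I (int i - int k - int j))"
    have "(\<Sum>i<J. \<Sum>k<J. b (int i) * b (int k) * I (int i - int k + int j)) =
       (\<Sum>k<J. \<Sum>i<J. b (int i) * b (int k) * I (int i - int k + int j))" by (rule sum.swap)
    also have "\<dots> = P" unfolding P_def by (intro sum.cong refl) (auto simp: I_def)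
    finally have sw: "(\<Sum>i<J. \<Sum>k<J. b (int i) * b (int k) * I (int i - int k + int j)) = P" .
    have "(\<Sum>i<J. \<Sum>k<J. c j * (b (int i) * b (int k)) / 2 * (I (int i - int k + int j) + I (int i - int k - int j)))
      = c j / 2 * (\<Sum>i<J. \<Sum>k<J. b (int i) * b (int k) * I (int i - int k + int j)) + c j / 2 * P"
      unfolding P_def sum_distrib_left sum.distrib[symmetric] by (intro sum.cong refl) (simp add: algebra_simps)
    also have "\<dots> = c j * P" unfolding sw by simp
    also have "P = 2 * pi * (\<Sum>i<J. b (int i) * b (int i - int j))"
      unfolding P_def sum_distrib_left by (intro sum.cong refl) (use pick in auto)
    finally show ?thesis by simp
  qed
  with nn have "0 \<le> 2 * pi * (\<Sum>j\<le>n. c j * (\<Sum>i<J. b (int i) * b (int i - int j)))"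
    unfolding sum_distrib_left by simp
  then show ?thesis using pi_gt_zero by (simp add: zero_le_mult_iff)
qed

lemma dominated_convergence_real_AE:
  fixes f :: "nat \<Rightarrow> real \<Rightarrow> real"
  assumes f: "\<And>n. f n integrable_on S" and h: "h integrable_on S" and N: "negligible N"
    and le: "\<And>n t. t \<in> S - N \<Longrightarrow> \<bar>f n t\<bar> \<le> h t"
    and lim: "\<And>t. t \<in> S - N \<Longrightarrow> (\<lambda>n. f n t) \<longlonglongrightarrow> g t"
  shows "g integrable_on S" "(\<lambda>n. integral S (f n)) \<longlonglongrightarrow> integral S g"
proof -
  let ?f = "\<lambda>n t. if t \<in> N then 0 else f n t"
  let ?g = "\<lambda>t. if t \<in> N then 0 else g t"
  let ?h = "\<lambda>t. if t \<in> N then 0 else h t"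
  have 1: "?f n integrable_on S" for n by (rule integrable_spike[OF f N]) auto
  have 2: "?h integrable_on S" by (rule integrable_spike[OF h N]) auto
  have 3: "norm (?f n t) \<le> ?h t" if "t \<in> S" for n t using le[of t n] that by auto
  have 4: "(\<lambda>n. ?f n t) \<longlonglongrightarrow> ?g t" if "t \<in> S" for t using lim that by auto
  have "integral S (?f n) = integral S (f n)" for n by (rule integral_spike[OF N]) auto
  moreover have "integral S ?g = integral S g" by (rule integral_spike[OF N]) auto
  ultimately show "(\<lambda>n. integral S (f n)) \<longlonglongrightarrow> integral S g"
    using dominated_convergence(2)[of ?f S ?h ?g, OF 1 2 3 4] by simp
  have "?g integrable_on S" using dominated_convergence(1)[of ?f S ?h ?g, OF 1 2 3 4] .
  then show "g integrable_on S" by (rule integrable_spike[OF _ N]) auto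
qed

lemma integral_as_sum_of_shifts:
  fixes q :: "real \<Rightarrow> real"
  assumes q: "continuous_on UNIV q" and h: "0 \<le> h"
  shows "integral {0..real J * h} q = integral {0..h} (\<lambda>t. \<Sum>i<J. q (t + real i * h))"
proof -
  have cont: "continuous_on {0..h} (\<lambda>t. q (t + c))" for c
    by (rule continuous_on_compose2[OF q]) (auto intro!: continuous_intros)
  have "integral {0..real J * h} q = (\<Sum>i<J. integral {0..h} (\<lambda>t. q (t + real i * h)))"
  proof (induction J)
    case (Suc J)
    have "integral {0..real (Suc J) * h} q = integral {0..real J * h} q + integral {real J * h..real (Suc J) * h} q"
      using h continuous_on_subset[OF q] by (intro Henstock_Kurzweil_Integration.integral_combine[symmetric] integrable_continuous_real)
         (auto intro!: mult_right_mono)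
    also have "integral {real J * h..real (Suc J) * h} q = integral {0..h} (\<lambda>t. q (t + real J * h))"
      using integral_shift_real_ivl[of "real J * h" "real J * h" "real (Suc J) * h" q] by (simp add: algebra_simps)
    finally show ?case using Suc by simp
  qed simp
  also have "\<dots> = integral {0..h} (\<lambda>t. \<Sum>i<J. q (t + real i * h))"
    by (intro integral_sum[symmetric] integrable_continuous_real cont) auto
  finally show ?thesis .
qed

text \<open>
  The samples \<open>V (t + i h)\<close> for \<open>0 \<le> t \<le> h\<close> form one sequence for each \<open>t\<close>, and the integrand summed over such a
  sequence is a Toeplitz form with the symbol of \<open>discrete_symbol_nonneg\<close>. The sum of \<open>V (t - j h)\<close> over \<open>j < n\<close>
  telescopes, which produces \<open>Z t - Z (t - \<tau>)\<close> without error; the last summand of the integrand is what remains of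
  the half weights at the ends of the trapezoid sum.
\<close>

lemma discrete_delay_form_nonneg:
  fixes Z :: "real \<Rightarrow> real"
  assumes "0 < \<tau>" "0 < n" and cont: "continuous_on UNIV Z" and Z0: "\<And>t. t \<le> 0 \<Longrightarrow> Z t = 0"
  defines "h \<equiv> \<tau> / real n"
  defines "V \<equiv> \<lambda>t. (Z t - Z (t - h)) / h"
  shows "0 \<le> integral {0..real m * \<tau>} (\<lambda>t. V t * (2/pi * V t + 4/pi^2 * V (t - \<tau>)
      - (Z t - Z (t - \<tau>)) / \<tau> + (V t - V (t - \<tau>)) / (2 * real n)))"
proof -
  have h: "0 < h" "real n * h = \<tau>" using assms by (auto simp: h_def)
  define c where "c j = (if j = 0 then 2/pi - 1/(2*real n) else if j < n then - 1/real n else 4/pi^2 - 1/(2*real n))" for j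
  have csum: "(\<Sum>j\<le>n. c j * g j) = 2/pi * g 0 + 4/pi^2 * g n - (1/2 * g 0 + (\<Sum>j=1..<n. g j) + g n/2) / real n" for g :: "nat \<Rightarrow> real"
  proof -
    have "{..n} = insert 0 (insert n {1..<n})" using \<open>0 < n\<close> by auto
    then have "(\<Sum>j\<le>n. c j * g j) = c 0 * g 0 + (c n * g n + (\<Sum>j=1..<n. c j * g j))" using \<open>0 < n\<close> by simp
    also have "(\<Sum>j=1..<n. c j * g j) = - (\<Sum>j=1..<n. g j) / real n"
      unfolding sum_negf[symmetric] sum_divide_distrib by (intro sum.cong) (auto simp: c_def)
    finally show ?thesis using \<open>0 < n\<close>
      by (simp add: c_def algebra_simps add_divide_distrib diff_divide_distrib)
  qed
  have V0: "V t = 0" if "t \<le> 0" for t using that h Z0[of t] Z0[of "t - h"] by (simp add: V_def)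
  have tele: "(\<Sum>j<k. V (t - real j * h)) = (Z t - Z (t - real k * h)) / h" for k t
  proof (induction k)
    case (Suc k)
    have "t - real k * h - h = t - real (Suc k) * h" by (simp add: algebra_simps)
    then have "V (t - real k * h) = (Z (t - real k * h) - Z (t - real (Suc k) * h)) / h"
      by (simp only: V_def)
    with Suc show ?case unfolding sum.lessThan_Suc by (simp only: add_divide_distrib[symmetric]) simp
  qed simp
  define q where "q t = V t * (\<Sum>j\<le>n. c j * V (t - real j * h))" for t
  have q_eq: "q t = V t * (2/pi * V t + 4/pi^2 * V (t - \<tau>)
      - (Z t - Z (t - \<tau>)) / \<tau> + (V t - V (t - \<tau>)) / (2 * real n))" for t
  proof -
    have "{..<n} = insert 0 {1..<n}" using \<open>0 < n\<close> by auto
    then have "(\<Sum>j<n. V (t - real j * h)) = V t + (\<Sum>j=1..<n. V (t - real j * h))" by simp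
    then have s: "(\<Sum>j=1..<n. V (t - real j * h)) = (Z t - Z (t - \<tau>)) / h - V t"
      using tele[of t n] h by simp
    have "(1/2 * V t + ((Z t - Z (t - \<tau>)) / h - V t) + V (t - \<tau>)/2) / real n
       = (Z t - Z (t - \<tau>)) / \<tau> - (V t - V (t - \<tau>)) / (2 * real n)"
    proof -
      have "(1/2 * x + (z / h - x) + y/2) / real n = z / (real n * h) - (x - y) / (2 * real n)" for x y z
        using h(1) \<open>0 < n\<close> by (simp add: field_simps)
      then show ?thesis unfolding h(2) .
    qed
    then show ?thesis unfolding q_def csum s using h by simp
  qed
  have Vc: "continuous_on UNIV (\<lambda>t. V (t - a))" for a
    unfolding V_def using h by (intro continuous_intros continuous_on_compose2[OF cont]) auto
  have qc: "continuous_on UNIV q"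
    unfolding q_def using Vc Vc[of 0] by (intro continuous_intros) auto
  have sumq: "0 \<le> (\<Sum>i<m * n. q (t + real i * h))" if "t \<in> {0..h}" for t
  proof -
    define b where "b i = V (t + real_of_int i * h)" for i :: int
    have bneg: "b i = 0" if "i < 0" for i
    proof -
      have "real_of_int i * h \<le> (-1) * h" using that h by (intro mult_right_mono) auto
      then show ?thesis unfolding b_def using \<open>t \<in> {0..h}\<close> by (intro V0) auto
    qed
    have "0 \<le> (\<Sum>j\<le>n. c j * (\<Sum>i<m * n. b (int i) * b (int i - int j)))"
    proof (rule toeplitz_form_nonneg)
      fix s :: real assume "\<bar>s\<bar> \<le> pi"
      then show "0 \<le> (\<Sum>j\<le>n. c j * cos (real j * s))"
        unfolding csum using discrete_symbol_nonneg[OF \<open>0 < n\<close>, of s] by simp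
    qed (rule bneg)
    also have "\<dots> = (\<Sum>i<m * n. \<Sum>j\<le>n. c j * (b (int i) * b (int i - int j)))"
      unfolding sum_distrib_left by (rule sum.swap)
    also have "\<dots> = (\<Sum>i<m * n. q (t + real i * h))"
      unfolding q_def b_def sum_distrib_left by (intro sum.cong refl) (simp add: algebra_simps)
    finally show ?thesis .
  qed
  have "integral {0..real m * \<tau>} q = integral {0..h} (\<lambda>t. \<Sum>i<m * n. q (t + real i * h))"
    using integral_as_sum_of_shifts[OF qc, of h "m * n"] h by (simp add: mult.assoc)
  also have "0 \<le> \<dots>" 
  proof (rule integral_nonneg)
    show "(\<lambda>t. \<Sum>i<m * n. q (t + real i * h)) integrable_on {0..h}"
      by (intro integrable_continuous_real continuous_intros continuous_on_compose2[OF qc]) auto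
  qed (use sumq in auto)
  finally show ?thesis unfolding q_eq .
qed

text \<open>
  The frequency condition in the time domain. Difference quotients of \<open>Z\<close> are bounded by the Lipschitz constant and
  converge almost everywhere to \<open>v\<close>, so \<open>discrete_delay_form_nonneg\<close> passes to the limit.
\<close>

lemma delay_form_nonneg:
  fixes Z v :: "real \<Rightarrow> real"
  assumes \<tau>: "0 < \<tau>" and Z0: "\<And>t. t \<le> 0 \<Longrightarrow> Z t = 0"
    and lip: "\<And>s t. \<bar>Z s - Z t\<bar> \<le> L * \<bar>s - t\<bar>"
    and N: "negligible N" and der: "\<And>t. t \<notin> N \<Longrightarrow> (Z has_real_derivative v t) (at t)"
  shows "0 \<le> integral {0..real m * \<tau>} (\<lambda>t. v t * (2/pi * v t + 4/pi^2 * v (t - \<tau>) - (Z t - Z (t - \<tau>)) / \<tau>))"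
proof -
  have L: "0 \<le> L" using lip[of 1 0] by simp
  have cont: "continuous_on UNIV Z"
  proof (rule continuous_on_subset)
    show "continuous_on UNIV Z"
      using lipschitz_on_continuous_on[of L UNIV Z] lip L by (auto simp: lipschitz_on_def dist_real_def)
  qed auto
  define h where "h n = \<tau> / real (Suc n)" for n
  have h: "0 < h n" for n using \<tau> by (simp add: h_def)
  have h0: "h \<longlonglongrightarrow> 0" unfolding h_def by (intro LIMSEQ_Suc[OF lim_const_over_n])
  define V where "V n t = (Z t - Z (t - h n)) / h n" for n t
  have Vb: "\<bar>V n t\<bar> \<le> L" for n t
    using lip[of t "t - h n"] h[of n] by (simp add: V_def abs_divide pos_divide_le_eq)
  have Vlim: "(\<lambda>n. V n t) \<longlonglongrightarrow> v t" if "t \<notin> N" for t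
  proof -
    have "((\<lambda>x. (Z (t + x) - Z t) / x) \<longlongrightarrow> v t) (at 0)" using der[OF that] by (simp add: DERIV_def)
    moreover have "filterlim (\<lambda>n. - h n) (at 0) sequentially"
      unfolding filterlim_at using h tendsto_minus[OF h0] by (auto intro!: always_eventually simp: less_le)
    ultimately have "(\<lambda>n. (Z (t + - h n) - Z t) / - h n) \<longlonglongrightarrow> v t" by (rule filterlim_compose)
    moreover have "(Z (t + - h n) - Z t) / - h n = V n t" for n by (simp add: V_def minus_divide_right[symmetric] minus_divide_left)
    ultimately show ?thesis by simp
  qed
  define M where "M = N \<union> (+) \<tau> ` N"
  have M: "negligible M" unfolding M_def using N by (intro negligible_Un negligible_translation)
  have notM: "t \<notin> N" "t - \<tau> \<notin> N" if "t \<notin> M" for t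
    using that by (auto simp: M_def image_iff algebra_simps dest: bspec)
  define q where "q n t = V n t * (2/pi * V n t + 4/pi^2 * V n (t - \<tau>)
      - (Z t - Z (t - \<tau>)) / \<tau> + (V n t - V n (t - \<tau>)) / (2 * real (Suc n)))" for n t
  have qpos: "0 \<le> integral {0..real m * \<tau>} (q n)" for n
    using discrete_delay_form_nonneg[OF \<tau> _ cont Z0, of "Suc n" m]
    unfolding q_def[abs_def] V_def[abs_def] h_def[abs_def] by simp
  have Vc: "continuous_on UNIV (\<lambda>t. V n (t - a))" for a n
    unfolding V_def using h[of n] by (intro continuous_intros continuous_on_compose2[OF cont]) auto
  have qc: "continuous_on UNIV (q n)" for n
    unfolding q_def using Vc[of n] Vc[of n 0] \<tau>
    by (intro continuous_intros continuous_on_compose2[OF cont]) auto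
  have qb: "\<bar>q n t\<bar> \<le> L * (2/pi * L + 4/pi^2 * L + L + 2 * L)" for n t
  proof -
    have 1: "\<bar>2/pi * V n t\<bar> \<le> 2/pi * L" using Vb[of n t] by (simp add: abs_mult divide_right_mono)
    have 2: "\<bar>4/pi^2 * V n (t - \<tau>)\<bar> \<le> 4/pi^2 * L" using Vb[of n "t - \<tau>"] by (simp add: abs_mult divide_right_mono)
    have 3: "\<bar>(Z t - Z (t - \<tau>)) / \<tau>\<bar> \<le> L" using lip[of t "t - \<tau>"] \<tau> by (simp add: abs_divide pos_divide_le_eq)
    have "\<bar>V n t - V n (t - \<tau>)\<bar> \<le> 2 * L" using Vb[of n t] Vb[of n "t - \<tau>"] by linarith
    moreover have "2 * L * 1 \<le> 2 * L * (2 * real (Suc n))" using L by (intro mult_left_mono) auto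
    ultimately have "\<bar>V n t - V n (t - \<tau>)\<bar> \<le> 2 * L * (2 * real (Suc n))" by linarith
    then have 4: "\<bar>(V n t - V n (t - \<tau>)) / (2 * real (Suc n))\<bar> \<le> 2 * L"
      by (simp add: abs_divide pos_divide_le_eq)
    have "\<bar>2/pi * V n t + 4/pi^2 * V n (t - \<tau>) - (Z t - Z (t - \<tau>)) / \<tau> + (V n t - V n (t - \<tau>)) / (2 * real (Suc n))\<bar>
       \<le> 2/pi * L + 4/pi^2 * L + L + 2 * L" using 1 2 3 4 by linarith
    then show ?thesis unfolding q_def abs_mult by (intro mult_mono Vb) (use L in auto)
  qed
  have "(\<lambda>n. integral {0..real m * \<tau>} (q n)) \<longlonglongrightarrow>
    integral {0..real m * \<tau>} (\<lambda>t. v t * (2/pi * v t + 4/pi^2 * v (t - \<tau>) - (Z t - Z (t - \<tau>)) / \<tau>))"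
  proof (rule dominated_convergence_real_AE(2)[OF _ _ M])
    show "q n integrable_on {0..real m * \<tau>}" for n
      by (rule integrable_continuous_real) (rule continuous_on_subset[OF qc], simp)
    show "(\<lambda>t. L * (2/pi * L + 4/pi^2 * L + L + 2 * L)) integrable_on {0..real m * \<tau>}"
      by (rule integrable_const_ivl)
    show "\<bar>q n t\<bar> \<le> L * (2/pi * L + 4/pi^2 * L + L + 2 * L)" for n t by (rule qb)
    fix t assume "t \<in> {0..real m * \<tau>} - M"
    then have t: "t \<notin> M" by simp
    have "(\<lambda>n. (1/2) * inverse (real (Suc n))) \<longlonglongrightarrow> 1/2 * 0"
      by (rule tendsto_mult[OF tendsto_const LIMSEQ_inverse_real_of_nat])
    then have "(\<lambda>n. (V n t - V n (t - \<tau>)) * (1/2 * inverse (real (Suc n)))) \<longlonglongrightarrow> (v t - v (t - \<tau>)) * (1/2 * 0)"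
      by (rule tendsto_mult[OF tendsto_diff[OF Vlim[OF notM(1)[OF t]] Vlim[OF notM(2)[OF t]]]])
    then have e: "(\<lambda>n. (V n t - V n (t - \<tau>)) / (2 * real (Suc n))) \<longlonglongrightarrow> 0" by (simp add: field_simps)
    have "(\<lambda>n. q n t) \<longlonglongrightarrow> v t * (2/pi * v t + 4/pi^2 * v (t - \<tau>) - (Z t - Z (t - \<tau>)) / \<tau> + 0)"
      unfolding q_def by (intro tendsto_intros e Vlim notM[OF t])
    then show "(\<lambda>n. q n t) \<longlonglongrightarrow> v t * (2/pi * v t + 4/pi^2 * v (t - \<tau>) - (Z t - Z (t - \<tau>)) / \<tau>)" by simp
  qed
  then show ?thesis by (rule LIMSEQ_le_const) (use qpos in auto)
qed

section \<open>Sector and Popov inequalities for delayed feedback\<close>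

text \<open>
  The properties of the model that decide stability: \<open>\<phi>\<close> stands for \<open>f\<^sub>1\<close>, \<open>k\<close> for the slope of its sector, \<open>L\<close> for
  a bound of its values and \<open>-p\<close> for the level at which the nonlinearity switches.
\<close>

locale delayed_feedback =
  fixes \<tau> p k L :: real and \<phi> :: "real \<Rightarrow> real"
  assumes tau_pos: "0 < \<tau>" and p_pos: "0 < p" and k_pos: "0 < k" and gain: "k * \<tau> < pi / 2"
    and phi_cont: "continuous_on UNIV \<phi>"
    and phi_sign: "\<And>x. 0 \<le> \<phi> x * x" and phi_le: "\<And>x. \<bar>\<phi> x\<bar> \<le> k * \<bar>x\<bar>"
    and phi_bounded: "\<And>x. \<bar>\<phi> x\<bar> \<le> L"
begin

definition rate :: "real \<Rightarrow> real \<Rightarrow> real" where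
  "rate x w = (if x > - p then \<phi> w else max 0 (\<phi> w))"

lemma L_nonneg: "0 \<le> L" using phi_bounded[of 0] by linarith

lemma rate_bounded: "\<bar>rate x w\<bar> \<le> L"
  using phi_bounded[of w] by (auto simp: rate_def)

text \<open>
  Switching preserves the sector, because it can only replace a value of \<open>\<phi>\<close> by zero.
\<close>

lemma rate_sector: "(rate x w)\<^sup>2 / k \<le> rate x w * w"
proof -
  have "(\<phi> w)\<^sup>2 \<le> k * (\<phi> w * w)"
  proof -
    have "\<bar>\<phi> w\<bar> * \<bar>\<phi> w\<bar> \<le> \<bar>\<phi> w\<bar> * (k * \<bar>w\<bar>)" by (intro mult_left_mono phi_le) simp
    also have "\<dots> = k * \<bar>\<phi> w * w\<bar>" by (simp add: abs_mult)
    finally show ?thesis using phi_sign[of w] by (simp add: power2_eq_square)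
  qed
  then have "(\<phi> w)\<^sup>2 / k \<le> \<phi> w * w" using k_pos by (simp add: field_simps)
  then show ?thesis by (auto simp: rate_def max_def)
qed

end

text \<open>
  The delay equation that the closed loop reduces to. The point \<open>0\<close> belongs to the exceptional set since an input,
  extended by zero to negative times, may jump there.
\<close>

locale delayed_feedback_trajectory = delayed_feedback +
  fixes f f' z v :: "real \<Rightarrow> real" and N :: "real set"
  assumes N: "negligible N" "0 \<in> N"
    and f_ac: "\<And>T. abs_continuous_on {0..T} f"
    and f_der: "\<And>t. 0 < t \<Longrightarrow> t \<notin> N \<Longrightarrow> (f has_real_derivative f' t) (at t)"
    and f'_meas: "\<And>T. f' \<in> borel_measurable (lebesgue_on {0..T})"
    and f'_square: "\<And>T. (\<lambda>t. (f' t)\<^sup>2) integrable_on {0..T}"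
    and z0: "\<And>t. t \<le> 0 \<Longrightarrow> z t = 0"
    and z_lip: "\<And>s t. \<bar>z s - z t\<bar> \<le> L * \<bar>s - t\<bar>"
    and z_der: "\<And>t. t \<notin> N \<Longrightarrow> (z has_real_derivative v t) (at t)"
    and v_eq: "\<And>t. 0 \<le> t \<Longrightarrow> v t = rate (z t) (f t - z (t - \<tau>))"
    and v0: "\<And>t. t < 0 \<Longrightarrow> v t = 0"
begin

definition w :: "real \<Rightarrow> real" where "w t = f t - z (t - \<tau>)"

lemma v_bounded: "\<bar>v t\<bar> \<le> L"
  using rate_bounded v_eq v0 L_nonneg by (cases "0 \<le> t") auto

lemma z_cont: "continuous_on S z"
  by (rule continuous_on_subset[OF lipschitz_on_continuous_on[of L UNIV]])
     (use z_lip L_nonneg in \<open>auto simp: lipschitz_on_def dist_real_def\<close>)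

lemma z_ac: "abs_continuous_on S (\<lambda>t. z (t - c))"
proof (rule abs_continuous_on_Lipschitz)
  fix s t show "\<bar>z (t - c) - z (s - c)\<bar> \<le> L * \<bar>t - s\<bar>" using z_lip[of "t - c" "s - c"] by simp
qed

lemma w_ac: "abs_continuous_on {0..T} w"
proof -
  have "abs_continuous_on {0..T} (\<lambda>t. - z (t - \<tau>))"
  proof (rule abs_continuous_on_Lipschitz)
    fix s t show "\<bar>- z (t - \<tau>) - - z (s - \<tau>)\<bar> \<le> L * \<bar>t - s\<bar>"
      using z_lip[of "s - \<tau>" "t - \<tau>"] by (simp add: abs_minus_commute)
  qed
  from abs_continuous_on_add[OF f_ac this] show ?thesis by (simp add: w_def[abs_def])
qed

lemma w_cont: "continuous_on {0..T} w"
  by (rule abs_continuous_on_imp_continuous_on[OF w_ac])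

lemma f_cont: "continuous_on {0..T} f"
  by (rule abs_continuous_on_imp_continuous_on[OF f_ac])

lemma v_meas: "v \<in> borel_measurable (lebesgue_on {0..T})"
proof -
  let ?M = "lebesgue_on {0..T}"
  have [measurable]: "z \<in> borel_measurable ?M" "w \<in> borel_measurable ?M"
    by (auto intro!: continuous_imp_measurable_on_sets_lebesgue z_cont w_cont)
  have [measurable]: "\<phi> \<in> borel_measurable borel" by (rule borel_measurable_continuous_onI[OF phi_cont])
  have "(\<lambda>t. if z t > - p then \<phi> (w t) else max 0 (\<phi> (w t))) \<in> borel_measurable ?M" by measurable
  then show ?thesis
    by (rule measurable_cong[THEN iffD1, rotated]) (auto simp: v_eq rate_def w_def)
qed

lemma v_delayed_meas: "(\<lambda>t. v (t - \<tau>)) \<in> borel_measurable (lebesgue_on {0..T})"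
proof -
  have right: "v integrable_on {0..max 0 (T - \<tau>)}"
    by (rule measurable_bounded_by_integrable_imp_integrable[OF v_meas integrable_const_ivl[of L]])
       (use v_bounded in auto)
  have left: "v integrable_on {-\<tau>..0}"
    by (rule integrable_spike[OF integrable_0 negligible_sing[of 0]]) (use v0 in auto)
  have "v integrable_on {-\<tau>..max 0 (T - \<tau>)}"
    by (rule Henstock_Kurzweil_Integration.integrable_combine[OF _ _ left right]) (use tau_pos in simp_all)
  then have "v integrable_on {0 - \<tau>..T - \<tau>}"
    by (rule integrable_on_subinterval) auto
  then have "(\<lambda>t. v (t - \<tau>)) integrable_on {0..T}"
    using integrable_shift_real_ivl[of v "0 - \<tau>" "T - \<tau>" "- \<tau>"] by simp
  then show ?thesis by (rule integrable_imp_measurable)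
qed

lemma bounded_meas_integrable:
  fixes g :: "real \<Rightarrow> real"
  assumes "g \<in> borel_measurable (lebesgue_on {0..T})" "\<And>t. t \<in> {0..T} \<Longrightarrow> \<bar>g t\<bar> \<le> B"
  shows "g integrable_on {0..T}"
  by (rule measurable_bounded_by_integrable_imp_integrable[OF assms(1) integrable_const_ivl[of B]])
     (use assms in auto)

lemma v_mult_cont_integrable:
  assumes "continuous_on {0..T} g" shows "(\<lambda>t. v t * g t) integrable_on {0..T}"
proof -
  obtain B where B: "\<And>t. t \<in> {0..T} \<Longrightarrow> \<bar>g t\<bar> \<le> B" using continuous_on_Icc_bounded[OF assms] by metis
  have [measurable]: "g \<in> borel_measurable (lebesgue_on {0..T})"
    by (auto intro!: continuous_imp_measurable_on_sets_lebesgue assms)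
  note v_meas[measurable]
  show ?thesis
  proof (rule bounded_meas_integrable)
    show "(\<lambda>t. v t * g t) \<in> borel_measurable (lebesgue_on {0..T})" by measurable
    show "\<bar>v t * g t\<bar> \<le> L * B" if "t \<in> {0..T}" for t
      unfolding abs_mult using v_bounded B[OF that] L_nonneg by (intro mult_mono) auto
  qed
qed

lemma f'_abs_int: "f' absolutely_integrable_on {0..T}"
proof (rule measurable_bounded_by_integrable_imp_absolutely_integrable[OF f'_meas])
  show "(\<lambda>t. 1 + (f' t)\<^sup>2) integrable_on {0..T}"
    by (intro integrable_add f'_square integrable_const_ivl)
  show "norm (f' x) \<le> 1 + (f' x)\<^sup>2" for x
  proof -
    have "0 \<le> (\<bar>f' x\<bar> - 1)\<^sup>2" by simp
    then show ?thesis by (simp add: power2_eq_square algebra_simps)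
  qed
qed auto

lemma bounded_meas_mult_w'_abs_int:
  assumes g: "g \<in> borel_measurable (lebesgue_on {0..T})" and B: "\<And>t. t \<in> {0..T} \<Longrightarrow> \<bar>g t\<bar> \<le> B"
  shows "(\<lambda>t. g t * (f' t - v (t - \<tau>))) absolutely_integrable_on {0..T}"
proof (rule absolutely_integrable_bounded_measurable_product_real[OF g])
  show "bounded (g ` {0..T})" unfolding bounded_iff using B by (intro exI[of _ B]) auto
  have "(\<lambda>t. v (t - \<tau>)) absolutely_integrable_on {0..T}"
    by (rule measurable_bounded_by_integrable_imp_absolutely_integrable[OF v_delayed_meas _ integrable_const_ivl[of L]])
       (use v_bounded in auto)
  then show "(\<lambda>t. f' t - v (t - \<tau>)) absolutely_integrable_on {0..T}"
    by (rule set_integral_diff(1)[OF f'_abs_int])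
qed auto

lemma w_der:
  assumes "0 < t" "t \<notin> N" "t - \<tau> \<notin> N"
  shows "(w has_real_derivative f' t - v (t - \<tau>)) (at t)"
proof -
  have "((\<lambda>t. z (t - \<tau>)) has_real_derivative v (t - \<tau>)) (at t)"
    using z_der[OF assms(3)] DERIV_shift[of z "v (t - \<tau>)" t "- \<tau>"] by simp
  from DERIV_diff[OF f_der[OF assms(1,2)] this] show ?thesis by (simp add: w_def[abs_def])
qed

lemma v_v_delayed_integrable: "(\<lambda>t. v t * v (t - \<tau>)) integrable_on {0..T}"
proof (rule bounded_meas_integrable)
  show "(\<lambda>t. v t * v (t - \<tau>)) \<in> borel_measurable (lebesgue_on {0..T})"
    using v_meas v_delayed_meas by (rule borel_measurable_times)
  show "\<bar>v t * v (t - \<tau>)\<bar> \<le> L * L" for t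
    unfolding abs_mult by (intro mult_mono v_bounded L_nonneg) auto
qed

lemma v_square_integrable: "(\<lambda>t. (v t)\<^sup>2) integrable_on {0..T}"
proof (rule bounded_meas_integrable)
  note v_meas[measurable]
  show "(\<lambda>t. (v t)\<^sup>2) \<in> borel_measurable (lebesgue_on {0..T})" by measurable
  show "\<bar>(v t)\<^sup>2\<bar> \<le> L\<^sup>2" for t using v_bounded[of t] by (simp add: abs_le_square_iff[symmetric])
qed

lemma v_f'_integrable: "(\<lambda>t. v t * f' t) integrable_on {0..T}"
proof -
  have "(\<lambda>t. v t * f' t) absolutely_integrable_on {0..T}"
    by (rule absolutely_integrable_bounded_measurable_product_real[OF v_meas _ _ f'_abs_int])
       (use v_bounded in \<open>auto simp: bounded_iff\<close>)
  then show ?thesis by (rule set_lebesgue_integral_eq_integral(1))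
qed

lemma z_delayed_cont: "continuous_on S (\<lambda>t. z (t - \<tau>))"
  by (rule continuous_on_compose2[OF z_cont[of UNIV]]) (auto intro!: continuous_intros)

lemma f_square_integrable: "(\<lambda>t. (f t)\<^sup>2) integrable_on {0..T}"
  by (intro integrable_continuous_real continuous_intros f_cont)

text \<open>
  Multiply \<open>w = f + (z - z(\<cdot> - \<tau>)) - z\<close> by \<open>v\<close> and apply the sector condition: the last summand contributes
  \<open>- \<integral> v z = - z(T)\<^sup>2/2\<close>, which may be dropped.
\<close>

lemma sector_inequality:
  assumes "0 \<le> T"
  shows "integral {0..T} (\<lambda>t. (v t)\<^sup>2) / k - integral {0..T} (\<lambda>t. v t * (z t - z (t - \<tau>)))
    \<le> integral {0..T} (\<lambda>t. v t * f t)"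
proof -
  have zz: "((\<lambda>t. 2 * (v t * z t)) has_integral (z T * z T - z 0 * z 0)) {0..T}"
  proof (rule abs_continuous_FTC[OF assms _ N(1)])
    show "abs_continuous_on {0..T} (\<lambda>t. z t * z t)"
      using abs_continuous_on_mult[OF z_ac[of _ 0] z_ac[of _ 0], of 0 T] by simp
    fix t assume "t \<in> {0..T} - N"
    then have "(z has_real_derivative v t) (at t)" using z_der by auto
    from DERIV_mult[OF this this] have "((\<lambda>t. z t * z t) has_real_derivative 2 * (v t * z t)) (at t)"
      by (simp add: mult.commute)
    then show "((\<lambda>t. z t * z t) has_real_derivative 2 * (v t * z t)) (at t within {0..T})"
      by (rule has_field_derivative_at_within)
  qed
  have vz_nonneg: "0 \<le> integral {0..T} (\<lambda>t. v t * z t)"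
  proof -
    have "2 * integral {0..T} (\<lambda>t. v t * z t) = z T * z T" using integral_unique[OF zz] z0[of 0] by simp
    moreover have "0 \<le> z T * z T" by simp
    ultimately show ?thesis by linarith
  qed
  have i1: "(\<lambda>t. v t * z t) integrable_on {0..T}" by (rule v_mult_cont_integrable[OF z_cont])
  have i2: "(\<lambda>t. v t * (z t - z (t - \<tau>))) integrable_on {0..T}"
    by (rule v_mult_cont_integrable) (intro continuous_intros z_cont z_delayed_cont)
  have i3: "(\<lambda>t. v t * f t) integrable_on {0..T}" by (rule v_mult_cont_integrable[OF f_cont])
  have "integral {0..T} (\<lambda>t. (v t)\<^sup>2 / k) \<le> integral {0..T} (\<lambda>t. v t * f t + v t * (z t - z (t - \<tau>)) - v t * z t)"
  proof (rule integral_le)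
    show "(\<lambda>t. (v t)\<^sup>2 / k) integrable_on {0..T}" using v_square_integrable by (rule integrable_on_divide)
    show "(\<lambda>t. v t * f t + v t * (z t - z (t - \<tau>)) - v t * z t) integrable_on {0..T}"
      by (intro integrable_add integrable_diff i1 i2 i3)
    fix t assume "t \<in> {0..T}"
    then show "(v t)\<^sup>2 / k \<le> v t * f t + v t * (z t - z (t - \<tau>)) - v t * z t"
      using rate_sector[of "z t" "f t - z (t - \<tau>)"] v_eq[of t] by (simp add: algebra_simps)
  qed
  also have "\<dots> = integral {0..T} (\<lambda>t. v t * f t) + integral {0..T} (\<lambda>t. v t * (z t - z (t - \<tau>))) - integral {0..T} (\<lambda>t. v t * z t)"
    using i1 i2 i3 by (simp add: Henstock_Kurzweil_Integration.integral_diff Henstock_Kurzweil_Integration.integral_add integrable_add)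
  finally show ?thesis using vz_nonneg by simp
qed

text \<open>
  Since \<open>w' = f' - v(\<cdot> - \<tau>)\<close>, the claim is \<open>\<integral> v w' \<ge> - k f(0)\<^sup>2\<close>. If \<open>v\<close> were \<open>\<phi>(w)\<close>, the integral would be the
  increment of an antiderivative of \<open>\<phi>\<close> along \<open>w\<close>. The switch instead multiplies the negative part of \<open>\<phi>\<close> by the
  indicator of \<open>z > -p\<close>. That indicator is approximated by continuously differentiable increasing cutoffs \<open>\<rho>\<^sub>n\<close>; with antiderivatives
  \<open>P\<close>, \<open>Q\<close> of the positive and negative part, the function \<open>P(w) + \<rho>\<^sub>n(z) Q(w)\<close> has the additional derivative term
  \<open>\<rho>\<^sub>n'(z) v Q(w)\<close>. It is nonpositive: \<open>Q(w)\<close> vanishes unless \<open>w < 0\<close>, and then \<open>v \<le> 0\<close>. So it can be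
  discarded before \<open>n\<close> tends to infinity.
\<close>

lemma popov_inequality:
  assumes T: "0 \<le> T"
  shows "integral {0..T} (\<lambda>t. v t * v (t - \<tau>)) \<le> integral {0..T} (\<lambda>t. v t * f' t) + k * (f 0)\<^sup>2"
proof -
  define \<phi>p where "\<phi>p x = max 0 (\<phi> x)" for x
  define \<phi>m where "\<phi>m x = min 0 (\<phi> x)" for x
  have cp: "continuous_on UNIV \<phi>p" and cm: "continuous_on UNIV \<phi>m"
    unfolding \<phi>p_def \<phi>m_def by (intro continuous_intros phi_cont)+
  have sum: "\<phi>p x + \<phi>m x = \<phi> x" for x by (simp add: \<phi>p_def \<phi>m_def max_def min_def)
  obtain P where P: "P 0 = 0" "\<And>x. (P has_real_derivative \<phi>p x) (at x)"
    using continuous_antiderivative[OF cp] by metis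
  obtain Q where Q: "Q 0 = 0" "\<And>x. (Q has_real_derivative \<phi>m x) (at x)"
    using continuous_antiderivative[OF cm] by metis
  have sp: "0 \<le> \<phi>p x * x" and sm: "0 \<le> \<phi>m x * x" for x
    using phi_sign[of x] by (auto simp: \<phi>p_def \<phi>m_def max_def min_def)
  have bp: "\<bar>\<phi>p x\<bar> \<le> k * \<bar>x\<bar>" and bm: "\<bar>\<phi>m x\<bar> \<le> k * \<bar>x\<bar>" for x
    using phi_le[of x] k_pos by (auto simp: \<phi>p_def \<phi>m_def max_def min_def)
  have k0: "0 \<le> k" using k_pos by simp
  have P0: "0 \<le> P x" and Q0: "0 \<le> Q x" for x
    using antiderivative_of_sector_bounded(1)[OF P sp bp k0] antiderivative_of_sector_bounded(1)[OF Q sm bm k0] by auto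
  have PQ: "P x + Q x \<le> k * x\<^sup>2" for x
  proof (rule antiderivative_of_sector_bounded(2)[where P = "\<lambda>x. P x + Q x" and g = \<phi>])
    show "((\<lambda>x. P x + Q x) has_real_derivative \<phi> x) (at x)" for x
      using DERIV_add[OF P(2) Q(2), of x] by (simp add: sum)
  qed (use P Q phi_sign phi_le k0 in auto)
  have Qpos: "Q x = 0" if "0 \<le> x" for x
  proof (cases "x = 0")
    case False
    then have "0 < x" using that by simp
    from MVT2[OF this Q(2)] obtain \<xi> where \<xi>: "0 < \<xi>" "Q x - Q 0 = (x - 0) * \<phi>m \<xi>" by auto
    have "0 \<le> \<phi> \<xi>" using phi_sign[of \<xi>] \<xi>(1) by (simp add: zero_le_mult_iff)
    then show ?thesis using \<xi>(2) Q(1) by (simp add: \<phi>m_def)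
  qed (use Q in simp)
  define \<rho> where "\<rho> n x = 1 - exp (- (real n * (max 0 (x + p))\<^sup>2))" for n x
  define \<rho>' where "\<rho>' n x = real n * (2 * max 0 (x + p)) * exp (- (real n * (max 0 (x + p))\<^sup>2))" for n x
  have \<rho>_der: "(\<rho> n has_real_derivative \<rho>' n x) (at x)" for n x
  proof -
    have "((\<lambda>x. (max 0 (x + p))\<^sup>2) has_real_derivative 2 * max 0 (x + p)) (at x)"
      using has_real_derivative_max0_square[of "x + p"] DERIV_shift[of "\<lambda>x. (max 0 x)\<^sup>2" "2 * max 0 (x + p)" x p] by simp
    moreover have "((\<lambda>y. 1 - exp (- (real n * y))) has_real_derivative real n * exp (- (real n * y))) (at y)" for y
      by (auto intro!: derivative_eq_intros)
    ultimately have "((\<lambda>x. 1 - exp (- (real n * (max 0 (x + p))\<^sup>2))) has_real_derivative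
        real n * exp (- (real n * (max 0 (x + p))\<^sup>2)) * (2 * max 0 (x + p))) (at x)"
      by (rule DERIV_chain2[rotated])
    then show ?thesis unfolding \<rho>_def[abs_def] \<rho>'_def by (simp only: mult_ac)
  qed
  have \<rho>'_cont: "continuous_on S (\<rho>' n)" for S n
    unfolding \<rho>'_def[abs_def] by (intro continuous_intros)
  have \<rho>_cont: "continuous_on S (\<rho> n)" for S n
    unfolding \<rho>_def[abs_def] by (intro continuous_intros)
  have \<rho>01: "0 \<le> \<rho> n x" "\<rho> n x \<le> 1" for n x by (auto simp: \<rho>_def)
  have \<rho>'0: "0 \<le> \<rho>' n x" for n x by (auto simp: \<rho>'_def)
  have \<rho>_lim: "(\<lambda>n. \<rho> n x) \<longlonglongrightarrow> (if x > - p then 1 else 0)" for x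
  proof (cases "x > - p")
    case True
    then have "0 < (max 0 (x + p))\<^sup>2" by simp
    then have "(\<lambda>n. exp (- (real n * (max 0 (x + p))\<^sup>2))) \<longlonglongrightarrow> 0"
      by (intro filterlim_compose[OF exp_at_bot] filterlim_uminus_at_top[THEN iffD1]
          filterlim_at_top_mult_tendsto_pos[OF tendsto_const, where c = "(max 0 (x + p))\<^sup>2" , simplified mult.commute]
          filterlim_real_sequentially)
    from tendsto_diff[OF tendsto_const[of 1] this] show ?thesis using True by (simp add: \<rho>_def)
  next
    case False
    then show ?thesis by (simp add: \<rho>_def)
  qed
  define M where "M = N \<union> (+) \<tau> ` N"
  have M: "negligible M" unfolding M_def using N by (intro negligible_Un negligible_translation)
  have notM: "t \<notin> N" "t - \<tau> \<notin> N" "t \<noteq> 0" if "t \<notin> M" for t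
    using that N(2) by (auto simp: M_def image_iff algebra_simps dest: bspec)
  define w' where "w' t = f' t - v (t - \<tau>)" for t
  define a where "a n t = \<phi>p (w t) + \<rho> n (z t) * \<phi>m (w t)" for n t
  define H where "H n t = P (w t) + \<rho> n (z t) * Q (w t)" for n t
  define D where "D n t = \<rho>' n (z t) * v t * Q (w t) + a n t * w' t" for n t
  have zac: "abs_continuous_on S z" for S using z_ac[of S 0] by simp
  have FTC: "(D n has_integral (H n T - H n 0)) {0..T}" for n
  proof (rule abs_continuous_FTC[OF T _ M])
    show "abs_continuous_on {0..T} (H n)"
      unfolding H_def[abs_def]
      by (intro abs_continuous_on_add abs_continuous_on_mult abs_continuous_on_compose_C1[OF w_ac P(2) cp]
          abs_continuous_on_compose_C1[OF w_ac Q(2) cm] abs_continuous_on_compose_C1[OF zac \<rho>_der \<rho>'_cont])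
    fix t assume t: "t \<in> {0..T} - M"
    then have "0 < t" using notM[of t] by auto
    have wd: "(w has_real_derivative w' t) (at t)"
      unfolding w'_def using t notM[of t] by (intro w_der \<open>0 < t\<close>) auto
    have zd: "(z has_real_derivative v t) (at t)" using t notM[of t] by (intro z_der) auto
    have "((\<lambda>t. P (w t) + \<rho> n (z t) * Q (w t)) has_real_derivative
       \<phi>p (w t) * w' t + (\<rho>' n (z t) * v t * Q (w t) + \<phi>m (w t) * w' t * \<rho> n (z t))) (at t)"
      by (intro DERIV_add DERIV_mult DERIV_chain2[OF P(2) wd] DERIV_chain2[OF Q(2) wd] DERIV_chain2[OF \<rho>_der zd])
    moreover have "\<phi>p (w t) * w' t + (\<rho>' n (z t) * v t * Q (w t) + \<phi>m (w t) * w' t * \<rho> n (z t)) = D n t"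
      unfolding D_def a_def by (simp add: algebra_simps)
    ultimately have "((\<lambda>t. P (w t) + \<rho> n (z t) * Q (w t)) has_real_derivative D n t) (at t)" by simp
    then show "(H n has_real_derivative D n t) (at t within {0..T})"
      unfolding H_def[abs_def] by (rule has_field_derivative_at_within)
  qed
  have cz: "continuous_on {0..T} (\<lambda>t. \<rho> n (z t))" for n
    by (rule continuous_on_compose2[OF \<rho>_cont[of UNIV] z_cont]) auto
  have cpw: "continuous_on {0..T} (\<lambda>t. \<phi>p (w t))" and cmw: "continuous_on {0..T} (\<lambda>t. \<phi>m (w t))"
    by (auto intro!: continuous_on_compose2[OF cp w_cont] continuous_on_compose2[OF cm w_cont])
  have a_bound: "\<bar>a n t\<bar> \<le> L" for n t
  proof -
    have "\<bar>\<phi>p x + r * \<phi>m x\<bar> \<le> L" if "0 \<le> r" "r \<le> 1" for r x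
    proof (cases "0 \<le> \<phi> x")
      case True then show ?thesis using phi_bounded[of x] by (simp add: \<phi>p_def \<phi>m_def)
    next
      case False
      then have "\<bar>\<phi>p x + r * \<phi>m x\<bar> = r * \<bar>\<phi> x\<bar>" using that by (simp add: \<phi>p_def \<phi>m_def abs_mult)
      also have "\<dots> \<le> 1 * L" using that phi_bounded[of x] by (intro mult_mono) auto
      finally show ?thesis by simp
    qed
    then show ?thesis unfolding a_def using \<rho>01 by blast
  qed
  have aw_abs: "(\<lambda>t. a n t * w' t) absolutely_integrable_on {0..T}" for n
    unfolding w'_def
  proof (rule bounded_meas_mult_w'_abs_int[OF _ a_bound])
    show "a n \<in> borel_measurable (lebesgue_on {0..T})"
      unfolding a_def[abs_def] by (intro continuous_imp_measurable_on_sets_lebesgue continuous_intros cz cpw cmw) auto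
  qed
  have w'_abs: "w' absolutely_integrable_on {0..T}"
    using bounded_meas_mult_w'_abs_int[of "\<lambda>_. 1" T 1] by (simp add: w'_def[abs_def])
  have lower: "- (k * (f 0)\<^sup>2) \<le> integral {0..T} (\<lambda>t. a n t * w' t)" for n
  proof -
    have "H n T - H n 0 \<le> integral {0..T} (\<lambda>t. a n t * w' t)"
    proof (rule has_integral_le[OF FTC[of n] integrable_integral])
      show "(\<lambda>t. a n t * w' t) integrable_on {0..T}"
        using aw_abs by (rule set_lebesgue_integral_eq_integral(1))
      fix t assume t: "t \<in> {0..T}"
      have "v t * Q (w t) \<le> 0"
      proof (cases "0 \<le> w t")
        case False
        then have "\<phi> (w t) \<le> 0" using phi_sign[of "w t"] by (simp add: zero_le_mult_iff)
        then have "v t \<le> 0" using v_eq[of t] t by (auto simp: rate_def w_def)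
        then show ?thesis using Q0[of "w t"] by (rule mult_nonpos_nonneg)
      qed (simp add: Qpos)
      then have "\<rho>' n (z t) * (v t * Q (w t)) \<le> 0" by (rule mult_nonneg_nonpos[OF \<rho>'0])
      then show "D n t \<le> a n t * w' t" by (simp add: D_def mult.assoc)
    qed
    moreover have "0 \<le> H n T" unfolding H_def using P0 Q0 \<rho>01 by simp
    moreover have "H n 0 \<le> k * (f 0)\<^sup>2"
    proof -
      have "w 0 = f 0" using z0[of "- \<tau>"] tau_pos by (simp add: w_def)
      moreover have "\<rho> n (z 0) * Q (w 0) \<le> 1 * Q (w 0)" using \<rho>01 Q0 by (intro mult_right_mono) auto
      ultimately show ?thesis unfolding H_def using PQ[of "f 0"] by simp
    qed
    ultimately show ?thesis by linarith
  qed
  have "(\<lambda>n. integral {0..T} (\<lambda>t. a n t * w' t)) \<longlonglongrightarrow> integral {0..T} (\<lambda>t. v t * w' t)"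
  proof (rule dominated_convergence(2))
    show "(\<lambda>t. a n t * w' t) integrable_on {0..T}" for n
      using aw_abs by (rule set_lebesgue_integral_eq_integral(1))
    show "(\<lambda>t. L * \<bar>w' t\<bar>) integrable_on {0..T}"
      using w'_abs unfolding absolutely_integrable_on_def real_norm_def by (intro integrable_on_mult_right) simp
    show "norm (a n t * w' t) \<le> L * \<bar>w' t\<bar>" for n t
      unfolding real_norm_def abs_mult using a_bound by (intro mult_right_mono) auto
    fix t assume t: "t \<in> {0..T}"
    have "(\<lambda>n. a n t * w' t) \<longlonglongrightarrow> (\<phi>p (w t) + (if z t > - p then 1 else 0) * \<phi>m (w t)) * w' t"
      unfolding a_def by (intro tendsto_intros \<rho>_lim)
    moreover have "\<phi>p (w t) + (if z t > - p then 1 else 0) * \<phi>m (w t) = v t"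
      using v_eq[of t] t sum[of "w t"] by (auto simp: rate_def w_def \<phi>p_def)
    ultimately show "(\<lambda>n. a n t * w' t) \<longlonglongrightarrow> v t * w' t" by simp
  qed
  then have main: "- (k * (f 0)\<^sup>2) \<le> integral {0..T} (\<lambda>t. v t * w' t)"
    by (rule LIMSEQ_le_const) (use lower in auto)
  have "integral {0..T} (\<lambda>t. v t * w' t) = integral {0..T} (\<lambda>t. v t * f' t) - integral {0..T} (\<lambda>t. v t * v (t - \<tau>))"
    using Henstock_Kurzweil_Integration.integral_diff[OF v_f'_integrable v_v_delayed_integrable] by (simp add: w'_def right_diff_distrib)
  then show ?thesis using main by linarith
qed

text \<open>
  \<open>delay_form_nonneg\<close> applies to the state stopped at time \<open>T\<close>, whose derivative vanishes after \<open>T\<close>; its horizon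
  can then be enlarged to a multiple of \<open>\<tau>\<close>.
\<close>

lemma coercivity:
  assumes T: "0 \<le> T"
  shows "integral {0..T} (\<lambda>t. v t * (z t - z (t - \<tau>))) / \<tau>
    \<le> 2/pi * integral {0..T} (\<lambda>t. (v t)\<^sup>2) + 4/pi\<^sup>2 * integral {0..T} (\<lambda>t. v t * v (t - \<tau>))"
proof -
  define Z where "Z t = z (min t T)" for t
  define V where "V t = (if t \<le> T then v t else 0)" for t
  obtain m :: nat where m: "T \<le> real m * \<tau>"
    using reals_Archimedean3[OF tau_pos] by (metis less_imp_le)
  have "0 \<le> integral {0..real m * \<tau>} (\<lambda>t. V t * (2/pi * V t + 4/pi^2 * V (t - \<tau>) - (Z t - Z (t - \<tau>)) / \<tau>))"
  proof (rule delay_form_nonneg[OF tau_pos])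
    show "Z t = 0" if "t \<le> 0" for t using that z0[of "min t T"] by (simp add: Z_def)
    show "\<bar>Z s - Z t\<bar> \<le> L * \<bar>s - t\<bar>" for s t
    proof -
      have "\<bar>min s T - min t T\<bar> \<le> \<bar>s - t\<bar>" by (simp add: min_def)
      from mult_left_mono[OF this L_nonneg] z_lip[of "min s T" "min t T"] show ?thesis unfolding Z_def by linarith
    qed
    show "negligible (insert T N)" using N by simp
    fix t assume t: "t \<notin> insert T N"
    show "(Z has_real_derivative V t) (at t)"
    proof (cases "t < T")
      case True
      have "(z has_real_derivative v t) (at t)" using t z_der by simp
      then have "(Z has_real_derivative v t) (at t)"
        by (rule DERIV_cong_ev[THEN iffD1, rotated -1, OF _ refl])
           (use True in \<open>auto simp: Z_def intro!: eventually_mono[OF eventually_nhds_in_open[of "{..<T}" t]]\<close>)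
      then show ?thesis using True by (simp add: V_def)
    next
      case False
      then have "T < t" using t by simp
      have "((\<lambda>_. z T) has_real_derivative 0) (at t)" by simp
      then have "(Z has_real_derivative 0) (at t)"
        by (rule DERIV_cong_ev[THEN iffD1, rotated -1, OF _ refl])
           (use \<open>T < t\<close> in \<open>auto simp: Z_def min_def intro!: eventually_mono[OF eventually_nhds_in_open[of "{T<..}" t]]\<close>)
      then show ?thesis using \<open>T < t\<close> by (simp add: V_def)
    qed
  qed
  also have "integral {0..real m * \<tau>} (\<lambda>t. V t * (2/pi * V t + 4/pi^2 * V (t - \<tau>) - (Z t - Z (t - \<tau>)) / \<tau>))
     = 2/pi * integral {0..T} (\<lambda>t. (v t)\<^sup>2) + 4/pi\<^sup>2 * integral {0..T} (\<lambda>t. v t * v (t - \<tau>))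
       - integral {0..T} (\<lambda>t. v t * (z t - z (t - \<tau>))) / \<tau>" (is "integral _ ?g = ?R")
  proof (rule integral_unique, rule has_integral_on_superset[where S = "{0..T}"])
    have i: "(\<lambda>t. v t * (z t - z (t - \<tau>))) integrable_on {0..T}"
      by (rule v_mult_cont_integrable) (intro continuous_intros z_cont z_delayed_cont)
    have "((\<lambda>t. 2/pi * (v t)\<^sup>2 + 4/pi\<^sup>2 * (v t * v (t - \<tau>)) - (v t * (z t - z (t - \<tau>))) / \<tau>) has_integral ?R) {0..T}"
      by (intro has_integral_add has_integral_diff has_integral_mult_right has_integral_divide
          integrable_integral v_square_integrable v_v_delayed_integrable i)
    then show "(?g has_integral ?R) {0..T}"
    proof (rule has_integral_eq[rotated])
      fix t assume t: "t \<in> {0..T}"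
      then have e: "V t = v t" "V (t - \<tau>) = v (t - \<tau>)" "Z t = z t" "Z (t - \<tau>) = z (t - \<tau>)"
        using tau_pos by (auto simp: V_def Z_def min_def)
      show "2/pi * (v t)\<^sup>2 + 4/pi\<^sup>2 * (v t * v (t - \<tau>)) - (v t * (z t - z (t - \<tau>))) / \<tau> = ?g t"
        unfolding e by (simp add: algebra_simps power2_eq_square diff_divide_distrib)
    qed
    show "{0..T} \<subseteq> {0..real m * \<tau>}" using m by auto
    fix t assume "t \<notin> {0..T}"
    then have "V t = 0" using v0 by (auto simp: V_def)
    then show "?g t = 0" by simp
  qed
  finally show ?thesis by linarith
qed

text \<open>
  Integrate the derivative of \<open>(1 - t) f(t)\<^sup>2\<close> over the unit interval.
\<close>

lemma initial_value_bound:
  assumes T: "1 \<le> T"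
  shows "(f 0)\<^sup>2 \<le> 2 * integral {0..T} (\<lambda>t. (f t)\<^sup>2 + (f' t)\<^sup>2)"
proof -
  let ?F = "\<lambda>t. (1 - t) * (f t * f t)"
  let ?D = "\<lambda>t. - (f t * f t) + (1 - t) * (2 * (f' t * f t))"
  have sq: "(\<lambda>t. (f t)\<^sup>2 + (f' t)\<^sup>2) integrable_on {0..T}" for T
    by (intro integrable_add f_square_integrable f'_square)
  have "(?D has_integral (?F 1 - ?F 0)) {0..1}"
  proof (rule abs_continuous_FTC[OF _ _ N(1)])
    show "abs_continuous_on {0..1} ?F"
      by (intro abs_continuous_on_mult f_ac abs_continuous_on_Lipschitz[where L = 1]) auto
    fix t :: real assume t: "t \<in> {0..1} - N"
    then have "0 < t" using N(2) by (cases "t = 0") auto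
    then have fd: "(f has_real_derivative f' t) (at t)" using t by (intro f_der) auto
    have "((\<lambda>t. 1 - t) has_real_derivative -1) (at t)" by (auto intro!: derivative_eq_intros)
    from DERIV_mult[OF this DERIV_mult[OF fd fd]]
    have "(?F has_real_derivative (-1) * (f t * f t) + (f' t * f t + f' t * f t) * (1 - t)) (at t)" .
    moreover have "(-1) * (f t * f t) + (f' t * f t + f' t * f t) * (1 - t) = ?D t" by (simp add: algebra_simps)
    ultimately have "(?F has_real_derivative ?D t) (at t)" by metis
    then show "(?F has_real_derivative ?D t) (at t within {0..1})" by (rule has_field_derivative_at_within)
  qed simp
  then have "((\<lambda>t. - ?D t) has_integral (f 0)\<^sup>2) {0..1}"
    using has_integral_neg[of ?D] by (force simp: power2_eq_square)
  moreover have "((\<lambda>t. 2 * ((f t)\<^sup>2 + (f' t)\<^sup>2)) has_integral (2 * integral {0..1} (\<lambda>t. (f t)\<^sup>2 + (f' t)\<^sup>2))) {0..1}"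
    by (intro has_integral_mult_right integrable_integral sq)
  ultimately have "(f 0)\<^sup>2 \<le> 2 * integral {0..1} (\<lambda>t. (f t)\<^sup>2 + (f' t)\<^sup>2)"
  proof (rule has_integral_le)
    fix t :: real assume t: "t \<in> {0..1}"
    have "2 * \<bar>f' t * f t\<bar> \<le> (f t)\<^sup>2 + (f' t)\<^sup>2"
      using zero_le_power2[of "\<bar>f t\<bar> - \<bar>f' t\<bar>"] by (simp add: power2_eq_square abs_mult algebra_simps)
    then have "\<bar>1 - t\<bar> * \<bar>2 * (f' t * f t)\<bar> \<le> 1 * ((f t)\<^sup>2 + (f' t)\<^sup>2)"
      using t by (intro mult_mono) (auto simp: abs_mult)
    then have "\<bar>(1 - t) * (2 * (f' t * f t))\<bar> \<le> (f t)\<^sup>2 + (f' t)\<^sup>2" unfolding abs_mult[symmetric] by simp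
    from order_trans[OF abs_ge_minus_self this]
    have *: "- ((1 - t) * (2 * (f' t * f t))) \<le> (f t)\<^sup>2 + (f' t)\<^sup>2" .
    have "- ?D t = (f t)\<^sup>2 + - ((1 - t) * (2 * (f' t * f t)))" by (simp add: power2_eq_square)
    also have "\<dots> \<le> (f t)\<^sup>2 + ((f t)\<^sup>2 + (f' t)\<^sup>2)" by (rule add_left_mono[OF *])
    also have "\<dots> \<le> 2 * ((f t)\<^sup>2 + (f' t)\<^sup>2)" by simp
    finally show "- ?D t \<le> 2 * ((f t)\<^sup>2 + (f' t)\<^sup>2)" .
  qed
  also have "integral {0..1} (\<lambda>t. (f t)\<^sup>2 + (f' t)\<^sup>2) \<le> integral {0..T} (\<lambda>t. (f t)\<^sup>2 + (f' t)\<^sup>2)"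
    using T by (intro integral_subset_le sq) auto
  finally show ?thesis by simp
qed

end

context delayed_feedback begin

definition margin :: real where "margin = 1 / (k * \<tau>) - 2 / pi"

text \<open>
  The constant that Young's inequality yields in \<open>energy_bound\<close>, where half of the margin absorbs the products
  of \<open>v\<close> with the input.
\<close>

definition energy_gain :: real where
  "energy_gain = 2 / margin * ((1/\<tau>\<^sup>2 + (4/pi\<^sup>2)\<^sup>2) / margin + 8/pi\<^sup>2 * k)"

lemma margin_pos: "0 < margin"
proof -
  have "0 < k * \<tau>" using k_pos tau_pos by simp
  then show ?thesis using gain unfolding margin_def by (simp add: field_simps)
qed

lemma energy_gain_nonneg: "0 \<le> energy_gain"
  unfolding energy_gain_def using margin_pos k_pos by simp

end

context delayed_feedback_trajectory begin

text \<open>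
  The sector inequality divided by \<open>\<tau>\<close>, plus the Popov inequality with multiplier \<open>4/\<pi>\<^sup>2\<close>, plus coercivity:
  the terms with the delay cancel and \<open>margin \<cdot> \<integral> v\<^sup>2\<close> remains on the left.
\<close>

lemma energy_bound:
  assumes T: "1 \<le> T"
  shows "integral {0..T} (\<lambda>t. (v t)\<^sup>2) \<le> energy_gain * integral {0..T} (\<lambda>t. (f t)\<^sup>2 + (f' t)\<^sup>2)"
proof -
  have T0: "0 \<le> T" using T by simp
  define q :: real where "q = 4/pi\<^sup>2"
  have q: "0 < q" by (simp add: q_def)
  define A where "A = integral {0..T} (\<lambda>t. (v t)\<^sup>2)"
  define X where "X = integral {0..T} (\<lambda>t. (f t)\<^sup>2 + (f' t)\<^sup>2)"
  define Y where "Y = integral {0..T} (\<lambda>t. v t * f t)"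
  define Y' where "Y' = integral {0..T} (\<lambda>t. v t * f' t)"
  define c where "c = (1/\<tau>\<^sup>2 + q\<^sup>2) / margin"
  note e = margin_pos
  have i: "(\<lambda>t. v t * f t) integrable_on {0..T}" by (rule v_mult_cont_integrable[OF f_cont])
  have "A / k - integral {0..T} (\<lambda>t. v t * (z t - z (t - \<tau>))) \<le> Y"
    unfolding A_def Y_def by (rule sector_inequality[OF T0])
  then have "(A / k - integral {0..T} (\<lambda>t. v t * (z t - z (t - \<tau>)))) / \<tau> \<le> Y / \<tau>"
    using tau_pos by (intro divide_right_mono) auto
  then have 1: "A / (k * \<tau>) - integral {0..T} (\<lambda>t. v t * (z t - z (t - \<tau>))) / \<tau> \<le> Y / \<tau>"
    by (simp add: diff_divide_distrib)
  have "q * integral {0..T} (\<lambda>t. v t * v (t - \<tau>)) \<le> q * (Y' + k * (f 0)\<^sup>2)"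
    unfolding Y'_def using q by (intro mult_left_mono popov_inequality T0) auto
  moreover have "q * (Y' + k * (f 0)\<^sup>2) \<le> q * (Y' + k * (2 * X))"
    unfolding X_def using q k_pos by (intro mult_left_mono add_left_mono initial_value_bound T) auto
  ultimately have 2: "q * integral {0..T} (\<lambda>t. v t * v (t - \<tau>)) \<le> q * Y' + 2 * q * k * X"
    by (simp add: algebra_simps)
  have 3: "integral {0..T} (\<lambda>t. v t * (z t - z (t - \<tau>))) / \<tau> \<le> 2/pi * A + q * integral {0..T} (\<lambda>t. v t * v (t - \<tau>))"
    unfolding A_def q_def by (rule coercivity[OF T0])
  have "margin * A = A / (k * \<tau>) - 2/pi * A" by (simp add: margin_def algebra_simps)
  with 1 2 3 have 4: "margin * A \<le> Y / \<tau> + q * Y' + 2 * q * k * X" by linarith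
  have "Y / \<tau> + q * Y' = integral {0..T} (\<lambda>t. v t * f t / \<tau> + q * (v t * f' t))"
    unfolding Y_def Y'_def
    by (rule integral_unique[symmetric]) (intro has_integral_add has_integral_divide has_integral_mult_right integrable_integral i v_f'_integrable)
  also have "\<dots> \<le> integral {0..T} (\<lambda>t. margin / 2 * (v t)\<^sup>2 + c * ((f t)\<^sup>2 + (f' t)\<^sup>2))"
  proof (rule integral_le)
    show "(\<lambda>t. v t * f t / \<tau> + q * (v t * f' t)) integrable_on {0..T}"
      by (intro integrable_add integrable_on_divide integrable_on_mult_right i v_f'_integrable)
    show "(\<lambda>t. margin / 2 * (v t)\<^sup>2 + c * ((f t)\<^sup>2 + (f' t)\<^sup>2)) integrable_on {0..T}"
      by (intro integrable_add integrable_on_mult_right v_square_integrable f_square_integrable f'_square)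
    fix t
    have young: "x * y \<le> margin / 2 * x\<^sup>2 + y\<^sup>2 / (2 * margin)" for x y
    proof -
      have "0 \<le> (margin * x - y)\<^sup>2 / (2 * margin)" using e by simp
      also have "\<dots> = margin / 2 * x\<^sup>2 + y\<^sup>2 / (2 * margin) - x * y"
        using e by (simp add: power2_eq_square field_simps)
      finally show ?thesis by simp
    qed
    have "(f t / \<tau> + q * f' t)\<^sup>2 \<le> 2 * (f t / \<tau>)\<^sup>2 + 2 * (q * f' t)\<^sup>2"
      using zero_le_power2[of "f t / \<tau> - q * f' t"] by (simp add: power2_diff power2_sum)
    also have "\<dots> \<le> 2 * ((1/\<tau>\<^sup>2 + q\<^sup>2) * ((f t)\<^sup>2 + (f' t)\<^sup>2))"
    proof -
      have "(1/\<tau>\<^sup>2 + q\<^sup>2) * ((f t)\<^sup>2 + (f' t)\<^sup>2) = (f t / \<tau>)\<^sup>2 + (q * f' t)\<^sup>2 + ((f' t / \<tau>)\<^sup>2 + (q * f t)\<^sup>2)"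
        by (simp add: power_divide power_mult_distrib algebra_simps)
      moreover have "0 \<le> (f' t / \<tau>)\<^sup>2 + (q * f t)\<^sup>2" by simp
      ultimately show ?thesis by linarith
    qed
    finally have "(f t / \<tau> + q * f' t)\<^sup>2 / (2 * margin) \<le> 2 * ((1/\<tau>\<^sup>2 + q\<^sup>2) * ((f t)\<^sup>2 + (f' t)\<^sup>2)) / (2 * margin)"
      using e by (intro divide_right_mono) auto
    also have "\<dots> = c * ((f t)\<^sup>2 + (f' t)\<^sup>2)" using e by (simp add: c_def)
    finally show "v t * f t / \<tau> + q * (v t * f' t) \<le> margin / 2 * (v t)\<^sup>2 + c * ((f t)\<^sup>2 + (f' t)\<^sup>2)"
      using young[of "v t" "f t / \<tau> + q * f' t"] by (simp add: algebra_simps)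
  qed
  also have "\<dots> = margin / 2 * A + c * X"
    unfolding A_def X_def
    by (rule integral_unique) (intro has_integral_add has_integral_mult_right integrable_integral
        integrable_add v_square_integrable f_square_integrable f'_square)
  finally have "margin / 2 * A \<le> (c + 2 * q * k) * X" using 4 by (simp add: algebra_simps)
  then have "2 / margin * (margin / 2 * A) \<le> 2 / margin * ((c + 2 * q * k) * X)"
    using e by (intro mult_left_mono) auto
  moreover have "2 / margin * (margin / 2 * A) = A" using e by simp
  moreover have "2 / margin * ((c + 2 * q * k) * X) = energy_gain * X"
    by (simp add: energy_gain_def c_def q_def)
  ultimately show ?thesis unfolding A_def X_def by simp
qed
end

section \<open>Reflection at a barrier\<close>

text \<open>
  The Skorokhod reflection at \<open>-p\<close> of the path with velocity \<open>h\<close> started at \<open>0\<close>: the supremum is the least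
  nondecreasing correction that keeps the path above the barrier.
\<close>

definition reflected :: "real \<Rightarrow> (real \<Rightarrow> real) \<Rightarrow> real \<Rightarrow> real" where
  "reflected p h t = (if t \<le> 0 then 0 else integral {0..t} h + (SUP s\<in>{0..t}. max 0 (- p - integral {0..s} h)))"

text \<open>
  Causality: it makes the stages of the method of steps consistent.
\<close>

lemma reflected_cong:
  assumes "\<And>s. 0 \<le> s \<Longrightarrow> s \<le> t \<Longrightarrow> h s = g s"
  shows "reflected p h t = reflected p g t"
proof -
  have "integral {0..s} h = integral {0..s} g" if "s \<le> t" for s
    by (rule Henstock_Kurzweil_Integration.integral_cong) (use assms that in auto)
  then show ?thesis unfolding reflected_def by (auto intro!: SUP_cong)
qed

locale reflection =
  fixes h :: "real \<Rightarrow> real" and L p :: real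
  assumes h_cont: "continuous_on {0..} h" and h_bound: "\<And>t. 0 \<le> t \<Longrightarrow> \<bar>h t\<bar> \<le> L" and p_pos: "0 < p"
begin

definition H :: "real \<Rightarrow> real" where "H t = integral {0..t} h"
definition R :: "real \<Rightarrow> real" where "R t = (SUP s\<in>{0..t}. max 0 (- p - H s))"

lemma reflected_eq: "0 < t \<Longrightarrow> reflected p h t = H t + R t"
  by (simp add: reflected_def H_def R_def)

lemma L_nonneg: "0 \<le> L" using h_bound[of 0] by simp

lemma h_int: "0 \<le> s \<Longrightarrow> h integrable_on {s..t}"
  by (intro integrable_continuous_real continuous_on_subset[OF h_cont]) auto

lemma H_diff: "0 \<le> s \<Longrightarrow> s \<le> t \<Longrightarrow> H t - H s = integral {s..t} h"
  using Henstock_Kurzweil_Integration.integral_combine[of 0 s t h] h_int[of 0 t] by (simp add: H_def)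

lemma H_diff_le:
  assumes "0 \<le> s" "s \<le> t" "\<And>r. s \<le> r \<Longrightarrow> r \<le> t \<Longrightarrow> \<bar>h r\<bar> \<le> B"
  shows "\<bar>H t - H s\<bar> \<le> B * (t - s)"
proof -
  have "norm (integral {s..t} h) \<le> B * (t - s)"
    by (rule integral_bound) (use assms in \<open>auto intro: continuous_on_subset[OF h_cont]\<close>)
  then show ?thesis using H_diff[OF assms(1,2)] by simp
qed

lemma H_lip: "0 \<le> s \<Longrightarrow> s \<le> t \<Longrightarrow> \<bar>H t - H s\<bar> \<le> L * (t - s)"
  by (rule H_diff_le) (use h_bound in auto)

lemma H_0 [simp]: "H 0 = 0" by (simp add: H_def)

lemma H_der:
  assumes "0 < t" shows "(H has_real_derivative h t) (at t)"
proof -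
  have "((\<lambda>x. integral {0..x} h) has_real_derivative h t) (at t within {0..t + 1})"
    by (rule integral_has_real_derivative) (use assms in \<open>auto intro: continuous_on_subset[OF h_cont]\<close>)
  moreover have "at t within {0..t + 1} = at t" by (rule at_within_interior) (use assms in auto)
  ultimately show ?thesis by (simp add: H_def[abs_def])
qed

lemma R_bdd: "bdd_above ((\<lambda>s. max 0 (- p - H s)) ` {0..t})"
proof (rule bdd_aboveI2[where M = "L * \<bar>t\<bar>"])
  fix s assume s: "s \<in> {0..t}"
  then have "\<bar>H s\<bar> \<le> L * s" using H_lip[of 0 s] by simp
  moreover have "L * s \<le> L * \<bar>t\<bar>" using s L_nonneg by (intro mult_left_mono) auto
  ultimately show "max 0 (- p - H s) \<le> L * \<bar>t\<bar>" using p_pos L_nonneg by auto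
qed

lemma R_ge: "0 \<le> s \<Longrightarrow> s \<le> t \<Longrightarrow> max 0 (- p - H s) \<le> R t"
  unfolding R_def by (rule cSUP_upper[OF _ R_bdd]) simp

lemma R_least: "0 \<le> t \<Longrightarrow> (\<And>s. 0 \<le> s \<Longrightarrow> s \<le> t \<Longrightarrow> max 0 (- p - H s) \<le> B) \<Longrightarrow> R t \<le> B"
  unfolding R_def by (rule cSUP_least) auto

lemma R_0 [simp]: "R 0 = 0" using p_pos by (simp add: R_def)

lemma R_mono: "0 \<le> s \<Longrightarrow> s \<le> t \<Longrightarrow> R s \<le> R t"
  by (rule R_least) (auto simp del: max.bounded_iff intro: R_ge)

lemma R_extend:
  assumes "0 \<le> s" "s \<le> t" "R s \<le> B" "\<And>r. s \<le> r \<Longrightarrow> r \<le> t \<Longrightarrow> - p - H r \<le> B"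
  shows "R t \<le> B"
proof (rule R_least)
  fix r assume r: "0 \<le> r" "r \<le> t"
  show "max 0 (- p - H r) \<le> B"
  proof (cases "r \<le> s")
    case True then show ?thesis using R_ge[of r s] r assms(3) by linarith
  next
    case False
    moreover have "0 \<le> R s" using R_ge[of s s] assms(1) by linarith
    ultimately show ?thesis using assms(3) assms(4)[of r] r by auto
  qed
qed (use assms in simp)

lemma R_increment:
  assumes "0 \<le> s" "s \<le> t" "\<And>r. s \<le> r \<Longrightarrow> r \<le> t \<Longrightarrow> \<bar>h r\<bar> \<le> B" "0 \<le> B"
  shows "R t \<le> R s + B * (t - s)"
proof (rule R_extend[OF assms(1,2)])
  show "R s \<le> R s + B * (t - s)" using assms by simp
  fix r assume r: "s \<le> r" "r \<le> t"
  have "\<bar>H r - H s\<bar> \<le> B * (r - s)" by (rule H_diff_le) (use assms r in auto)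
  also have "\<dots> \<le> B * (t - s)" using r assms by (intro mult_left_mono) auto
  finally show "- p - H r \<le> R s + B * (t - s)" using R_ge[of s s] assms(1) by linarith
qed

lemma HR_lip:
  assumes "0 \<le> s" "s \<le> t" "\<And>r. s \<le> r \<Longrightarrow> r \<le> t \<Longrightarrow> \<bar>h r\<bar> \<le> B" "0 \<le> B"
  shows "\<bar>(H t + R t) - (H s + R s)\<bar> \<le> 2 * B * (t - s)"
  using H_diff_le[OF assms(1-3)] R_increment[OF assms] R_mono[OF assms(1,2)] by simp

lemma HR_ge: "0 \<le> t \<Longrightarrow> - p \<le> H t + R t"
  using R_ge[of t t] by linarith

lemma reflected_nonpos: "t \<le> 0 \<Longrightarrow> reflected p h t = 0" by (simp add: reflected_def)

lemma reflected_eq': "0 \<le> t \<Longrightarrow> reflected p h t = H t + R t"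
  using reflected_eq reflected_nonpos by (cases "t = 0") auto

lemma reflected_lip: "\<bar>reflected p h s - reflected p h t\<bar> \<le> 2 * L * \<bar>s - t\<bar>"
proof (induction s t rule: linorder_wlog)
  case (le s t)
  consider "t \<le> 0" | "s \<le> 0" "0 < t" | "0 < s" using le by linarith
  then show ?case
  proof cases
    case 1 then show ?thesis using le L_nonneg by (simp add: reflected_nonpos)
  next
    case 2
    have "\<bar>(H t + R t) - (H 0 + R 0)\<bar> \<le> 2 * L * (t - 0)"
      by (rule HR_lip) (use 2 h_bound L_nonneg in auto)
    also have "\<dots> \<le> 2 * L * (t - s)" using 2 L_nonneg by (intro mult_left_mono) auto
    finally show ?thesis using 2 by (simp add: reflected_nonpos reflected_eq)
  next
    case 3
    have "\<bar>(H t + R t) - (H s + R s)\<bar> \<le> 2 * L * (t - s)"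
      by (rule HR_lip) (use 3 le h_bound L_nonneg in auto)
    then show ?thesis using 3 le by (simp add: reflected_eq' abs_minus_commute)
  qed
next
  case (sym s t) then show ?case by (simp add: abs_minus_commute)
qed

text \<open>
  Away from the barrier the supremum is locally constant.
\<close>

lemma reflected_der_free:
  assumes t: "0 < t" and z: "reflected p h t > - p"
  shows "(reflected p h has_real_derivative h t) (at t)"
proof -
  define \<eta> where "\<eta> = H t + R t + p"
  have \<eta>: "0 < \<eta>" using z t by (simp add: reflected_eq \<eta>_def)
  define d where "d = min t (\<eta> / (2 * L + 1))"
  have d: "0 < d" "d \<le> t" using t \<eta> L_nonneg by (auto simp: d_def)
  have "d \<le> \<eta> / (2 * L + 1)" by (simp add: d_def)
  then have "d * (2 * L + 1) \<le> \<eta>" using L_nonneg by (simp add: pos_le_divide_eq)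
  then have Ld: "2 * L * d \<le> \<eta>" using d by (simp add: algebra_simps)
  have Rc: "R s = R t" if s: "s \<in> {t - d<..<t + d}" for s
  proof (cases "s \<le> t")
    case True
    have Ls: "L * (t - s) \<le> L * d" using s L_nonneg by (intro mult_left_mono) auto
    have Rt: "R t \<le> R s + L * d"
      using R_increment[of s t L] True s d h_bound L_nonneg Ls by force
    have "R t \<le> R s"
    proof (rule R_extend)
      fix r assume r: "s \<le> r" "r \<le> t"
      have "\<bar>H t - H r\<bar> \<le> L * (t - r)" by (rule H_lip) (use r s d in auto)
      also have "\<dots> \<le> L * d" using r s L_nonneg by (intro mult_left_mono) auto
      finally show "- p - H r \<le> R s" using Rt Ld unfolding \<eta>_def by linarith
    qed (use s d True in auto)
    moreover have "R s \<le> R t" by (rule R_mono) (use s d True in auto)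
    ultimately show ?thesis by simp
  next
    case False
    have "R s \<le> R t"
    proof (rule R_extend)
      fix r assume r: "t \<le> r" "r \<le> s"
      have "\<bar>H r - H t\<bar> \<le> L * (r - t)" by (rule H_lip) (use r t in auto)
      also have "\<dots> \<le> L * d" using r s L_nonneg by (intro mult_left_mono) auto
      moreover have "0 \<le> L * d" using L_nonneg d by simp
      ultimately show "- p - H r \<le> R t" using Ld unfolding \<eta>_def by linarith
    qed (use t False in auto)
    moreover have "R t \<le> R s" by (rule R_mono) (use t False in auto)
    ultimately show ?thesis by simp
  qed
  have "((\<lambda>s. H s + R t) has_real_derivative h t) (at t)"
    using DERIV_add[OF H_der[OF t] DERIV_const[of "R t"]] by simp
  then show ?thesis
  proof (rule has_field_derivative_transform_within_open[where S = "{t - d<..<t + d}"])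
    fix s assume s: "s \<in> {t - d<..<t + d}"
    then show "H s + R t = reflected p h s" using Rc[OF s] d by (simp add: reflected_eq)
  qed (use d in auto)
qed

lemma h_near:
  assumes "0 < t" "0 < e"
  obtains d where "0 < d" "d \<le> t" "\<And>s. \<bar>s - t\<bar> < d \<Longrightarrow> \<bar>h s - h t\<bar> < e"
proof -
  obtain d where d: "0 < d" "\<And>s. s \<in> {0..} \<Longrightarrow> dist s t < d \<Longrightarrow> dist (h s) (h t) < e"
    using h_cont assms unfolding continuous_on_iff by (metis atLeast_iff less_imp_le)
  show ?thesis
    by (rule that[of "min d t"]) (use d assms in \<open>auto simp: dist_real_def\<close>)
qed

text \<open>
  A positive velocity at the barrier would mean that the path was below the barrier shortly before.
\<close>

lemma at_barrier_h_le:
  assumes t: "0 < t" and z: "reflected p h t \<le> - p"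
  shows "h t \<le> 0"
proof (rule ccontr)
  assume "\<not> h t \<le> 0"
  then obtain d where d: "0 < d" "\<And>s. 0 < s \<Longrightarrow> s < d \<Longrightarrow> H (t - s) < H t"
    using DERIV_pos_inc_left[OF H_der[OF t]] by force
  define s where "s = min (d/2) (t/2)"
  have s: "0 < s" "s < d" "s < t" using d t by (auto simp: s_def)
  have "H (t - s) < H t" using d(2) s by blast
  moreover have "R (t - s) \<le> R t" using s by (intro R_mono) auto
  moreover have "- p \<le> H (t - s) + R (t - s)" using s by (intro HR_ge) auto
  ultimately show False using z t by (simp add: reflected_eq)
qed

text \<open>
  Near a zero of \<open>h\<close> both the free path and the correction have arbitrarily small Lipschitz constants.
\<close>

lemma reflected_der_stationary:
  assumes t: "0 < t" and h0: "h t = 0"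
  shows "(reflected p h has_real_derivative 0) (at t)"
  unfolding has_field_derivative_def has_derivative_within_alt
proof (intro conjI allI impI)
  show "bounded_linear ((*) (0::real))" by (rule bounded_linear_mult_right)
  fix e :: real assume "0 < e"
  then obtain d where d: "0 < d" "d \<le> t" "\<And>s. \<bar>s - t\<bar> < d \<Longrightarrow> \<bar>h s - h t\<bar> < e/2"
    using h_near[OF t, of "e/2"] by (metis half_gt_zero)
  show "\<exists>d>0. \<forall>y\<in>UNIV. norm (y - t) < d \<longrightarrow>
      norm (reflected p h y - reflected p h t - 0 * (y - t)) \<le> e * norm (y - t)"
  proof (intro exI[of _ d] conjI ballI impI d(1))
    fix y assume y: "norm (y - t) < d"
    then have y0: "0 < y" using d by auto
    show "norm (reflected p h y - reflected p h t - 0 * (y - t)) \<le> e * norm (y - t)"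
    proof (cases "y \<le> t")
      case True
      have "\<bar>(H t + R t) - (H y + R y)\<bar> \<le> 2 * (e/2) * (t - y)"
        by (rule HR_lip) (use True y y0 d h0 \<open>0 < e\<close> in \<open>auto intro!: less_imp_le d(3)[unfolded h0 diff_0_right]\<close>)
      then show ?thesis using True y0 t by (simp add: reflected_eq abs_minus_commute)
    next
      case False
      have "\<bar>(H y + R y) - (H t + R t)\<bar> \<le> 2 * (e/2) * (y - t)"
        by (rule HR_lip) (use False y t d h0 \<open>0 < e\<close> in \<open>auto intro!: less_imp_le d(3)[unfolded h0 diff_0_right]\<close>)
      then show ?thesis using False y0 t by (simp add: reflected_eq)
    qed
  qed
qed

text \<open>
  While \<open>h < 0\<close>, the correction increases exactly as fast as the free path decreases.
\<close>

lemma reflected_stays_at_barrier: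
  assumes t: "0 < t" and z: "reflected p h t \<le> - p" and neg: "h t < 0"
  obtains d where "0 < d" "\<And>s. t \<le> s \<Longrightarrow> s < t + d \<Longrightarrow> reflected p h s = - p"
proof -
  obtain d where d: "0 < d" "\<And>s. \<bar>s - t\<bar> < d \<Longrightarrow> \<bar>h s - h t\<bar> < - h t"
    using h_near[OF t, of "- h t"] neg by auto
  show ?thesis
  proof (rule that[OF d(1)])
    fix s assume s: "t \<le> s" "s < t + d"
    have dec: "H s \<le> H r" if "t \<le> r" "r \<le> s" for r
    proof (rule DERIV_nonpos_imp_nonincreasing[OF that(2)])
      fix x assume x: "r \<le> x" "x \<le> s"
      then have "\<bar>h x - h t\<bar> < - h t" using that s by (intro d(2)) auto
      then show "\<exists>y. (H has_real_derivative y) (at x) \<and> y \<le> 0"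
        using x that t by (intro exI[of _ "h x"] conjI H_der) auto
    qed
    have "R s \<le> - p - H s"
    proof (rule R_extend[of t])
      show "R t \<le> - p - H s" using z t dec[of t] s by (simp add: reflected_eq)
      show "- p - H r \<le> - p - H s" if "t \<le> r" "r \<le> s" for r using dec[OF that] by simp
    qed (use t s in auto)
    then show "reflected p h s = - p" using HR_ge[of s] s t by (simp add: reflected_eq)
  qed
qed

text \<open>
  The only positive times at which the reflected path can fail to be differentiable: it reaches the barrier with negative
  velocity and has not been resting there.
\<close>

definition arrivals :: "real set" where
  "arrivals = {t. 0 < t \<and> reflected p h t \<le> - p \<and> h t < 0 \<and>
     \<not> (\<exists>d>0. \<forall>s. t - d < s \<longrightarrow> s \<le> t \<longrightarrow> reflected p h s = - p)}"

text \<open>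
  After each arrival the path rests for a while, so the arrivals are separated by disjoint open intervals.
\<close>

lemma countable_arrivals: "countable arrivals"
proof -
  have "\<exists>d>0. \<forall>s. t \<le> s \<longrightarrow> s < t + d \<longrightarrow> reflected p h s = - p" if "t \<in> arrivals" for t
    using reflected_stays_at_barrier[of t] that unfolding arrivals_def by (metis (mono_tags, lifting) mem_Collect_eq)
  then obtain d where d: "\<And>t. t \<in> arrivals \<Longrightarrow> 0 < d t"
    "\<And>t s. t \<in> arrivals \<Longrightarrow> t \<le> s \<Longrightarrow> s < t + d t \<Longrightarrow> reflected p h s = - p" by metis
  define I where "I t = {t<..<t + d t}" for t
  have sep: "t + d t \<le> t'" if "t \<in> arrivals" "t' \<in> arrivals" "t < t'" for t t'
  proof (rule ccontr)
    assume "\<not> t + d t \<le> t'"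
    then have "\<forall>s. t' - (t' - t) < s \<longrightarrow> s \<le> t' \<longrightarrow> reflected p h s = - p"
      using d(2)[OF that(1)] by auto
    then have "\<exists>e>0. \<forall>s. t' - e < s \<longrightarrow> s \<le> t' \<longrightarrow> reflected p h s = - p"
      using that(3) by (intro exI[of _ "t' - t"]) simp
    then show False using that(2) unfolding arrivals_def by blast
  qed
  have disj: "I t \<inter> I t' = {}" if "t \<in> arrivals" "t' \<in> arrivals" "t \<noteq> t'" for t t'
    using sep[of t t'] sep[of t' t] that by (cases "t < t'") (auto simp: I_def)
  have "countable (I ` arrivals)"
    by (rule countable_disjoint_open_subsets) (use disj in \<open>auto simp: I_def pairwise_def disjnt_def\<close>)
  moreover have "inj_on I arrivals"
  proof (rule inj_onI, rule ccontr)
    fix t t' assume t: "t \<in> arrivals" "t' \<in> arrivals" "I t = I t'" "t \<noteq> t'"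
    then have "I t = {}" using disj[of t t'] by auto
    then show False using d(1)[OF t(1)] by (simp add: I_def)
  qed
  ultimately show ?thesis by (rule countable_image_inj_on)
qed

lemma reflected_der:
  assumes t: "0 < t" and "t \<notin> arrivals"
  shows "(reflected p h has_real_derivative (if reflected p h t > - p then h t else max 0 (h t))) (at t)"
proof (cases "reflected p h t > - p")
  case True
  then show ?thesis using reflected_der_free[OF t] by simp
next
  case False
  then have z: "reflected p h t \<le> - p" by simp
  have "(reflected p h has_real_derivative 0) (at t)"
  proof (cases "h t = 0")
    case True then show ?thesis by (rule reflected_der_stationary[OF t])
  next
    case False
    then have neg: "h t < 0" using at_barrier_h_le[OF t z] by simp
    obtain d1 where d1: "0 < d1" "\<And>s. t - d1 < s \<Longrightarrow> s \<le> t \<Longrightarrow> reflected p h s = - p"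
      using assms(2) t z neg unfolding arrivals_def by blast
    obtain d2 where d2: "0 < d2" "\<And>s. t \<le> s \<Longrightarrow> s < t + d2 \<Longrightarrow> reflected p h s = - p"
      using reflected_stays_at_barrier[OF t z neg] by blast
    have "((\<lambda>s. - p) has_real_derivative 0) (at t)" by simp
    then show ?thesis
    proof (rule has_field_derivative_transform_within_open[where S = "{t - d1<..<t + d2}"])
      show "- p = reflected p h s" if "s \<in> {t - d1<..<t + d2}" for s
        using d1(2)[of s] d2(2)[of s] that by (cases "s \<le> t") auto
    qed (use d1 d2 in auto)
  qed
  then show ?thesis using False at_barrier_h_le[OF t z] by (simp add: max_def)
qed

end

lemma reflected_solution:
  fixes h :: "real \<Rightarrow> real"
  assumes "continuous_on {0..} h" "\<And>t. 0 \<le> t \<Longrightarrow> \<bar>h t\<bar> \<le> L" "0 < p"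
  shows "\<bar>reflected p h s - reflected p h t\<bar> \<le> 2 * L * \<bar>s - t\<bar>"
    and "\<exists>E. countable E \<and> (\<forall>t>0. t \<notin> E \<longrightarrow>
      (reflected p h has_real_derivative (if reflected p h t > - p then h t else max 0 (h t))) (at t))"
proof -
  interpret reflection h L p using assms by unfold_locales
  show "\<bar>reflected p h s - reflected p h t\<bar> \<le> 2 * L * \<bar>s - t\<bar>" by (rule reflected_lip)
  show "\<exists>E. countable E \<and> (\<forall>t>0. t \<notin> E \<longrightarrow>
      (reflected p h has_real_derivative (if reflected p h t > - p then h t else max 0 (h t))) (at t))"
    using countable_arrivals reflected_der by (intro exI[of _ arrivals]) blast
qed

section \<open>Solutions by the method of steps\<close>

context delayed_feedback begin

text \<open>
  The input of stage \<open>m + 1\<close> on \<open>[0, (m + 1) \<tau>]\<close> refers to stage \<open>m\<close> on \<open>[-\<tau>, m \<tau>]\<close> only, where that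
  stage is already final.
\<close>

primrec steps :: "(real \<Rightarrow> real) \<Rightarrow> nat \<Rightarrow> real \<Rightarrow> real" where
  "steps f 0 = (\<lambda>_. 0)"
| "steps f (Suc m) = reflected p (\<lambda>t. \<phi> (f t - steps f m (t - \<tau>)))"

lemma steps_nonpos: "t \<le> 0 \<Longrightarrow> steps f m t = 0"
  by (cases m) (auto simp: reflected_def)

lemma steps_input_cont:
  assumes f: "continuous_on {0..} f" and lip: "\<And>s t. \<bar>steps f m s - steps f m t\<bar> \<le> 2 * L * \<bar>s - t\<bar>"
  shows "continuous_on {0..} (\<lambda>t. \<phi> (f t - steps f m (t - \<tau>)))"
proof -
  have "continuous_on UNIV (steps f m)"
    using lipschitz_on_continuous_on[of "2 * L" UNIV "steps f m"] lip L_nonneg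
    by (auto simp: lipschitz_on_def dist_real_def)
  then have "continuous_on {0..} (\<lambda>t. steps f m (t - \<tau>))"
    by (rule continuous_on_compose2) (auto intro!: continuous_intros)
  then have "continuous_on {0..} (\<lambda>t. f t - steps f m (t - \<tau>))"
    by (intro continuous_on_diff f)
  then show ?thesis by (rule continuous_on_compose2[OF phi_cont]) auto
qed

lemma steps_lip:
  assumes f: "continuous_on {0..} f"
  shows "\<bar>steps f m s - steps f m t\<bar> \<le> 2 * L * \<bar>s - t\<bar>"
proof (induction m arbitrary: s t)
  case 0 then show ?case using L_nonneg by simp
next
  case (Suc m)
  show ?case unfolding steps.simps
    by (rule reflected_solution(1)[OF steps_input_cont[OF f Suc.IH] phi_bounded p_pos])
qed

lemma steps_stable_Suc: "t \<le> real m * \<tau> \<Longrightarrow> steps f (Suc m) t = steps f m t"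
proof (induction m arbitrary: t)
  case 0 then show ?case by (simp add: steps_nonpos reflected_def)
next
  case (Suc m)
  have "reflected p (\<lambda>t. \<phi> (f t - steps f (Suc m) (t - \<tau>))) t = reflected p (\<lambda>t. \<phi> (f t - steps f m (t - \<tau>))) t"
  proof (rule reflected_cong)
    fix s assume "0 \<le> s" "s \<le> t"
    then have "s - \<tau> \<le> real m * \<tau>" using Suc.prems by (simp add: algebra_simps)
    then show "\<phi> (f s - steps f (Suc m) (s - \<tau>)) = \<phi> (f s - steps f m (s - \<tau>))" by (simp only: Suc.IH)
  qed
  then show ?case by (simp only: steps.simps(2)[of f "Suc m", THEN fun_cong] steps.simps(2)[of f m, THEN fun_cong])
qed

lemma steps_stable:
  assumes "t \<le> real m * \<tau>" "m \<le> n" shows "steps f n t = steps f m t"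
  using assms(2)
proof (induction n rule: dec_induct)
  case (step n)
  have "real m * \<tau> \<le> real n * \<tau>" using step tau_pos by (intro mult_right_mono) auto
  then have "t \<le> real n * \<tau>" using assms(1) by linarith
  then show ?case using step.IH by (simp only: steps_stable_Suc)
qed simp

definition solution :: "(real \<Rightarrow> real) \<Rightarrow> real \<Rightarrow> real" where
  "solution f t = steps f (nat \<lceil>t / \<tau>\<rceil>) t"

lemma solution_eq:
  assumes "t \<le> real n * \<tau>" shows "solution f t = steps f n t"
proof -
  have "t / \<tau> \<le> real n" using assms tau_pos by (simp add: pos_divide_le_eq)
  then have "nat \<lceil>t / \<tau>\<rceil> \<le> n" by linarith
  moreover have "t \<le> real (nat \<lceil>t / \<tau>\<rceil>) * \<tau>"
  proof -
    have "t / \<tau> \<le> real (nat \<lceil>t / \<tau>\<rceil>)" by (rule real_nat_ceiling_ge)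
    then show ?thesis using tau_pos by (simp add: pos_divide_le_eq)
  qed
  ultimately show ?thesis unfolding solution_def using steps_stable by metis
qed

lemma solution_nonpos: "t \<le> 0 \<Longrightarrow> solution f t = 0"
  using solution_eq[of t 0 f] by simp

lemma solution_lip:
  assumes f: "continuous_on {0..} f"
  shows "\<bar>solution f s - solution f t\<bar> \<le> 2 * L * \<bar>s - t\<bar>"
proof -
  obtain n where "max s t < real n * \<tau>" using reals_Archimedean3[OF tau_pos] by blast
  then show ?thesis using solution_eq[of s n f] solution_eq[of t n f] steps_lip[OF f, of n s t] by simp
qed

lemma solution_der:
  assumes f: "continuous_on {0..} f"
  obtains E where "countable E" "\<And>t. 0 < t \<Longrightarrow> t \<notin> E \<Longrightarrow>
    (solution f has_real_derivative rate (solution f t) (f t - solution f (t - \<tau>))) (at t)"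
proof -
  have "\<exists>E. countable E \<and> (\<forall>t>0. t \<notin> E \<longrightarrow>
      (steps f (Suc m) has_real_derivative rate (steps f (Suc m) t) (f t - steps f m (t - \<tau>))) (at t))" for m
    using reflected_solution(2)[OF steps_input_cont[OF f steps_lip[OF f]] phi_bounded p_pos, of m]
    by (simp only: steps.simps rate_def)
  then obtain E where E: "\<And>m. countable (E m)" "\<And>m t. 0 < t \<Longrightarrow> t \<notin> E m \<Longrightarrow>
      (steps f (Suc m) has_real_derivative rate (steps f (Suc m) t) (f t - steps f m (t - \<tau>))) (at t)" by metis
  show ?thesis
  proof (rule that[of "\<Union>m. E m"])
    show "countable (\<Union>m. E m)" using E(1) by simp
    fix t assume t: "0 < t" "t \<notin> (\<Union>m. E m)"
    obtain n where n: "t < real n * \<tau>" using reals_Archimedean3[OF tau_pos] by blast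
    with t(1) obtain m where m: "n = Suc m" by (cases n) auto
    have "(steps f (Suc m) has_real_derivative rate (steps f (Suc m) t) (f t - steps f m (t - \<tau>))) (at t)"
      by (rule E(2)) (use t in auto)
    moreover have "steps f (Suc m) t = solution f t" using solution_eq[of t n f] n m by simp
    moreover have "steps f m (t - \<tau>) = solution f (t - \<tau>)"
      using solution_eq[of "t - \<tau>" m f] n m by (simp add: algebra_simps)
    ultimately have "(steps f (Suc m) has_real_derivative rate (solution f t) (f t - solution f (t - \<tau>))) (at t)" by simp
    then show "(solution f has_real_derivative rate (solution f t) (f t - solution f (t - \<tau>))) (at t)"
    proof (rule has_field_derivative_transform_within_open[where S = "{..<real n * \<tau>}"])
      show "steps f (Suc m) s = solution f s" if "s \<in> {..<real n * \<tau>}" for s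
        using solution_eq[of s n f] that m by simp
    qed (use n in auto)
  qed
qed
end

section \<open>Signals with square integrable derivative\<close>

lemma AE_halfline_iff:
  fixes P :: "real \<Rightarrow> bool"
  shows
  "(AE t in lebesgue_on {0..}. P t) \<longleftrightarrow> (\<exists>N. negligible N \<and> (\<forall>t\<ge>0. t \<notin> N \<longrightarrow> P t))"
proof -
  have "(AE t in lebesgue_on {0..}. P t) \<longleftrightarrow> (AE t in lebesgue. t \<in> {0..} \<longrightarrow> P t)"
    by (rule AE_restrict_space_iff) simp
  also have "\<dots> \<longleftrightarrow> (\<exists>N. negligible N \<and> (\<forall>t\<ge>0. t \<notin> N \<longrightarrow> P (t::real)))"
    unfolding eventually_ae_filter negligible_iff_null_sets by (simp add: subset_eq) blast
  finally show ?thesis .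
qed

lemma countable_imp_negligible: "countable (E :: real set) \<Longrightarrow> negligible E"
  by (simp add: negligible_iff_null_sets countable_imp_null_set_lborel null_sets_completionI)

lemma measurable_on_halfline:
  fixes g :: "real \<Rightarrow> real"
  assumes "\<And>T. 0 < T \<Longrightarrow> g \<in> borel_measurable (lebesgue_on {0..T})"
  shows "g \<in> borel_measurable (lebesgue_on {0..})"
proof -
  have m: "(\<lambda>t. if t \<in> {0..real (Suc n)} then g t else 0) \<in> borel_measurable lebesgue" for n
    by (subst borel_measurable_if) (auto intro: assms)
  have "(\<lambda>t. if t \<in> {0..} then g t else 0) \<in> borel_measurable lebesgue"
  proof (rule borel_measurable_LIMSEQ_real[OF _ m])
    fix t :: real
    obtain n0 where n0: "t \<le> real n0" using real_arch_simple by blast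
    have "\<forall>\<^sub>F n in sequentially. (if t \<in> {0..real (Suc n)} then g t else 0) = (if t \<in> {0..} then g t else 0)"
      unfolding eventually_sequentially by (rule exI[of _ n0]) (use n0 in \<open>auto simp: not_le\<close>)
    then show "(\<lambda>n. if t \<in> {0..real (Suc n)} then g t else 0) \<longlonglongrightarrow> (if t \<in> {0..} then g t else 0)"
      by (rule tendsto_eventually)
  qed
  then show ?thesis by (subst (asm) borel_measurable_if) auto
qed

text \<open>
  The bound is demanded for \<open>T \<ge> 1\<close> because the initial value of the input is controlled by its norm over a unit
  interval.
\<close>

lemma integrable_halfline_from_bound:
  fixes g :: "real \<Rightarrow> real"
  assumes g: "\<And>T. g integrable_on {0..T}" and nn: "\<And>t. 0 \<le> g t"
    and B: "\<And>T. 1 \<le> T \<Longrightarrow> integral {0..T} g \<le> B"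
  shows "g integrable_on {0..}" "integral {0..} g \<le> B"
proof -
  let ?f = "\<lambda>n t. if t \<in> {0..real (Suc n)} then g t else 0"
  have hf: "(?f n has_integral integral {0..real (Suc n)} g) {0..}" for n
    by (subst has_integral_restrict) (auto intro: integrable_integral[OF g])
  have i: "integral {0..} (?f n) = integral {0..real (Suc n)} g" for n
    by (rule integral_unique[OF hf])
  have le: "integral {0..} (?f n) \<le> B" for n unfolding i by (rule B) simp
  have conv: "g integrable_on {0..} \<and> (\<lambda>n. integral {0..} (?f n)) \<longlonglongrightarrow> integral {0..} g"
  proof (rule monotone_convergence_increasing)
    show "?f n integrable_on {0..}" for n by (rule has_integral_integrable[OF hf])
    show "?f n t \<le> ?f (Suc n) t" for n t using nn[of t] by auto
    fix t :: real assume t: "t \<in> {0..}"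
    obtain n0 where n0: "t \<le> real n0" using real_arch_simple by blast
    have "\<forall>\<^sub>F n in sequentially. ?f n t = g t"
      unfolding eventually_sequentially by (rule exI[of _ n0]) (use n0 t in auto)
    then show "(\<lambda>n. ?f n t) \<longlonglongrightarrow> g t" by (rule tendsto_eventually)
  next
    have "0 \<le> integral {0..} (?f n)" for n unfolding i by (rule integral_nonneg[OF g]) (rule nn)
    then show "bounded (range (\<lambda>n. integral {0..} (?f n)))"
      unfolding bounded_iff using le by (intro exI[of _ B]) auto
  qed
  then show "g integrable_on {0..}" by simp
  show "integral {0..} g \<le> B" using conv by (intro LIMSEQ_le_const2[of _ "integral {0..} g"]) (use le in auto)
qed

lemma L2_square_integral:
  assumes "g \<in> L2"
  shows "((\<lambda>t. (g t)\<^sup>2) has_integral (LINT t|lebesgue_on {0..}. (g t)\<^sup>2)) {0..}"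
  using assms has_integral_integral_lebesgue_on[of "{0..}" "\<lambda>t. (g t)\<^sup>2"]
  by (simp add: L2_def square_integrable_on_def)

lemma L2_measurable: "g \<in> L2 \<Longrightarrow> g \<in> borel_measurable (lebesgue_on {0..T})"
  by (rule measurable_restrict_mono[of _ _ "{0..}"]) (auto simp: L2_def square_integrable_on_def)

lemma L2_square_integrable: "g \<in> L2 \<Longrightarrow> (\<lambda>t. (g t)\<^sup>2) integrable_on {0..T}"
  by (rule integrable_on_subinterval[OF has_integral_integrable[OF L2_square_integral]]) auto

lemma L2_square_integral_le:
  assumes "g \<in> L2" shows "integral {0..T} (\<lambda>t. (g t)\<^sup>2) \<le> (LINT t|lebesgue_on {0..}. (g t)\<^sup>2)"
proof -
  have "integral {0..T} (\<lambda>t. (g t)\<^sup>2) \<le> integral {0..} (\<lambda>t. (g t)\<^sup>2)"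
    by (rule integral_subset_le) (use L2_square_integrable[OF assms] L2_square_integral[OF assms] in auto)
  then show ?thesis using integral_unique[OF L2_square_integral[OF assms]] by simp
qed

lemma L2e_iff:
  "g \<in> L2e \<longleftrightarrow> signal g \<and> (\<forall>T>0. g \<in> borel_measurable (lebesgue_on {0..T}) \<and> (\<lambda>t. (g t)\<^sup>2) integrable_on {0..T})"
proof -
  have "integrable (lebesgue_on {0..T}) (\<lambda>t. (g t)\<^sup>2) \<longleftrightarrow> (\<lambda>t. (g t)\<^sup>2) integrable_on {0..T}" for T
  proof
    show "(\<lambda>t. (g t)\<^sup>2) integrable_on {0..T}" if "integrable (lebesgue_on {0..T}) (\<lambda>t. (g t)\<^sup>2)"
      using has_integral_integral_lebesgue_on[OF that] by (auto simp: has_integral_integrable)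
    show "integrable (lebesgue_on {0..T}) (\<lambda>t. (g t)\<^sup>2)" if "(\<lambda>t. (g t)\<^sup>2) integrable_on {0..T}"
      by (rule absolutely_integrable_imp_integrable[OF nonnegative_absolutely_integrable_1[OF that]]) auto
  qed
  then show ?thesis by (simp add: L2e_def square_integrable_on_def)
qed

lemma L2_from_L2e:
  assumes g: "g \<in> L2e" and B: "\<And>T. 1 \<le> T \<Longrightarrow> integral {0..T} (\<lambda>t. (g t)\<^sup>2) \<le> B"
  shows "g \<in> L2" "(LINT t|lebesgue_on {0..}. (g t)\<^sup>2) \<le> B"
proof -
  have i: "(\<lambda>t. (g t)\<^sup>2) integrable_on {0..T}" for T
  proof (cases "0 < T")
    case True then show ?thesis using g by (simp add: L2e_iff)
  next
    case False
    then have "{0..T} \<subseteq> {0}" by auto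
    then show ?thesis by (intro integrable_spike[OF integrable_0 negligible_sing[of 0]]) auto
  qed
  note H = integrable_halfline_from_bound[OF i zero_le_power2 B]
  have "integrable (lebesgue_on {0..}) (\<lambda>t. (g t)\<^sup>2)"
    by (rule absolutely_integrable_imp_integrable[OF nonnegative_absolutely_integrable_1[OF H(1)]]) auto
  moreover have "g \<in> borel_measurable (lebesgue_on {0..})"
    by (rule measurable_on_halfline) (use g in \<open>simp add: L2e_iff\<close>)
  ultimately show L2: "g \<in> L2" using g by (simp add: L2_def L2e_def square_integrable_on_def)
  show "(LINT t|lebesgue_on {0..}. (g t)\<^sup>2) \<le> B"
    using H(2) integral_unique[OF L2_square_integral[OF L2]] by simp
qed

lemma L2e_cong_negligible:
  assumes g: "\<And>T. 0 < T \<Longrightarrow> g absolutely_integrable_on {0..T}"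
    and sq: "\<And>T. 0 < T \<Longrightarrow> (\<lambda>t. (g t)\<^sup>2) integrable_on {0..T}"
    and N: "negligible N" and eq: "\<And>t. 0 \<le> t \<Longrightarrow> t \<notin> N \<Longrightarrow> u t = g t" and u: "signal u"
  shows "u \<in> L2e"
  unfolding L2e_iff
proof (intro conjI allI impI u)
  fix T :: real assume T: "0 < T"
  have "u absolutely_integrable_on {0..T}" by (rule absolutely_integrable_spike[OF g[OF T] N]) (use eq in auto)
  then show "u \<in> borel_measurable (lebesgue_on {0..T})"
    by (intro integrable_imp_measurable set_lebesgue_integral_eq_integral(1))
  show "(\<lambda>t. (u t)\<^sup>2) integrable_on {0..T}" by (rule integrable_spike[OF sq[OF T] N]) (use eq in auto)
qed

lemma W2_trajectory_input:
  assumes f: "f \<in> W2"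
  shows "abs_continuous_on {0..T} f" "deriv f \<in> borel_measurable (lebesgue_on {0..T})"
    "(\<lambda>t. (deriv f t)\<^sup>2) integrable_on {0..T}"
    "\<exists>N. negligible N \<and> (\<forall>t\<ge>0. t \<notin> N \<longrightarrow> (f has_real_derivative deriv f t) (at t))"
proof -
  have "abs_continuous_on {0..max 1 T} f" using f by (simp add: W2_def loc_abs_continuous_def)
  then show "abs_continuous_on {0..T} f" by (rule abs_continuous_on_subset) auto
  have d: "deriv f \<in> L2" using f by (simp add: W2_def)
  show "deriv f \<in> borel_measurable (lebesgue_on {0..T})" by (rule L2_measurable[OF d])
  show "(\<lambda>t. (deriv f t)\<^sup>2) integrable_on {0..T}" by (rule L2_square_integrable[OF d])
  have "AE t in lebesgue_on {0..}. f differentiable (at t)" using f by (simp add: W2_def)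
  then show "\<exists>N. negligible N \<and> (\<forall>t\<ge>0. t \<notin> N \<longrightarrow> (f has_real_derivative deriv f t) (at t))"
    unfolding AE_halfline_iff DERIV_deriv_iff_real_differentiable .
qed

lemma W2_norm_square:
  "(W2_norm f)\<^sup>2 = (LINT t|lebesgue_on {0..}. (f t)\<^sup>2) + (LINT t|lebesgue_on {0..}. (deriv f t)\<^sup>2)"
  unfolding W2_norm_def by (rule real_sqrt_pow2) simp

lemma L2_norm_square: "(L2_norm f)\<^sup>2 = (LINT t|lebesgue_on {0..}. (f t)\<^sup>2)"
  unfolding L2_norm_def by (rule real_sqrt_pow2) simp

text \<open>
  As the rate is bounded, this makes every state of \<open>\<Delta>\<close> Lipschitz, although only its absolute continuity is
  postulated.
\<close>

lemma Lipschitz_from_derivative: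
  fixes z u :: "real \<Rightarrow> real"
  assumes N: "negligible N" and ac: "\<And>T. abs_continuous_on {0..T} z" and z0: "\<And>t. t \<le> 0 \<Longrightarrow> z t = 0"
    and der: "\<And>t. 0 \<le> t \<Longrightarrow> t \<notin> N \<Longrightarrow> (z has_real_derivative u t) (at t)"
    and bnd: "\<And>t. 0 \<le> t \<Longrightarrow> \<bar>u t\<bar> \<le> B"
  shows "\<bar>z s - z t\<bar> \<le> B * \<bar>s - t\<bar>"
proof (induction s t rule: linorder_wlog)
  case (le s t)
  have B: "0 \<le> B" using bnd[of 0] by simp
  have pos: "\<bar>z s - z t\<bar> \<le> B * (t - s)" if "0 \<le> s" "s \<le> t" for s t
  proof -
    have "(u has_integral z t - z s) {s..t}"
    proof (rule abs_continuous_FTC[OF that(2) abs_continuous_on_subset[OF ac[of t]] N])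
      fix x assume "x \<in> {s..t} - N"
      show "(z has_real_derivative u x) (at x within {s..t})"
        by (rule has_field_derivative_at_within[OF der]) (use that \<open>x \<in> {s..t} - N\<close> in auto)
    qed (use that in auto)
    then have "norm (z t - z s) \<le> B * measure lborel {s..t}"
      by (rule has_integral_bound_real[OF B finite.emptyI]) (use bnd that in auto)
    then show ?thesis using that by (simp add: abs_minus_commute)
  qed
  show ?case
  proof (cases "0 \<le> s")
    case True then show ?thesis using pos[of s t] le by simp
  next
    case False
    have "\<bar>z 0 - z (max 0 t)\<bar> \<le> B * (max 0 t - 0)" by (rule pos) auto
    also have "\<dots> \<le> B * (t - s)" using B False le by (intro mult_left_mono) auto
    finally have "\<bar>z 0 - z (max 0 t)\<bar> \<le> B * (t - s)" .
    moreover have "z t = z (max 0 t)" using z0[of t] z0[of 0] by (cases "t \<le> 0") (simp_all add: max_def)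
    moreover have "z s = z 0" using False z0[of s] z0[of 0] by simp
    ultimately show ?thesis using le by (simp add: abs_minus_commute)
  qed
next
  case (sym s t) then show ?case by (simp add: abs_minus_commute)
qed

lemma G_of_derivative:
  fixes z u :: "real \<Rightarrow> real"
  assumes tau: "0 < \<tau>" and N: "negligible N" and lip: "\<And>s t. \<bar>z s - z t\<bar> \<le> B * \<bar>s - t\<bar>"
    and der: "\<And>t. t \<notin> N \<Longrightarrow> (z has_real_derivative u t) (at t)"
    and bnd: "\<And>t. t \<notin> N \<Longrightarrow> \<bar>u t\<bar> \<le> B"
  shows "G \<tau> u t = z t - z (t - \<tau>)"
proof -
  have FTC: "(u has_integral z t - z (t - \<tau>)) {t - \<tau>..t}"
  proof (rule abs_continuous_FTC[OF _ abs_continuous_on_Lipschitz N])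
    show "\<bar>z t - z s\<bar> \<le> B * \<bar>t - s\<bar>" for s t by (rule lip)
    show "(z has_real_derivative u x) (at x within {t - \<tau>..t})" if "x \<in> {t - \<tau>..t} - N" for x
      by (rule has_field_derivative_at_within[OF der]) (use that in auto)
  qed (use tau in simp)
  let ?u = "\<lambda>t. if t \<in> N then 0 else u t"
  have B: "0 \<le> B" using lip[of 1 0] by simp
  have "?u integrable_on {t - \<tau>..t}"
    by (rule integrable_spike[OF has_integral_integrable[OF FTC] N]) auto
  then have "?u absolutely_integrable_on {t - \<tau>..t}"
    by (intro measurable_bounded_by_integrable_imp_absolutely_integrable[OF integrable_imp_measurable _ integrable_const_ivl[of B]])
       (use bnd B in auto)
  then have "u absolutely_integrable_on {t - \<tau>..t}"
    by (rule absolutely_integrable_spike[OF _ N]) auto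
  then have "integrable (lebesgue_on {t - \<tau>..t}) u" by (rule absolutely_integrable_imp_integrable) simp
  then show ?thesis unfolding G_def using lebesgue_integral_eq_integral[of "{t - \<tau>..t}" u] integral_unique[OF FTC] by simp
qed

section \<open>Bounds for the output\<close>

context delayed_feedback_trajectory begin

lemma v_square_integrable_past:
  assumes "0 \<le> T"
  shows "(\<lambda>t. (v t)\<^sup>2) integrable_on {-\<tau>..T}" "integral {-\<tau>..T} (\<lambda>t. (v t)\<^sup>2) = integral {0..T} (\<lambda>t. (v t)\<^sup>2)"
proof -
  have left: "((\<lambda>t. (v t)\<^sup>2) has_integral 0) {-\<tau>..0}"
    by (rule has_integral_spike[OF negligible_sing[of 0] _ has_integral_0]) (use v0 in auto)
  have right: "((\<lambda>t. (v t)\<^sup>2) has_integral integral {0..T} (\<lambda>t. (v t)\<^sup>2)) {0..T}"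
    by (rule integrable_integral[OF v_square_integrable])
  have "((\<lambda>t. (v t)\<^sup>2) has_integral 0 + integral {0..T} (\<lambda>t. (v t)\<^sup>2)) {-\<tau>..T}"
    by (rule Henstock_Kurzweil_Integration.has_integral_combine[OF _ _ left right]) (use tau_pos assms in auto)
  then show "(\<lambda>t. (v t)\<^sup>2) integrable_on {-\<tau>..T}" "integral {-\<tau>..T} (\<lambda>t. (v t)\<^sup>2) = integral {0..T} (\<lambda>t. (v t)\<^sup>2)"
    by (auto simp: has_integral_integrable integral_unique)
qed

text \<open>
  The Cauchy-Schwarz inequality, obtained from the nonnegative integral of the squared deviation of \<open>v\<close> from its
  mean \<open>m\<close> over the delay interval.
\<close>

lemma increment_square_le:
  assumes "0 \<le> t"
  shows "(z t - z (t - \<tau>))\<^sup>2 \<le> \<tau> * integral {t - \<tau>..t} (\<lambda>s. (v s)\<^sup>2)"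
proof -
  define m where "m = (z t - z (t - \<tau>)) / \<tau>"
  have FTC: "(v has_integral z t - z (t - \<tau>)) {t - \<tau>..t}"
  proof (rule abs_continuous_FTC[OF _ _ N(1)])
    show "abs_continuous_on {t - \<tau>..t} z" using z_ac[of _ 0] by simp
    show "(z has_real_derivative v x) (at x within {t - \<tau>..t})" if "x \<in> {t - \<tau>..t} - N" for x
      by (rule has_field_derivative_at_within[OF z_der]) (use that in auto)
  qed (use tau_pos in simp)
  have sq: "((\<lambda>s. (v s)\<^sup>2) has_integral integral {t - \<tau>..t} (\<lambda>s. (v s)\<^sup>2)) {t - \<tau>..t}"
    by (intro integrable_integral integrable_on_subinterval[OF v_square_integrable_past(1)[OF assms]]) (use assms in auto)
  have "((\<lambda>s. (v s)\<^sup>2 - 2 * m * v s + m\<^sup>2) has_integral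
      integral {t - \<tau>..t} (\<lambda>s. (v s)\<^sup>2) - 2 * m * (z t - z (t - \<tau>)) + m\<^sup>2 * \<tau>) {t - \<tau>..t}"
    using has_integral_const_real[of "m\<^sup>2" "t - \<tau>" t] tau_pos
    by (intro has_integral_add has_integral_diff has_integral_mult_right sq FTC) (simp add: mult.commute)
  then have "0 \<le> integral {t - \<tau>..t} (\<lambda>s. (v s)\<^sup>2) - 2 * m * (z t - z (t - \<tau>)) + m\<^sup>2 * \<tau>"
  proof (rule has_integral_nonneg)
    fix s
    have "0 \<le> (v s - m)\<^sup>2" by simp
    then show "0 \<le> (v s)\<^sup>2 - 2 * m * v s + m\<^sup>2" by (simp add: power2_diff mult_ac)
  qed
  also have "\<dots> = integral {t - \<tau>..t} (\<lambda>s. (v s)\<^sup>2) - (z t - z (t - \<tau>))\<^sup>2 / \<tau>"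
    using tau_pos by (simp add: m_def power2_eq_square field_simps)
  finally show ?thesis using tau_pos by (simp add: field_simps)
qed

text \<open>
  With \<open>E t\<close> the energy of \<open>v\<close> up to time \<open>t\<close>, the preceding bound is \<open>\<tau> (E t - E (t - \<tau>))\<close>. Integrated over
  \<open>[0, T]\<close> this leaves at most the integral of \<open>E\<close> over one delay interval.
\<close>

lemma increment_energy:
  assumes T: "0 \<le> T"
  shows "integral {0..T} (\<lambda>t. (z t - z (t - \<tau>))\<^sup>2) \<le> \<tau>\<^sup>2 * integral {0..T} (\<lambda>t. (v t)\<^sup>2)"
proof -
  define E where "E t = integral {-\<tau>..t} (\<lambda>t. (v t)\<^sup>2)" for t
  note int = v_square_integrable_past(1)[OF T]
  have Ec: "continuous_on {-\<tau>..T} E" unfolding E_def by (rule indefinite_integral_continuous_1[OF int])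
  have Emono: "E s \<le> E t" if "s \<le> t" "t \<le> T" for s t
    unfolding E_def
    by (rule integral_subset_le) (use that in \<open>auto intro!: integrable_on_subinterval[OF int]\<close>)
  have E0: "0 \<le> E t" if "t \<le> T" for t
    unfolding E_def by (rule integral_nonneg) (use that in \<open>auto intro!: integrable_on_subinterval[OF int]\<close>)
  have Ei: "E integrable_on {a..b}" if "-\<tau> \<le> a" "b \<le> T" for a b
    by (intro integrable_continuous_real continuous_on_subset[OF Ec]) (use that in auto)
  have Esc: "continuous_on {0..T} (\<lambda>t. E (t - \<tau>))"
    by (rule continuous_on_compose2[OF Ec]) (use tau_pos in \<open>auto intro!: continuous_intros\<close>)
  have "integral {0..T} (\<lambda>t. (z t - z (t - \<tau>))\<^sup>2) \<le> integral {0..T} (\<lambda>t. \<tau> * (E t - E (t - \<tau>)))"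
  proof (rule integral_le)
    show "(\<lambda>t. (z t - z (t - \<tau>))\<^sup>2) integrable_on {0..T}"
      by (intro integrable_continuous_real continuous_intros z_cont z_delayed_cont)
    show "(\<lambda>t. \<tau> * (E t - E (t - \<tau>))) integrable_on {0..T}"
      by (intro integrable_continuous_real continuous_intros Esc continuous_on_subset[OF Ec]) (use tau_pos in auto)
    fix t assume t: "t \<in> {0..T}"
    have "integral {-\<tau>..t - \<tau>} (\<lambda>t. (v t)\<^sup>2) + integral {t - \<tau>..t} (\<lambda>t. (v t)\<^sup>2) = integral {-\<tau>..t} (\<lambda>t. (v t)\<^sup>2)"
      using t tau_pos by (intro Henstock_Kurzweil_Integration.integral_combine integrable_on_subinterval[OF int]) auto
    then have "integral {t - \<tau>..t} (\<lambda>t. (v t)\<^sup>2) = E t - E (t - \<tau>)" by (simp add: E_def)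
    then show "(z t - z (t - \<tau>))\<^sup>2 \<le> \<tau> * (E t - E (t - \<tau>))" using increment_square_le[of t] t by simp
  qed
  also have "\<dots> = \<tau> * (integral {0..T} E - integral {0..T} (\<lambda>t. E (t - \<tau>)))"
    using Ei[of 0 T] tau_pos integrable_continuous_real[OF Esc]
    by (simp add: Henstock_Kurzweil_Integration.integral_diff)
  also have "integral {0..T} (\<lambda>t. E (t - \<tau>)) = integral {-\<tau>..T - \<tau>} E"
    using integral_shift_real_ivl[of "-\<tau>" "-\<tau>" "T - \<tau>" E] by simp
  also have "\<tau> * (integral {0..T} E - integral {-\<tau>..T - \<tau>} E) \<le> \<tau> * (\<tau> * E T)"
  proof (rule mult_left_mono)
    have "integral {-\<tau>..0} E + integral {0..T} E = integral {-\<tau>..T} E"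
      using T tau_pos by (intro Henstock_Kurzweil_Integration.integral_combine Ei) auto
    moreover have "integral {-\<tau>..T - \<tau>} E + integral {T - \<tau>..T} E = integral {-\<tau>..T} E"
      using T tau_pos by (intro Henstock_Kurzweil_Integration.integral_combine Ei) auto
    moreover have "0 \<le> integral {-\<tau>..0} E" using T by (intro integral_nonneg Ei E0) auto
    moreover have "integral {T - \<tau>..T} E \<le> integral {T - \<tau>..T} (\<lambda>_. E T)"
      using T tau_pos by (intro integral_le Ei integrable_const_ivl Emono) auto
    moreover have "integral {T - \<tau>..T} (\<lambda>_. E T) = \<tau> * E T" using tau_pos by simp
    ultimately show "integral {0..T} E - integral {-\<tau>..T - \<tau>} E \<le> \<tau> * E T" by linarith
  qed (use tau_pos in simp)
  also have "E T = integral {0..T} (\<lambda>t. (v t)\<^sup>2)" unfolding E_def by (rule v_square_integrable_past(2)[OF T])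
  finally show ?thesis by (simp add: power2_eq_square mult_ac)
qed

lemma v_delayed_square:
  assumes T: "0 \<le> T"
  shows "(\<lambda>t. (v (t - \<tau>))\<^sup>2) integrable_on {0..T}"
    "integral {0..T} (\<lambda>t. (v (t - \<tau>))\<^sup>2) \<le> integral {0..T} (\<lambda>t. (v t)\<^sup>2)"
proof -
  note int = v_square_integrable_past(1)[OF T]
  have i: "(\<lambda>t. (v t)\<^sup>2) integrable_on {-\<tau>..T - \<tau>}"
    by (rule integrable_on_subinterval[OF int]) (use tau_pos in auto)
  from integrable_shift_real_ivl[OF this, of "-\<tau>"]
  show "(\<lambda>t. (v (t - \<tau>))\<^sup>2) integrable_on {0..T}" by simp
  have "integral {0..T} (\<lambda>t. (v (t - \<tau>))\<^sup>2) = integral {-\<tau>..T - \<tau>} (\<lambda>t. (v t)\<^sup>2)"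
    using integral_shift_real_ivl[of "-\<tau>" "-\<tau>" "T - \<tau>" "\<lambda>t. (v t)\<^sup>2"] by simp
  also have "\<dots> \<le> integral {-\<tau>..T} (\<lambda>t. (v t)\<^sup>2)"
    by (rule integral_subset_le[OF _ i int]) (use tau_pos in auto)
  finally show "integral {0..T} (\<lambda>t. (v (t - \<tau>))\<^sup>2) \<le> integral {0..T} (\<lambda>t. (v t)\<^sup>2)"
    using v_square_integrable_past(2)[OF T] by simp
qed

lemma output_ac: "abs_continuous_on {0..T} (\<lambda>t. f t + (z t - z (t - \<tau>)))"
proof -
  have "abs_continuous_on {0..T} (\<lambda>t. z t - z (t - \<tau>))"
  proof (rule abs_continuous_on_Lipschitz)
    fix s t show "\<bar>(z t - z (t - \<tau>)) - (z s - z (s - \<tau>))\<bar> \<le> 2 * L * \<bar>t - s\<bar>"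
      using z_lip[of t s] z_lip[of "t - \<tau>" "s - \<tau>"] by (simp add: abs_le_iff)
  qed
  then show ?thesis by (rule abs_continuous_on_add[OF f_ac])
qed

lemma output_square_le:
  assumes T: "0 \<le> T"
  shows "integral {0..T} (\<lambda>t. (f t + (z t - z (t - \<tau>)))\<^sup>2)
    \<le> 2 * integral {0..T} (\<lambda>t. (f t)\<^sup>2) + 2 * \<tau>\<^sup>2 * integral {0..T} (\<lambda>t. (v t)\<^sup>2)"
proof -
  have i: "(\<lambda>t. (z t - z (t - \<tau>))\<^sup>2) integrable_on {0..T}"
    by (intro integrable_continuous_real continuous_intros z_cont z_delayed_cont)
  have "integral {0..T} (\<lambda>t. (f t + (z t - z (t - \<tau>)))\<^sup>2) \<le> integral {0..T} (\<lambda>t. 2 * (f t)\<^sup>2 + 2 * (z t - z (t - \<tau>))\<^sup>2)"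
  proof (rule integral_le)
    show "(\<lambda>t. (f t + (z t - z (t - \<tau>)))\<^sup>2) integrable_on {0..T}"
      by (intro integrable_continuous_real continuous_intros z_cont z_delayed_cont f_cont)
    show "(\<lambda>t. 2 * (f t)\<^sup>2 + 2 * (z t - z (t - \<tau>))\<^sup>2) integrable_on {0..T}"
      by (intro integrable_add integrable_on_mult_right i f_square_integrable)
    show "(f t + (z t - z (t - \<tau>)))\<^sup>2 \<le> 2 * (f t)\<^sup>2 + 2 * (z t - z (t - \<tau>))\<^sup>2" for t
      using sum_squares_bound[of "f t" "z t - z (t - \<tau>)"] by (simp add: power2_sum)
  qed
  also have "\<dots> = 2 * integral {0..T} (\<lambda>t. (f t)\<^sup>2) + 2 * integral {0..T} (\<lambda>t. (z t - z (t - \<tau>))\<^sup>2)"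
    by (rule integral_unique) (intro has_integral_add has_integral_mult_right integrable_integral i f_square_integrable)
  finally show ?thesis using increment_energy[OF T] by simp
qed

lemma output_derivative_abs_int: "(\<lambda>t. f' t + v t - v (t - \<tau>)) absolutely_integrable_on {0..T}"
proof -
  have "(\<lambda>t. f' t - v (t - \<tau>)) absolutely_integrable_on {0..T}"
    using bounded_meas_mult_w'_abs_int[of "\<lambda>_. 1" T 1] by simp
  moreover have "v absolutely_integrable_on {0..T}"
    by (rule measurable_bounded_by_integrable_imp_absolutely_integrable[OF v_meas _ integrable_const_ivl[of L]])
       (use v_bounded in auto)
  ultimately have "(\<lambda>t. (f' t - v (t - \<tau>)) + v t) absolutely_integrable_on {0..T}"
    by (rule set_integral_add(1))
  then show ?thesis by (simp add: algebra_simps)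
qed

lemma output_derivative_square:
  assumes T: "0 \<le> T"
  shows "(\<lambda>t. (f' t + v t - v (t - \<tau>))\<^sup>2) integrable_on {0..T}"
    "integral {0..T} (\<lambda>t. (f' t + v t - v (t - \<tau>))\<^sup>2)
     \<le> 3 * integral {0..T} (\<lambda>t. (f' t)\<^sup>2) + 6 * integral {0..T} (\<lambda>t. (v t)\<^sup>2)"
proof -
  let ?B = "\<lambda>t. 3 * (f' t)\<^sup>2 + 3 * (v t)\<^sup>2 + 3 * (v (t - \<tau>))\<^sup>2"
  have le: "(f' t + v t - v (t - \<tau>))\<^sup>2 \<le> ?B t" for t
  proof -
    have "(a + b - c)\<^sup>2 \<le> 3 * a\<^sup>2 + 3 * b\<^sup>2 + 3 * c\<^sup>2" for a b c :: real
    proof -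
      have "3 * a\<^sup>2 + 3 * b\<^sup>2 + 3 * c\<^sup>2 - (a + b - c)\<^sup>2 = (a - b)\<^sup>2 + (a + c)\<^sup>2 + (b + c)\<^sup>2"
        by (simp add: power2_eq_square algebra_simps)
      moreover have "0 \<le> (a - b)\<^sup>2 + (a + c)\<^sup>2 + (b + c)\<^sup>2" by simp
      ultimately show ?thesis by linarith
    qed
    then show ?thesis .
  qed
  have Bi: "(?B has_integral 3 * integral {0..T} (\<lambda>t. (f' t)\<^sup>2) + 3 * integral {0..T} (\<lambda>t. (v t)\<^sup>2)
      + 3 * integral {0..T} (\<lambda>t. (v (t - \<tau>))\<^sup>2)) {0..T}"
    by (intro has_integral_add has_integral_mult_right integrable_integral f'_square v_square_integrable
        v_delayed_square(1)[OF T])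
  show i: "(\<lambda>t. (f' t + v t - v (t - \<tau>))\<^sup>2) integrable_on {0..T}"
  proof (rule measurable_bounded_by_integrable_imp_integrable[OF _ has_integral_integrable[OF Bi]])
    have "(\<lambda>t. f' t + v t - v (t - \<tau>)) \<in> borel_measurable (lebesgue_on {0..T})"
      using output_derivative_abs_int by (intro integrable_imp_measurable set_lebesgue_integral_eq_integral(1))
    then show "(\<lambda>t. (f' t + v t - v (t - \<tau>))\<^sup>2) \<in> borel_measurable (lebesgue_on {0..T})"
      by (rule borel_measurable_power)
  qed (use le in auto)
  have "integral {0..T} (\<lambda>t. (f' t + v t - v (t - \<tau>))\<^sup>2) \<le> 3 * integral {0..T} (\<lambda>t. (f' t)\<^sup>2) + 3 * integral {0..T} (\<lambda>t. (v t)\<^sup>2)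
      + 3 * integral {0..T} (\<lambda>t. (v (t - \<tau>))\<^sup>2)"
    by (rule has_integral_le[OF integrable_integral[OF i] Bi]) (rule le)
  then show "integral {0..T} (\<lambda>t. (f' t + v t - v (t - \<tau>))\<^sup>2)
     \<le> 3 * integral {0..T} (\<lambda>t. (f' t)\<^sup>2) + 6 * integral {0..T} (\<lambda>t. (v t)\<^sup>2)"
    using v_delayed_square(2)[OF T] by simp
qed

lemma output_derivative:
  assumes y: "\<And>t. 0 \<le> t \<Longrightarrow> y t = f t + (z t - z (t - \<tau>))"
    and t: "0 < t" "t \<notin> N \<union> (+) \<tau> ` N"
  shows "(y has_real_derivative f' t + v t - v (t - \<tau>)) (at t)"
proof -
  have "t \<notin> N" "t - \<tau> \<notin> N" using t(2) by (auto simp: image_iff algebra_simps dest: bspec)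
  then have "((\<lambda>t. z t + w t) has_real_derivative v t + (f' t - v (t - \<tau>))) (at t)"
    by (intro DERIV_add z_der w_der t(1)) auto
  then have "((\<lambda>t. z t + w t) has_real_derivative f' t + v t - v (t - \<tau>)) (at t)"
    by (simp add: algebra_simps)
  then show ?thesis
    by (rule has_field_derivative_transform_within_open[where S = "{0<..}"])
       (use t y in \<open>auto simp: w_def\<close>)
qed

lemma negligible_shifted: "negligible (N \<union> (+) \<tau> ` N)"
  using N(1) by (intro negligible_Un negligible_translation)

lemma v_in_L2e:
  assumes u: "signal u" and N': "negligible N'" and eq: "\<And>t. 0 \<le> t \<Longrightarrow> t \<notin> N' \<Longrightarrow> u t = v t"
  shows "u \<in> L2e"
proof (rule L2e_cong_negligible[OF _ v_square_integrable N' eq u])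
  show "v absolutely_integrable_on {0..T}" for T
    by (rule measurable_bounded_by_integrable_imp_absolutely_integrable[OF v_meas _ integrable_const_ivl[of L]])
       (use v_bounded in auto)
qed

lemma output_in_W2e:
  assumes y: "\<And>t. 0 \<le> t \<Longrightarrow> y t = f t + (z t - z (t - \<tau>))" and sig: "signal y"
  shows "y \<in> W2e"
proof -
  have ac: "abs_continuous_on {0..T} y" for T
  proof (rule abs_continuous_on_dominated[OF output_ac output_ac, where C = "1/2"])
    fix s t assume "s \<in> {0..T}" "t \<in> {0..T}"
    then show "\<bar>y t - y s\<bar> \<le> 1/2 * (\<bar>f t + (z t - z (t - \<tau>)) - (f s + (z s - z (s - \<tau>)))\<bar>
        + \<bar>f t + (z t - z (t - \<tau>)) - (f s + (z s - z (s - \<tau>)))\<bar>)"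
      using y[of s] y[of t] by simp
  qed
  have yc: "continuous_on {0..T} y" for T by (rule abs_continuous_on_imp_continuous_on[OF ac])
  have nz: "t \<notin> N \<union> (+) \<tau> ` N \<Longrightarrow> 0 \<le> t \<Longrightarrow> 0 < t" for t using N(2) by (cases "t = 0") auto
  have "AE t in lebesgue_on {0..}. y differentiable (at t)"
    unfolding AE_halfline_iff
  proof (intro exI[of _ "N \<union> (+) \<tau> ` N"] conjI allI impI)
    fix t assume "0 \<le> t" "t \<notin> N \<union> (+) \<tau> ` N"
    then show "y differentiable (at t)"
      using output_derivative[OF y, of t] nz by (auto simp: real_differentiable_def)
  qed (rule negligible_shifted)
  moreover have "y \<in> L2e"
    unfolding L2e_iff
  proof (intro conjI allI impI sig)
    fix T show "y \<in> borel_measurable (lebesgue_on {0..T})"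
      by (rule continuous_imp_measurable_on_sets_lebesgue[OF yc]) simp
    show "(\<lambda>t. (y t)\<^sup>2) integrable_on {0..T}" by (intro integrable_continuous_real continuous_intros yc)
  qed
  moreover have "deriv y \<in> L2e"
  proof (rule L2e_cong_negligible[OF output_derivative_abs_int _ negligible_shifted])
    show "(\<lambda>t. (f' t + v t - v (t - \<tau>))\<^sup>2) integrable_on {0..T}" if "0 < T" for T
      using output_derivative_square(1)[of T] that by simp
    show "deriv y t = f' t + v t - v (t - \<tau>)" if "0 \<le> t" "t \<notin> N \<union> (+) \<tau> ` N" for t
      by (rule DERIV_imp_deriv[OF output_derivative[OF y]]) (use that nz in auto)
    show "signal (deriv y)"
      unfolding signal_def
    proof (intro allI impI)
      fix t :: real assume t: "t < 0"
      have "((\<lambda>_. 0) has_real_derivative 0) (at t)" by simp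
      then have "(y has_real_derivative 0) (at t)"
        by (rule has_field_derivative_transform_within_open[where S = "{..<0}"])
           (use t sig in \<open>auto simp: signal_def\<close>)
      then show "deriv y t = 0" by (rule DERIV_imp_deriv)
    qed
  qed
  ultimately show ?thesis using ac by (simp add: W2e_def loc_abs_continuous_def)
qed

text \<open>
  With \<open>X\<close> the squared norm of the input and \<open>C\<close> the energy gain, \<open>u\<close>, \<open>y\<close> and \<open>y'\<close> contribute \<open>C X\<close>,
  \<open>(2 + 2 \<tau>\<^sup>2 C) X\<close> and \<open>(3 + 6 C) X\<close> to the squared norm of the output.
\<close>

lemma closed_loop_bound:
  assumes f: "f \<in> W2" and f': "f' = deriv f"
    and y: "\<And>t. 0 \<le> t \<Longrightarrow> y t = f t + (z t - z (t - \<tau>))" and yW: "y \<in> W2e"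
    and u: "signal u" and N': "negligible N'" and eq: "\<And>t. 0 \<le> t \<Longrightarrow> t \<notin> N' \<Longrightarrow> u t = v t"
  shows "y \<in> W2" "u \<in> L2"
    "W2_L2_norm (y, u) \<le> sqrt (5 + (2 * \<tau>\<^sup>2 + 7) * energy_gain) * W2_norm f"
proof -
  define X where "X = (W2_norm f)\<^sup>2"
  define C where "C = energy_gain"
  have C: "0 \<le> C" unfolding C_def by (rule energy_gain_nonneg)
  have fL: "f \<in> L2" "deriv f \<in> L2" using f by (auto simp: W2_def)
  have Xeq: "X = (LINT t|lebesgue_on {0..}. (f t)\<^sup>2) + (LINT t|lebesgue_on {0..}. (deriv f t)\<^sup>2)"
    unfolding X_def by (rule W2_norm_square)
  have pos: "0 \<le> (LINT t|lebesgue_on {0..}. (g t)\<^sup>2)" for g :: "real \<Rightarrow> real" by simp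
  have fX: "integral {0..T} (\<lambda>t. (f t)\<^sup>2) \<le> X" "integral {0..T} (\<lambda>t. (f' t)\<^sup>2) \<le> X" for T
    using L2_square_integral_le[OF fL(1), of T] L2_square_integral_le[OF fL(2), of T] pos[of f] pos[of "deriv f"]
    unfolding Xeq f' by linarith+
  have ff: "integral {0..T} (\<lambda>t. (f t)\<^sup>2 + (f' t)\<^sup>2) \<le> X" for T
    using L2_square_integral_le[OF fL(1), of T] L2_square_integral_le[OF fL(2), of T]
      Henstock_Kurzweil_Integration.integral_add[OF f_square_integrable[of T] f'_square[of T]]
    unfolding Xeq f' by linarith
  have vC: "integral {0..T} (\<lambda>t. (v t)\<^sup>2) \<le> C * X" if "1 \<le> T" for T
  proof -
    have "integral {0..T} (\<lambda>t. (v t)\<^sup>2) \<le> C * integral {0..T} (\<lambda>t. (f t)\<^sup>2 + (f' t)\<^sup>2)"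
      unfolding C_def by (rule energy_bound[OF that])
    also have "\<dots> \<le> C * X" by (rule mult_left_mono[OF ff C])
    finally show ?thesis .
  qed
  have uL: "u \<in> L2" "(LINT t|lebesgue_on {0..}. (u t)\<^sup>2) \<le> C * X"
  proof -
    have u2: "integral {0..T} (\<lambda>t. (u t)\<^sup>2) \<le> C * X" if "1 \<le> T" for T
    proof -
      have "integral {0..T} (\<lambda>t. (u t)\<^sup>2) = integral {0..T} (\<lambda>t. (v t)\<^sup>2)"
        by (rule integral_spike[OF N']) (use eq in auto)
      then show ?thesis using vC[OF that] by simp
    qed
    show "u \<in> L2" "(LINT t|lebesgue_on {0..}. (u t)\<^sup>2) \<le> C * X"
      using L2_from_L2e[OF v_in_L2e[OF u N' eq] u2] by auto
  qed
  have yL: "y \<in> L2" "(LINT t|lebesgue_on {0..}. (y t)\<^sup>2) \<le> 2 * X + 2 * \<tau>\<^sup>2 * (C * X)"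
  proof -
    have y2: "integral {0..T} (\<lambda>t. (y t)\<^sup>2) \<le> 2 * X + 2 * \<tau>\<^sup>2 * (C * X)" if "1 \<le> T" for T
    proof -
      have "integral {0..T} (\<lambda>t. (y t)\<^sup>2) = integral {0..T} (\<lambda>t. (f t + (z t - z (t - \<tau>)))\<^sup>2)"
        by (rule Henstock_Kurzweil_Integration.integral_cong) (simp add: y)
      also have "\<dots> \<le> 2 * integral {0..T} (\<lambda>t. (f t)\<^sup>2) + 2 * \<tau>\<^sup>2 * integral {0..T} (\<lambda>t. (v t)\<^sup>2)"
        by (rule output_square_le) (use that in simp)
      also have "\<dots> \<le> 2 * X + 2 * \<tau>\<^sup>2 * (C * X)"
        by (intro add_mono mult_left_mono fX vC that) auto
      finally show ?thesis .
    qed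
    have "y \<in> L2e" using yW by (simp add: W2e_def)
    from L2_from_L2e[OF this y2]
    show "y \<in> L2" "(LINT t|lebesgue_on {0..}. (y t)\<^sup>2) \<le> 2 * X + 2 * \<tau>\<^sup>2 * (C * X)" by auto
  qed
  have dL: "deriv y \<in> L2" "(LINT t|lebesgue_on {0..}. (deriv y t)\<^sup>2) \<le> 3 * X + 6 * (C * X)"
  proof -
    have d2: "integral {0..T} (\<lambda>t. (deriv y t)\<^sup>2) \<le> 3 * X + 6 * (C * X)" if "1 \<le> T" for T
    proof -
      have "integral {0..T} (\<lambda>t. (deriv y t)\<^sup>2) = integral {0..T} (\<lambda>t. (f' t + v t - v (t - \<tau>))\<^sup>2)"
      proof (rule integral_spike[OF negligible_shifted])
        fix t assume t: "t \<in> {0..T} - (N \<union> (+) \<tau> ` N)"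
        then have "0 < t" using N(2) by (cases "t = 0") auto
        then have "deriv y t = f' t + v t - v (t - \<tau>)"
          using t by (intro DERIV_imp_deriv output_derivative[OF y]) auto
        then show "(f' t + v t - v (t - \<tau>))\<^sup>2 = (deriv y t)\<^sup>2" by simp
      qed
      also have "\<dots> \<le> 3 * integral {0..T} (\<lambda>t. (f' t)\<^sup>2) + 6 * integral {0..T} (\<lambda>t. (v t)\<^sup>2)"
        by (rule output_derivative_square(2)) (use that in simp)
      also have "\<dots> \<le> 3 * X + 6 * (C * X)"
        by (intro add_mono mult_left_mono fX vC that) auto
      finally show ?thesis .
    qed
    have "deriv y \<in> L2e" using yW by (simp add: W2e_def)
    from L2_from_L2e[OF this d2]
    show "deriv y \<in> L2" "(LINT t|lebesgue_on {0..}. (deriv y t)\<^sup>2) \<le> 3 * X + 6 * (C * X)" by auto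
  qed
  show "y \<in> W2" using yW yL(1) dL(1) by (simp add: W2_def W2e_def)
  show "u \<in> L2" by (rule uL(1))
  have "(W2_L2_norm (y, u))\<^sup>2 = (W2_norm y)\<^sup>2 + (L2_norm u)\<^sup>2"
    unfolding W2_L2_norm_def by simp
  also have "\<dots> \<le> (2 * X + 2 * \<tau>\<^sup>2 * (C * X)) + (3 * X + 6 * (C * X)) + C * X"
    unfolding W2_norm_square L2_norm_square by (intro add_mono yL(2) dL(2) uL(2))
  also have "\<dots> = (5 + (2 * \<tau>\<^sup>2 + 7) * C) * X" by (simp add: algebra_simps)
  also have "\<dots> = (sqrt (5 + (2 * \<tau>\<^sup>2 + 7) * C) * W2_norm f)\<^sup>2"
    using C by (simp add: X_def power_mult_distrib)
  finally show "W2_L2_norm (y, u) \<le> sqrt (5 + (2 * \<tau>\<^sup>2 + 7) * energy_gain) * W2_norm f"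
    unfolding C_def[symmetric]
    by (rule power2_le_imp_le) (use C in \<open>auto simp: W2_norm_def intro!: mult_nonneg_nonneg\<close>)
qed

end

section \<open>The closed loop\<close>

context delayed_feedback begin

lemma trajectory_of_derivative:
  assumes f: "f \<in> W2" and z0: "\<And>t. t \<le> 0 \<Longrightarrow> z t = 0" and ac: "\<And>T. abs_continuous_on {0..T} z"
    and N0: "negligible N0" and der: "\<And>t. 0 \<le> t \<Longrightarrow> t \<notin> N0 \<Longrightarrow>
      (z has_real_derivative rate (z t) (f t - z (t - \<tau>))) (at t)"
  shows "\<exists>N. N0 \<subseteq> N \<and> delayed_feedback_trajectory \<tau> p k L \<phi> f (deriv f) z
      (\<lambda>t. if 0 \<le> t then rate (z t) (f t - z (t - \<tau>)) else 0) N"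
proof -
  obtain N1 where N1: "negligible N1" "\<And>t. 0 \<le> t \<Longrightarrow> t \<notin> N1 \<Longrightarrow> (f has_real_derivative deriv f t) (at t)"
    using W2_trajectory_input(4)[OF f] by blast
  let ?N = "insert 0 (N0 \<union> N1)"
  have tr: "delayed_feedback_trajectory \<tau> p k L \<phi> f (deriv f) z
      (\<lambda>t. if 0 \<le> t then rate (z t) (f t - z (t - \<tau>)) else 0) ?N"
  proof (intro delayed_feedback_trajectory.intro delayed_feedback_axioms delayed_feedback_trajectory_axioms.intro)
    show "negligible ?N" using N0 N1 by (simp add: negligible_Un)
    show "\<bar>z s - z t\<bar> \<le> L * \<bar>s - t\<bar>" for s t
      by (rule Lipschitz_from_derivative[OF N0 ac z0 der rate_bounded])
    show "(z has_real_derivative (if 0 \<le> t then rate (z t) (f t - z (t - \<tau>)) else 0)) (at t)" if t: "t \<notin> ?N" for t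
    proof (cases "0 \<le> t")
      case True then show ?thesis using der[of t] t by simp
    next
      case False
      have "((\<lambda>_. 0) has_real_derivative 0) (at t)" by simp
      then have "(z has_real_derivative 0) (at t)"
        by (rule has_field_derivative_transform_within_open[where S = "{..<0}"]) (use False z0 in auto)
      then show ?thesis using False by simp
    qed
  qed (use W2_trajectory_input[OF f] N1 z0 in auto)
  show ?thesis by (intro exI[of _ ?N] conjI tr) auto
qed

lemma closed_loop_exists:
  assumes f: "f \<in> W2"
  shows "\<exists>y u z. y \<in> W2e \<and> u \<in> L2e \<and> (\<forall>t\<ge>0. y t = G \<tau> u t + f t) \<and> signal u \<and> signal z \<and>
    loc_abs_continuous z \<and> z 0 = 0 \<and>
    (AE t in lebesgue_on {0..}. (z has_real_derivative rate (z t) (y t - z t)) (at t)) \<and>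
    (AE t in lebesgue_on {0..}. (z has_real_derivative u t) (at t))"
proof -
  have f_cont: "continuous_on {0..} f"
    unfolding continuous_on_eq_continuous_within
  proof
    fix t :: real assume t: "t \<in> {0..}"
    have "continuous_on {0..t + 1} f"
      by (rule abs_continuous_on_imp_continuous_on[OF W2_trajectory_input(1)[OF f]])
    then have "continuous (at t within {0..t + 1}) f"
      using t by (simp add: continuous_on_eq_continuous_within)
    moreover have "at t within {0..t + 1} = at t within {0..}"
      by (rule at_within_nhd[of _ "{..<t + 1}"]) (use t in auto)
    ultimately show "continuous (at t within {0..}) f" by (simp add: continuous_within)
  qed
  define z where "z = solution f"
  have z0: "z t = 0" if "t \<le> 0" for t using that by (simp add: z_def solution_nonpos)
  have zlip: "\<bar>z s - z t\<bar> \<le> 2 * L * \<bar>s - t\<bar>" for s t unfolding z_def by (rule solution_lip[OF f_cont])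
  have zac: "abs_continuous_on S z" for S by (rule abs_continuous_on_Lipschitz) (rule zlip)
  obtain E where E: "countable E" "\<And>t. 0 < t \<Longrightarrow> t \<notin> E \<Longrightarrow> (z has_real_derivative rate (z t) (f t - z (t - \<tau>))) (at t)"
    unfolding z_def using solution_der[OF f_cont] by blast
  have N0: "negligible (insert 0 E)" using countable_imp_negligible[OF E(1)] by simp
  have der: "(z has_real_derivative rate (z t) (f t - z (t - \<tau>))) (at t)" if "0 \<le> t" "t \<notin> insert 0 E" for t
    using E(2)[of t] that by (cases "t = 0") auto
  define u where "u t = (if 0 \<le> t then rate (z t) (f t - z (t - \<tau>)) else 0)" for t
  define y where "y t = (if 0 \<le> t then f t + (z t - z (t - \<tau>)) else 0)" for t
  obtain N where N: "insert 0 E \<subseteq> N" and "delayed_feedback_trajectory \<tau> p k L \<phi> f (deriv f) z u N"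
    using trajectory_of_derivative[OF f z0 zac N0 der] unfolding u_def[abs_def] by blast
  then interpret tr: delayed_feedback_trajectory \<tau> p k L \<phi> f "deriv f" z u N by simp
  have "y \<in> W2e" by (rule tr.output_in_W2e) (auto simp: y_def signal_def)
  moreover have "u \<in> L2e" by (rule tr.v_in_L2e[of u "{}"]) (auto simp: u_def signal_def)
  moreover have "y t = G \<tau> u t + f t" if "0 \<le> t" for t
    using G_of_derivative[OF tau_pos tr.N(1) tr.z_lip tr.z_der tr.v_bounded, of t] that by (simp add: y_def)
  moreover have "signal u" "signal z" using z0 by (auto simp: signal_def u_def)
  moreover have "loc_abs_continuous z" "z 0 = 0" using zac z0 by (auto simp: loc_abs_continuous_def)
  moreover have "AE t in lebesgue_on {0..}. (z has_real_derivative rate (z t) (y t - z t)) (at t)"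
    unfolding AE_halfline_iff using N0 der by (intro exI[of _ "insert 0 E"]) (simp add: y_def)
  moreover have "AE t in lebesgue_on {0..}. (z has_real_derivative u t) (at t)"
    unfolding AE_halfline_iff using N0 der by (intro exI[of _ "insert 0 E"]) (simp add: u_def)
  ultimately show ?thesis by blast
qed

text \<open>
  The signal \<open>u\<close> is prescribed almost everywhere, as the derivative of \<open>z\<close>. That determines \<open>G u\<close>, hence \<open>y - z\<close>,
  and identifies \<open>u\<close> with the rate of a trajectory up to a null set.
\<close>

lemma closed_loop_stable:
  assumes f: "f \<in> W2" and yW: "y \<in> W2e" and y: "\<And>t. 0 \<le> t \<Longrightarrow> y t = G \<tau> u t + f t"
    and u: "signal u" and z: "signal z" "loc_abs_continuous z" "z 0 = 0"
    and dz: "AE t in lebesgue_on {0..}. (z has_real_derivative rate (z t) (y t - z t)) (at t)"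
    and du: "AE t in lebesgue_on {0..}. (z has_real_derivative u t) (at t)"
  shows "y \<in> W2" "u \<in> L2"
    "W2_L2_norm (y, u) \<le> sqrt (5 + (2 * \<tau>\<^sup>2 + 7) * energy_gain) * W2_norm f"
proof -
  obtain N1 where N1: "negligible N1" "\<And>t. 0 \<le> t \<Longrightarrow> t \<notin> N1 \<Longrightarrow> (z has_real_derivative rate (z t) (y t - z t)) (at t)"
    using dz unfolding AE_halfline_iff by blast
  obtain N2 where N2: "negligible N2" "\<And>t. 0 \<le> t \<Longrightarrow> t \<notin> N2 \<Longrightarrow> (z has_real_derivative u t) (at t)"
    using du unfolding AE_halfline_iff by blast
  define M where "M = N1 \<union> N2"
  have M: "negligible M" using N1 N2 by (simp add: M_def negligible_Un)
  have z0: "z t = 0" if "t \<le> 0" for t using that z by (cases "t = 0") (auto simp: signal_def)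
  have zac: "abs_continuous_on {0..T} z" for T
  proof -
    have "abs_continuous_on {0..max 1 T} z" using z(2) by (simp add: loc_abs_continuous_def)
    then show ?thesis by (rule abs_continuous_on_subset) auto
  qed
  have zlip: "\<bar>z s - z t\<bar> \<le> L * \<bar>s - t\<bar>" for s t
    by (rule Lipschitz_from_derivative[OF N1(1) zac z0 N1(2) rate_bounded])
  have u_eq: "u t = rate (z t) (y t - z t)" if "0 \<le> t" "t \<notin> M" for t
    using DERIV_unique[OF N2(2)[of t] N1(2)[of t]] that by (auto simp: M_def)
  have der_u: "(z has_real_derivative u t) (at t)" if "t \<notin> M" for t
  proof (cases "0 \<le> t")
    case True then show ?thesis using N2(2) that by (simp add: M_def)
  next
    case False
    have "((\<lambda>_. 0) has_real_derivative 0) (at t)" by simp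
    then have "(z has_real_derivative 0) (at t)"
      by (rule has_field_derivative_transform_within_open[where S = "{..<0}"]) (use False z0 in auto)
    then show ?thesis using False u by (simp add: signal_def)
  qed
  have u_bound: "\<bar>u t\<bar> \<le> L" if "t \<notin> M" for t
    using u_eq[of t] that rate_bounded u L_nonneg by (cases "0 \<le> t") (auto simp: signal_def)
  have y_eq: "y t = f t + (z t - z (t - \<tau>))" if "0 \<le> t" for t
    using y[OF that] G_of_derivative[OF tau_pos M zlip der_u u_bound, of t] by simp
  then have w_eq: "y t - z t = f t - z (t - \<tau>)" if "0 \<le> t" for t using that by simp
  have der: "(z has_real_derivative rate (z t) (f t - z (t - \<tau>))) (at t)" if "0 \<le> t" "t \<notin> M" for t
    using N1(2)[of t] that w_eq[of t] by (simp add: M_def)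
  define v where "v t = (if 0 \<le> t then rate (z t) (f t - z (t - \<tau>)) else 0)" for t
  obtain N where N: "M \<subseteq> N" and "delayed_feedback_trajectory \<tau> p k L \<phi> f (deriv f) z v N"
    using trajectory_of_derivative[OF f z0 zac M der] unfolding v_def[abs_def] by blast
  then interpret tr: delayed_feedback_trajectory \<tau> p k L \<phi> f "deriv f" z v N by simp
  have uv: "u t = v t" if "0 \<le> t" "t \<notin> M" for t
    using u_eq[OF that] w_eq[OF that(1)] that by (simp add: v_def)
  show "y \<in> W2" "u \<in> L2"
    "W2_L2_norm (y, u) \<le> sqrt (5 + (2 * \<tau>\<^sup>2 + 7) * energy_gain) * W2_norm f"
    using tr.closed_loop_bound[OF f refl y_eq yW u M uv] by auto
qed

end

text \<open>
  For \<open>y \<le> 0\<close> the sector condition follows from \<open>exp (a y) - 1 \<ge> a y\<close> and \<open>a \<le> M/P\<close>. For \<open>0 \<le> y \<le> P\<close> it says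
  that the convex function \<open>exp (a y) - 1\<close> lies below its chord, which ends at the saturation value \<open>M\<close>.
\<close>

lemma congestion_feedback:
  fixes \<tau> \<alpha> xmax c :: real
  assumes tau: "0 < \<tau>" and c: "0 < c" and x: "c < xmax" and a0: "0 < \<alpha>" and am: "\<alpha> < pi * \<alpha>_max xmax c / 2"
  defines "P \<equiv> p0 \<tau> \<alpha> xmax c" and "M \<equiv> xmax / c - 1"
  shows "delayed_feedback \<tau> P (M / P) (max 1 M) (f1 \<tau> \<alpha> xmax c)"
proof -
  define a where "a = \<alpha> / \<tau>"
  have a: "0 < a" using tau a0 by (simp add: a_def)
  have r: "1 < xmax / c" using c x by simp
  have lr: "0 < ln (xmax / c)" using r by simp
  have P: "0 < P" unfolding P_def p0_def using tau a0 lr by simp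
  have aP: "a * P = ln (xmax / c)" using tau a0 by (simp add: a_def P_def p0_def)
  have eP: "exp (a * P) = xmax / c" unfolding aP using r by simp
  have M: "0 < M" using r by (simp add: M_def)
  have phi: "f1 \<tau> \<alpha> xmax c y = min (exp (a * y) - 1) M" for y
    using eP unfolding f1_def a_def P_def M_def by simp
  have aM: "a \<le> M / P"
  proof -
    have "1 + a * P \<le> exp (a * P)" by (rule exp_ge_add_one_self)
    then have "a * P \<le> M" unfolding eP M_def by simp
    then show ?thesis using P by (simp add: pos_le_divide_eq)
  qed
  have up: "min (exp (a * y) - 1) M \<le> M / P * y" if y: "0 \<le> y" for y
  proof (cases "y \<le> P")
    case True
    have "exp ((1 - y / P) *\<^sub>R 0 + (y / P) *\<^sub>R (a * P)) \<le> (1 - y / P) * exp 0 + (y / P) * exp (a * P)"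
      by (rule convex_onD[OF exp_convex]) (use y True P in auto)
    moreover have "(1 - y / P) *\<^sub>R 0 + (y / P) *\<^sub>R (a * P) = a * y" using P by simp
    ultimately have "exp (a * y) \<le> (1 - y / P) + (y / P) * (xmax / c)" by (simp only: eP exp_zero mult_1_right)
    also have "\<dots> = 1 + M / P * y" using P by (simp add: M_def field_simps)
    finally show ?thesis by simp
  next
    case False
    then have "M * 1 \<le> M * (y / P)" using M P by (intro mult_left_mono) auto
    then show ?thesis by simp
  qed
  show ?thesis
  proof
    show "0 < \<tau>" "0 < P" "0 < M / P" using tau P M by auto
    have "M / (\<tau> / \<alpha> * l) * \<tau> = \<alpha> / (l / M)" if "0 < l" for l
      using tau a0 M that by (simp add: field_simps)
    from this[OF lr] have "M / P * \<tau> = \<alpha> / \<alpha>_max xmax c"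
      unfolding P_def p0_def \<alpha>_max_def M_def .
    also have "0 < \<alpha>_max xmax c" unfolding \<alpha>_max_def using lr r by simp
    then have "\<alpha> / \<alpha>_max xmax c < pi / 2" using am by (simp add: field_simps)
    finally show "M / P * \<tau> < pi / 2" .
    show "continuous_on UNIV (f1 \<tau> \<alpha> xmax c)" unfolding phi[abs_def] by (intro continuous_intros)
    fix y
    have neg: "min (exp (a * y) - 1) M \<le> 0 \<and> M / P * y \<le> min (exp (a * y) - 1) M" if y: "y \<le> 0"
    proof -
      have e1: "exp (a * y) \<le> 1" using a y by (simp add: mult_nonneg_nonpos)
      then have "exp (a * y) - 1 \<le> M" using M by linarith
      then have e: "min (exp (a * y) - 1) M = exp (a * y) - 1" by (rule min_absorb1)
      have "M / P * y \<le> a * y" using aM y by (rule mult_right_mono_neg)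
      also have "\<dots> \<le> exp (a * y) - 1" using exp_ge_add_one_self[of "a * y"] by linarith
      finally show ?thesis unfolding e using e1 by linarith
    qed
    have posi: "0 \<le> min (exp (a * y) - 1) M" if "0 \<le> y" using that a M by simp
    show "0 \<le> f1 \<tau> \<alpha> xmax c y * y"
    proof (cases "0 \<le> y")
      case True then show ?thesis unfolding phi using posi by (intro mult_nonneg_nonneg) auto
    next
      case False then show ?thesis unfolding phi using neg by (intro mult_nonpos_nonpos) auto
    qed
    show "\<bar>f1 \<tau> \<alpha> xmax c y\<bar> \<le> M / P * \<bar>y\<bar>"
    proof (cases "0 \<le> y")
      case True
      then have "\<bar>f1 \<tau> \<alpha> xmax c y\<bar> = min (exp (a * y) - 1) M" unfolding phi using posi by (intro abs_of_nonneg)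
      then show ?thesis using up[OF True] True by simp
    next
      case False
      then have n: "min (exp (a * y) - 1) M \<le> 0" "M / P * y \<le> min (exp (a * y) - 1) M" using neg by auto
      then have "\<bar>f1 \<tau> \<alpha> xmax c y\<bar> = - min (exp (a * y) - 1) M" unfolding phi by (intro abs_of_nonpos)
      moreover have "M / P * \<bar>y\<bar> = - (M / P * y)" using False by simp
      ultimately show ?thesis using n(2) by linarith
    qed
    have "- 1 \<le> min (exp (a * y) - 1) M" using M exp_ge_zero[of "a * y"] by (intro min.boundedI) linarith+
    moreover have "min (exp (a * y) - 1) M \<le> M" by simp
    ultimately show "\<bar>f1 \<tau> \<alpha> xmax c y\<bar> \<le> max 1 M" unfolding phi by linarith
  qed
qed

theorem mainTheorem2:
  fixes \<tau> \<alpha> xmax c :: real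
  assumes "\<tau> > 0" and "c > 0" and "xmax > c"
    and "0 < \<alpha>" and "\<alpha> < pi * \<alpha>_max xmax c / 2"
  shows "W2_L2_stable_on_W2 (closed_loop \<tau> \<alpha> xmax c)"
proof -
  interpret delayed_feedback \<tau> "p0 \<tau> \<alpha> xmax c" "(xmax / c - 1) / p0 \<tau> \<alpha> xmax c" "max 1 (xmax / c - 1)" "f1 \<tau> \<alpha> xmax c"
    using assms by (rule congestion_feedback)
  have rate_eq: "rate = fc \<tau> \<alpha> xmax c"
    by (intro ext) (simp add: rate_def fc_def f2_def)
  have loop: "closed_loop \<tau> \<alpha> xmax c f (y, u) \<longleftrightarrow> (\<exists>z. y \<in> W2e \<and> u \<in> L2e \<and> (\<forall>t\<ge>0. y t = G \<tau> u t + f t) \<and>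
    signal u \<and> signal z \<and> loc_abs_continuous z \<and> z 0 = 0 \<and>
    (AE t in lebesgue_on {0..}. (z has_real_derivative rate (z t) (y t - z t)) (at t)) \<and>
    (AE t in lebesgue_on {0..}. (z has_real_derivative u t) (at t)))" for f y u
    unfolding closed_loop_def \<Delta>_def \<Delta>z_def rate_eq by auto
  have stable: "y \<in> W2 \<and> u \<in> L2 \<and> W2_L2_norm (y, u) \<le> sqrt (5 + (2 * \<tau>\<^sup>2 + 7) * energy_gain) * W2_norm f"
    if f: "f \<in> W2" and cl: "closed_loop \<tau> \<alpha> xmax c f (y, u)" for f y u
  proof -
    obtain z where z: "y \<in> W2e" "\<forall>t\<ge>0. y t = G \<tau> u t + f t"
      "signal u" "signal z" "loc_abs_continuous z" "z 0 = 0"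
      "AE t in lebesgue_on {0..}. (z has_real_derivative rate (z t) (y t - z t)) (at t)"
      "AE t in lebesgue_on {0..}. (z has_real_derivative u t) (at t)"
      using cl unfolding loop by blast
    have y_eq: "\<And>t. 0 \<le> t \<Longrightarrow> y t = G \<tau> u t + f t" using z(2) by blast
    show ?thesis using closed_loop_stable[OF f z(1) y_eq z(3-8)] by blast
  qed
  have ex: "\<exists>q. closed_loop \<tau> \<alpha> xmax c f q" if f: "f \<in> W2" for f
  proof -
    obtain y u where "closed_loop \<tau> \<alpha> xmax c f (y, u)" using closed_loop_exists[OF f] unfolding loop by blast
    then show ?thesis by blast
  qed
  have bound: "q \<in> W2 \<times> L2 \<and> W2_L2_norm q \<le> sqrt (5 + (2 * \<tau>\<^sup>2 + 7) * energy_gain) * W2_norm f"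
    if "f \<in> W2" "closed_loop \<tau> \<alpha> xmax c f q" for f q
    using stable[OF that(1)] that(2) by (cases q) auto
  show ?thesis
    unfolding W2_L2_stable_on_W2_def using ex bound by blast
qed

end
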